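(* Let $T$ be a triangulation, with $n\ge 2$ triangles, of a polygon, let $f=(i,k)$ be an arc crossing all diagonals of $T$, drawn from $i$ (bottom) to $k$ (top), and let $G=G_f$ be its labelled snake graph. Let the last (top-most) triangle $\Delta_n$ have vertices $j,k,l$, where $e=(j,l)$ is the last diagonal crossed by $f$, $a=(j,k)$ and $b=(k,l)$ are boundary edges, and $j$ is the top-most (last) fan center; assume $j$ lies to the left of $f$. Let $d=(i,j)$, $c=(i,l)$, and let $\varphi$ be the $\mu$-invariant of the triangle $(i,j,k)$ (with sides $a,d,f$) obtained by flipping $e$ in the quadrilateral $i,l,k,j$. Let $T$ have its default orientation with respect to the direction $i\to k$. Edges and arcs are identified with their super $\lambda$-lengths. Then: (a) $$f=\frac{1}{\mathrm{cross}(f)}\sum_{M\in D(G)}\mathrm{wt}(M).$$ (b) If the polygon has an odd number of triangles, then $$\sqrt{df}\;\varphi=\frac{1}{\mathrm{cross}(f)}\sqrt{\frac{e}{b}}\sum_{M\in D_t(G)}\mathrm{wt}(M)^*,$$ where $x\mapsto x^*$ is the involution toggling $\theta_n$ (the odd variable of the top-most triangle). If there are an even number of triangles, the same formula holds with the sum over $D_r(G)$ instead of $D_t(G)$.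
   Context: **Triangulation.** The polygon has $n+2$ vertices. Let $x_1,\dots,x_{n-1}$ be the diagonals of $T$ in the order in which $f$ crosses them (from $i$ to $k$), and $\Delta_1,\dots,\Delta_n$ the triangles in the order they are met; $\Delta_m$ carries an odd variable ($\mu$-invariant) $\theta_m$. Each side and diagonal of $T$ carries an even variable ($\lambda$-length), denoted by the same letter as the edge. The super algebra $\mathbb{R}[x^{\pm 1/2}\mid\theta_1,\dots,\theta_n]$ is generated by commuting (positive) even variables, their inverses and square roots, and anticommuting odd variables ($\theta_p\theta_q=-\theta_q\theta_p$, $\theta_p^2=0$). Super $\lambda$-lengths have positive body, so inverses and square roots of them make sense (by nilpotent expansion). $\mathrm{cross}(f)=x_1\cdots x_{n-1}$. **Fan centers, default orientation, positive order.** For $2\le m\le n-1$ the fan center of $\Delta_m$ is the common vertex of $x_{m-1}$ and $x_m$; $\Delta_1$ and $\Delta_n$ have the same fan center as $\Delta_2$ and $\Delta_{n-1}$ respectively (if $n=2$, a chosen endpoint of $x_1$ is the only fan center). Let $c_1,\dots,c_N$ be the distinct fan centers in order from $i$ to $k$. Default orientation: the diagonal joining $c_s$ and $c_{s+1}$ is oriented $c_s\to c_{s+1}$; every other diagonal is oriented away from the fan center which is its endpoint. (Boundary orientations are irrelevant.) Positive order on $\theta_1,\dots,\theta_n$: for each $m<n$, if $x_m$ is oriented so that $\Delta_m$ is on its right, then $\theta_m>\theta_s$ for all $s>m$; otherwise $\theta_m<\theta_s$ for all $s>m$. A product of odd variables "in the positive order" is written from left to right with decreasing variables. **Flips (super Ptolemy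 relations).** Consider a quadrilateral whose flipped diagonal $e$ is drawn horizontally and oriented left to right, with sides $a$ (upper left), $b$ (upper right), $c$ (lower right), $d$ (lower left), $\mu$-invariant $\theta$ for the upper triangle and $\sigma$ for the lower triangle. Replacing $e$ by the other diagonal $f$, oriented from bottom to top, gives $$ef=ac+bd+\sqrt{abcd}\,\sigma\theta,\qquad \theta'=\frac{\theta\sqrt{bd}+\sigma\sqrt{ac}}{\sqrt{ef}},\qquad \sigma'=\frac{\sigma\sqrt{bd}-\theta\sqrt{ac}}{\sqrt{ef}},$$ with $\theta'$ the $\mu$-invariant of the new left triangle and $\sigma'$ that of the new right triangle; the orientation of $b$ is reversed, those of $a,c,d$ are unchanged. Two orientations are equivalent if they are related by reversing all three sides of triangles; each such reversal of a triangle negates its $\mu$-invariant. So $\mu$-invariants are defined only up to sign, depending on the representative orientation. The super $\lambda$-length of an arc is the element obtained by applying flips until the arc appears; it is independent of the flip sequence. **The element $\varphi$.** Flipping $x_1,\dots,x_{n-2}$ produces the triangle $(i,j,l)$ with $\mu$-invariant $\sigma$ (with representative orientation in which $e$ is oriented $j\to l$). Flipping $e$ then gives $\varphi=\frac{1}{\sqrt{ef}}(\sqrt{bd}\,\theta_n+\sqrt{ac}\,\sigma)$. **Labelled snake graph $G_f$.** It has one square tile $T_m$ for each $x_m$ ($1\le m\le n-1$). Let $x_m=(p,q)$ with $p$ to the left of $f$ and $q$ to the right, $u$ the third vertex of $\Delta_m$, $v$ the third vertex of $\Delta_{m+1}$. If $m$ is odd, the left, bottom, top, right sides of $T_m$ are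 labelled $(u,p),(u,q),(p,v),(q,v)$; if $m$ is even, they are labelled $(u,q),(u,p),(q,v),(p,v)$. The bottom-left corner of $T_m$ carries $\theta_m$ and its top-right corner carries $\theta_{m+1}$. The third side of $\Delta_{m+1}$ (other than $x_m,x_{m+1}$) labels the right or the top side of $T_m$; accordingly $T_{m+1}$ is attached to the right of, or on top of, $T_m$, glued along the side with this label. **Double dimer covers.** A double dimer cover of $G$ is a multiset $M$ of edges such that every vertex is incident to exactly two elements of $M$ (possibly two copies of one edge). $D(G)$ is the set of all of them; $D_r(G)$ (resp. $D_t(G)$) is the set of those using at least one copy of the right (resp. top) edge of the last tile. Edges used once form cycles; a cycle surrounding tiles $T_s,\dots,T_t$ has weight $\theta_s\theta_{t+1}$. $\mathrm{wt}(M)$ is the product of the square roots of the labels of all elements of $M$ (with multiplicity) times the product of the cycle weights, all odd variables being written in the positive order. **Toggling.** For a monomial $x$ whose odd variables are written in the positive order, $x^*$ is $x$ with $\theta_n$ removed if $x$ contains $\theta_n$, and otherwise is $x$ with $\theta_n$ inserted at the place dictated by the positive order (no sign).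
   Formalization: In (b) the odd variable of each triangle whose fan center lies right of f enters with reversed sign (an equivalent orientation); with the default orientation itself (b) fails once a fan center lies on the right (e.g. n=4). Even variables are arbitrary positive reals. *)

theory Defs
  imports Complex_Main "HOL-Library.Multiset"
begin

section \<open>The real Grassmann algebra\<close>

text \<open>
  An element is a finite real combination of the monomials
  \<open>\<theta>\<^sub>S = \<theta>\<^sub>{s\<^sub>1\<^sub>} \<cdots> \<theta>\<^sub>{s\<^sub>r\<^sub>}\<close> with \<open>S = {s\<^sub>1 < \<cdots> < s\<^sub>r}\<close> a finite set of naturals; \<open>coeff x S\<close> is
  the coefficient of \<open>\<theta>\<^sub>S\<close>.  The even variables (the lambda-lengths of the initial triangulation)
  are treated as positive real variables: an identity between expressions in them is an identity
  in this algebra for all positive real values.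
\<close>

typedef grassmann = "{f :: nat set \<Rightarrow> real. \<exists>N. \<forall>S. f S \<noteq> 0 \<longrightarrow> S \<subseteq> {..<N}}"
  morphisms coeff Abs_grassmann
  by (rule exI[of _ "\<lambda>_. 0"]) simp

setup_lifting type_definition_grassmann

text \<open>\<open>\<theta>\<^sub>A \<theta>\<^sub>B = (-1) ^ inversions A B \<cdot> \<theta>\<^bsub>A \<union> B\<^esub>\<close> for disjoint \<open>A\<close> and \<open>B\<close>.\<close>

definition inversions :: "nat set \<Rightarrow> nat set \<Rightarrow> nat" where
  "inversions A B = card {(a, b). a \<in> A \<and> b \<in> B \<and> b < a}"

lemma inversions_empty: "inversions A {} = 0" "inversions {} B = 0"
  by (simp_all add: inversions_def)

lemma inversions_Un_left:
  assumes "finite A" "finite B" "finite C" "A \<inter> B = {}"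
  shows "inversions (A \<union> B) C = inversions A C + inversions B C"
proof -
  have fin: "finite {(a, b). a \<in> X \<and> b \<in> C \<and> b < a}" if "finite X" for X
    by (rule finite_subset[of _ "X \<times> C"]) (use that assms(3) in auto)
  have "{(a, b). a \<in> A \<union> B \<and> b \<in> C \<and> b < a}
      = {(a, b). a \<in> A \<and> b \<in> C \<and> b < a} \<union> {(a, b). a \<in> B \<and> b \<in> C \<and> b < a}"
    by auto
  then show ?thesis
    unfolding inversions_def using fin assms by (simp add: card_Un_disjoint disjoint_iff)
qed

lemma inversions_Un_right:
  assumes "finite A" "finite B" "finite C" "B \<inter> C = {}"
  shows "inversions A (B \<union> C) = inversions A B + inversions A C"
proof -
  have fin: "finite {(a, b). a \<in> A \<and> b \<in> X \<and> b < a}" if "finite X" for X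
    by (rule finite_subset[of _ "A \<times> X"]) (use that assms(1) in auto)
  have "{(a, b). a \<in> A \<and> b \<in> B \<union> C \<and> b < a}
      = {(a, b). a \<in> A \<and> b \<in> B \<and> b < a} \<union> {(a, b). a \<in> A \<and> b \<in> C \<and> b < a}"
    by auto
  then show ?thesis
    unfolding inversions_def using fin assms by (simp add: card_Un_disjoint disjoint_iff)
qed

definition gmult :: "(nat set \<Rightarrow> real) \<Rightarrow> (nat set \<Rightarrow> real) \<Rightarrow> nat set \<Rightarrow> real" where
  "gmult f g S = (\<Sum>A\<in>Pow S. (- 1) ^ inversions A (S - A) * f A * g (S - A))"

lemma gmult_assoc: "gmult (gmult f g) h S = gmult f (gmult g h) S"
proof (cases "finite S")
  case False
  then show ?thesis by (simp add: gmult_def finite_Pow_iff)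
next
  case True
  define sg where "sg A B = (- 1 :: real) ^ inversions A B" for A B
  have fin: "finite A" if "A \<subseteq> S" for A
    using True that by (rule rev_finite_subset)
  have "gmult (gmult f g) h S
      = (\<Sum>A\<in>Pow S. \<Sum>B\<in>Pow A. sg A (S - A) * sg B (A - B) * f B * g (A - B) * h (S - A))"
    unfolding gmult_def sg_def by (simp add: sum_distrib_left sum_distrib_right mult_ac)
  also have "\<dots> = (\<Sum>(A, B)\<in>Sigma (Pow S) Pow.
      sg A (S - A) * sg B (A - B) * f B * g (A - B) * h (S - A))"
    by (rule sum.Sigma) (use True in \<open>auto intro: fin\<close>)
  also have "\<dots> = (\<Sum>(B, C)\<in>(SIGMA B:Pow S. Pow (S - B)).
      sg B (S - B) * sg C (S - B - C) * f B * g C * h (S - B - C))"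
  proof (rule sum.reindex_bij_witness[of _ "\<lambda>(B, C). (B \<union> C, B)" "\<lambda>(A, B). (B, A - B)"], goal_cases)
    case (5 a)
    then obtain A B where a: "a = (A, B)" "B \<subseteq> A" "A \<subseteq> S" by auto
    have "sg A (S - A) = sg B (S - A) * sg (A - B) (S - A)"
      using inversions_Un_left[of B "A - B" "S - A"] a fin
      by (simp add: sg_def power_add Un_absorb1)
    moreover have "sg B (S - B) = sg B (A - B) * sg B (S - A)"
    proof -
      have "S - B = (A - B) \<union> (S - A)" using a by auto
      moreover have "inversions B ((A - B) \<union> (S - A)) = inversions B (A - B) + inversions B (S - A)"
        by (rule inversions_Un_right) (use a fin in auto)
      ultimately show ?thesis by (simp add: sg_def power_add)
    qed
    moreover have "S - B - (A - B) = S - A" using a by auto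
    ultimately show ?case using a by simp
  qed auto
  also have "\<dots> = (\<Sum>B\<in>Pow S. \<Sum>C\<in>Pow (S - B).
      sg B (S - B) * sg C (S - B - C) * f B * g C * h (S - B - C))"
    by (rule sum.Sigma[symmetric]) (use True in auto)
  also have "\<dots> = gmult f (gmult g h) S"
    unfolding gmult_def sg_def by (simp add: sum_distrib_left mult_ac)
  finally show ?thesis .
qed

instantiation grassmann :: real_algebra_1
begin

lift_definition zero_grassmann :: grassmann is "\<lambda>_. 0" by simp

lift_definition one_grassmann :: grassmann is "\<lambda>S. if S = {} then 1 else 0"
  by (rule exI[of _ 0]) auto

lift_definition uminus_grassmann :: "grassmann \<Rightarrow> grassmann" is "\<lambda>f S. - f S" by simp

lift_definition scaleR_grassmann :: "real \<Rightarrow> grassmann \<Rightarrow> grassmann" is "\<lambda>r f S. r * f S"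
  by auto

lift_definition plus_grassmann :: "grassmann \<Rightarrow> grassmann \<Rightarrow> grassmann" is "\<lambda>f g S. f S + g S"
proof -
  fix f g :: "nat set \<Rightarrow> real"
  assume "\<exists>N. \<forall>S. f S \<noteq> 0 \<longrightarrow> S \<subseteq> {..<N}" "\<exists>N. \<forall>S. g S \<noteq> 0 \<longrightarrow> S \<subseteq> {..<N}"
  then obtain M N where M: "\<And>S. f S \<noteq> 0 \<Longrightarrow> S \<subseteq> {..<M}" and N: "\<And>S. g S \<noteq> 0 \<Longrightarrow> S \<subseteq> {..<N}"
    by auto
  have "S \<subseteq> {..<max M N}" if "f S + g S \<noteq> 0" for S
  proof -
    from that have "f S \<noteq> 0 \<or> g S \<noteq> 0" by auto
    then show ?thesis using M[of S] N[of S] by fastforce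
  qed
  then show "\<exists>N. \<forall>S. f S + g S \<noteq> 0 \<longrightarrow> S \<subseteq> {..<N}" by blast
qed

definition "x - y = x + (- y)" for x y :: grassmann

lift_definition times_grassmann :: "grassmann \<Rightarrow> grassmann \<Rightarrow> grassmann" is gmult
proof -
  fix f g :: "nat set \<Rightarrow> real"
  assume "\<exists>N. \<forall>S. f S \<noteq> 0 \<longrightarrow> S \<subseteq> {..<N}" "\<exists>N. \<forall>S. g S \<noteq> 0 \<longrightarrow> S \<subseteq> {..<N}"
  then obtain M N where M: "\<And>S. f S \<noteq> 0 \<Longrightarrow> S \<subseteq> {..<M}" and N: "\<And>S. g S \<noteq> 0 \<Longrightarrow> S \<subseteq> {..<N}"
    by auto
  have "S \<subseteq> {..<max M N}" if "gmult f g S \<noteq> 0" for S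
  proof -
    from that obtain A where "A \<in> Pow S" "f A \<noteq> 0" "g (S - A) \<noteq> 0"
      unfolding gmult_def by (metis (no_types, lifting) mult_eq_0_iff sum.neutral)
    then show ?thesis using M[of A] N[of "S - A"] by fastforce
  qed
  then show "\<exists>N. \<forall>S. gmult f g S \<noteq> 0 \<longrightarrow> S \<subseteq> {..<N}" by blast
qed

instance
proof
  fix a b c :: grassmann and r s :: real
  show "a + b + c = a + (b + c)" "a + b = b + a" "0 + a = a" "- a + a = 0" "r *\<^sub>R (a + b) = r *\<^sub>R a + r *\<^sub>R b"
    "(r + s) *\<^sub>R a = r *\<^sub>R a + s *\<^sub>R a" "r *\<^sub>R s *\<^sub>R a = (r * s) *\<^sub>R a" "1 *\<^sub>R a = a"
    by (transfer; auto simp: algebra_simps)+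
  show "a - b = a + - b" by (simp add: minus_grassmann_def)
  show "a * b * c = a * (b * c)"
    by transfer (rule ext, rule gmult_assoc)
  show "(a + b) * c = a * c + b * c" "a * (b + c) = a * b + a * c"
    by (transfer; auto simp: gmult_def algebra_simps sum.distrib)+
  show "r *\<^sub>R a * b = r *\<^sub>R (a * b)" "a * r *\<^sub>R b = r *\<^sub>R (a * b)"
    by (transfer; auto simp: gmult_def sum_distrib_left algebra_simps)+
  show "1 * a = a"
  proof (transfer, rule ext)
    fix f :: "nat set \<Rightarrow> real" and S assume f: "\<exists>N. \<forall>S. f S \<noteq> 0 \<longrightarrow> S \<subseteq> {..<N}"
    show "gmult (\<lambda>S. if S = {} then 1 else 0) f S = f S"
    proof (cases "finite S")
      case False
      then have "f S = 0" using f finite_subset by blast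
      with False show ?thesis by (simp add: gmult_def finite_Pow_iff)
    next
      case True
      then have "gmult (\<lambda>S. if S = {} then 1 else 0) f S
          = (\<Sum>A\<in>Pow S. if A = {} then f S else 0)"
        unfolding gmult_def by (intro sum.cong) (auto simp: inversions_empty)
      with True show ?thesis by (simp add: sum.delta)
    qed
  qed
  show "a * 1 = a"
  proof (transfer, rule ext)
    fix f :: "nat set \<Rightarrow> real" and S assume f: "\<exists>N. \<forall>S. f S \<noteq> 0 \<longrightarrow> S \<subseteq> {..<N}"
    show "gmult f (\<lambda>S. if S = {} then 1 else 0) S = f S"
    proof (cases "finite S")
      case False
      then have "f S = 0" using f finite_subset by blast
      with False show ?thesis by (simp add: gmult_def finite_Pow_iff)
    next
      case True
      then have "gmult f (\<lambda>S. if S = {} then 1 else 0) S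
          = (\<Sum>A\<in>Pow S. if A = S then f S else 0)"
        unfolding gmult_def by (intro sum.cong) (auto simp: inversions_empty)
      with True show ?thesis by (simp add: sum.delta)
    qed
  qed
  show "(0 :: grassmann) \<noteq> 1" by transfer (auto simp: fun_eq_iff)
qed

end

lift_definition odd_var :: "nat \<Rightarrow> grassmann" is "\<lambda>m S. if S = {m} then 1 else 0"
  by (rule exI[of _ "Suc m" for m]) auto

definition body :: "grassmann \<Rightarrow> real" where
  "body x = coeff x {}"

definition soul :: "grassmann \<Rightarrow> grassmann" where
  "soul x = x - of_real (body x)"

text \<open>
  Inverse and positive square root of an element with positive body, as the (finite) binomial
  expansions of \<open>b\<^sup>p (1 + u)\<^sup>p\<close> with \<open>b\<close> the body and \<open>u = soul/b\<close> nilpotent.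
\<close>

instantiation grassmann :: inverse
begin

definition inverse_grassmann :: "grassmann \<Rightarrow> grassmann" where
  "inverse x = (let u = soul x /\<^sub>R body x
     in (\<Sum>r | u ^ r \<noteq> 0. (- u) ^ r) /\<^sub>R body x)"

definition divide_grassmann :: "grassmann \<Rightarrow> grassmann \<Rightarrow> grassmann" where
  "x div y = x * inverse y" for x y :: grassmann

instance ..

end

definition gsqrt :: "grassmann \<Rightarrow> grassmann" where
  "gsqrt x = (let u = soul x /\<^sub>R body x
     in sqrt (body x) *\<^sub>R (\<Sum>r | u ^ r \<noteq> 0. ((1/2 :: real) gchoose r) *\<^sub>R u ^ r))"


section \<open>Decorated triangulations of a polygon and flips\<close>

text \<open>
  The vertices of an \<open>N\<close>-gon are \<open>0, \<dots>, N - 1\<close> in clockwise order; arcs and triangles are sets of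
  two and three vertices.  \<open>cw p q r\<close>: going clockwise from \<open>p\<close> one meets \<open>q\<close> before \<open>r\<close>;
  equivalently, \<open>r\<close> is to the right of the chord directed from \<open>p\<close> to \<open>q\<close>.
\<close>

definition cw :: "nat \<Rightarrow> nat \<Rightarrow> nat \<Rightarrow> bool" where
  "cw p q r \<longleftrightarrow> p < q \<and> q < r \<or> q < r \<and> r < p \<or> r < p \<and> p < q"

definition boundary :: "nat \<Rightarrow> nat set set" where
  "boundary N = (\<lambda>v. {v, Suc v mod N}) ` {..<N}"

definition diagonals :: "nat \<Rightarrow> nat set set" where
  "diagonals N = {{p, q} | p q. p < N \<and> q < N \<and> p \<noteq> q} - boundary N"

definition crosses :: "nat set \<Rightarrow> nat set \<Rightarrow> bool" where
  "crosses d e \<longleftrightarrow> (\<exists>p q r s. d = {p, q} \<and> e = {r, s} \<and> cw p r q \<and> cw q s p)"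

definition triangulation :: "nat \<Rightarrow> nat set set \<Rightarrow> bool" where
  "triangulation N T \<longleftrightarrow> T \<subseteq> diagonals N \<and> (\<forall>d\<in>T. \<forall>e\<in>T. \<not> crosses d e)
     \<and> (\<forall>d\<in>diagonals N - T. \<exists>e\<in>T. crosses d e)"

text \<open>
  \<open>arcs\<close> contains the boundary sides; \<open>dir D u v\<close> says that the arc \<open>{u, v}\<close> is oriented
  from \<open>u\<close> to \<open>v\<close>.  The values of \<open>dir\<close>, \<open>len\<close>, \<open>mu\<close> outside the arcs and triangles of \<open>D\<close> are
  meaningless.
\<close>

record decorated =
  arcs :: "nat set set"
  dir :: "nat \<Rightarrow> nat \<Rightarrow> bool"
  len :: "nat set \<Rightarrow> grassmann"
  mu :: "nat set \<Rightarrow> grassmann"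

definition is_triangle :: "decorated \<Rightarrow> nat set \<Rightarrow> bool" where
  "is_triangle D t \<longleftrightarrow> card t = 3 \<and> (\<forall>u\<in>t. \<forall>v\<in>t. u \<noteq> v \<longrightarrow> {u, v} \<in> arcs D)"

text \<open>A side common to two reversed triangles is reversed twice.\<close>

definition reverse_triangles :: "nat set set \<Rightarrow> decorated \<Rightarrow> decorated" where
  "reverse_triangles R D = D\<lparr>
     dir := (\<lambda>u v. if odd (card {t \<in> R. {u, v} \<subseteq> t}) then dir D v u else dir D u v),
     mu := (\<lambda>t. if t \<in> R then - mu D t else mu D t)\<rparr>"

text \<open>
  Flip of the arc oriented \<open>p \<rightarrow> q\<close> and drawn horizontally from left to right, with \<open>t\<close> the top and
  \<open>s\<close> the bottom vertex of the quadrilateral.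
\<close>

definition flip :: "nat \<Rightarrow> nat \<Rightarrow> nat \<Rightarrow> nat \<Rightarrow> decorated \<Rightarrow> decorated \<Rightarrow> bool" where
  "flip p t q s D D' \<longleftrightarrow>
     cw p t q \<and> cw p q s \<and> {{p, q}, {p, t}, {t, q}, {q, s}, {s, p}} \<subseteq> arcs D \<and> dir D p q \<and>
     (let a = len D {p, t}; b = len D {t, q}; c = len D {q, s}; d = len D {s, p};
          e = len D {p, q}; \<theta> = mu D {p, t, q}; \<sigma> = mu D {p, q, s};
          f = (a * c + b * d + gsqrt (a * b * c * d) * \<sigma> * \<theta>) / e;
          \<theta>' = (\<theta> * gsqrt (b * d) + \<sigma> * gsqrt (a * c)) / gsqrt (e * f);
          \<sigma>' = (\<sigma> * gsqrt (b * d) - \<theta> * gsqrt (a * c)) / gsqrt (e * f)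
      in D' = \<lparr>arcs = insert {s, t} (arcs D - {{p, q}}),
               dir = (\<lambda>u v. if {u, v} = {s, t} then u = s \<and> v = t
                            else if {u, v} = {t, q} then dir D v u else dir D u v),
               len = (len D)({s, t} := f),
               mu = (mu D)({p, t, s} := \<theta>', {q, t, s} := \<sigma>')\<rparr>)"

definition move :: "decorated \<Rightarrow> decorated \<Rightarrow> bool" where
  "move D D' \<longleftrightarrow> (\<exists>p t q s. flip p t q s D D')
     \<or> (\<exists>t. is_triangle D t \<and> D' = reverse_triangles {t} D)"

definition super_length :: "decorated \<Rightarrow> nat set \<Rightarrow> grassmann" where
  "super_length D d = (THE y. \<exists>E. move\<^sup>*\<^sup>* D E \<and> d \<in> arcs E \<and> y = len E d)"


section \<open>The arc and its default orientation\<close>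

text \<open>
  From here on the polygon has the vertices \<open>0, \<dots>, n + 1\<close>, labelled clockwise starting at the
  initial point \<open>i = 0\<close> of the arc \<open>f = {0, k}\<close> drawn from bottom to top.  So the vertices smaller
  than \<open>k\<close> are to the left of \<open>f\<close>, those larger than \<open>k\<close> to the right, and a diagonal \<open>d\<close> crossing
  \<open>f\<close> has left endpoint \<open>Min d\<close> and right endpoint \<open>Max d\<close>.  The diagonals crossed are
  \<open>x 1, \<dots>, x (n - 1)\<close>.
\<close>

definition crossed_before :: "nat set \<Rightarrow> nat set \<Rightarrow> bool" where
  "crossed_before d e \<longleftrightarrow> Min d \<le> Min e \<and> Max e \<le> Max d"

text \<open>\<open>\<Delta>\<^sub>m\<close>: \<open>f\<close> enters it through \<open>x (m - 1)\<close> (or at \<open>0\<close>) and leaves it through \<open>x m\<close> (or at \<open>k\<close>).\<close>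

definition tri :: "nat \<Rightarrow> nat \<Rightarrow> (nat \<Rightarrow> nat set) \<Rightarrow> nat \<Rightarrow> nat set" where
  "tri n k x m = (if m = 1 then {0} else x (m - 1)) \<union> (if m = n then {k} else x m)"

text \<open>The vertex \<open>j\<close> is only used for \<open>n = 2\<close>, where it is the chosen endpoint of \<open>x 1\<close>.\<close>

definition fan_center :: "nat \<Rightarrow> nat \<Rightarrow> (nat \<Rightarrow> nat set) \<Rightarrow> nat \<Rightarrow> nat" where
  "fan_center n j x m = (if n = 2 then j
     else let r = max 2 (min (n - 1) m) in the_elem (x (r - 1) \<inter> x r))"

definition fan_centers :: "nat \<Rightarrow> nat \<Rightarrow> (nat \<Rightarrow> nat set) \<Rightarrow> nat list" where
  "fan_centers n j x = remdups (map (fan_center n j x) [1..<Suc n])"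

definition default_dir :: "nat \<Rightarrow> nat \<Rightarrow> (nat \<Rightarrow> nat set) \<Rightarrow> nat \<Rightarrow> nat \<Rightarrow> bool" where
  "default_dir n j x p q \<longleftrightarrow> (let c = fan_centers n j x in
     if \<exists>s. Suc s < length c \<and> {p, q} = {c ! s, c ! Suc s}
     then \<exists>s. Suc s < length c \<and> p = c ! s \<and> q = c ! Suc s
     else p \<in> set c)"

text \<open>\<open>pos_greater n k j x r s\<close>: \<open>\<theta>\<^sub>r > \<theta>\<^sub>s\<close> in the positive order.\<close>

definition lies_on_right :: "nat \<Rightarrow> nat \<Rightarrow> nat \<Rightarrow> (nat \<Rightarrow> nat set) \<Rightarrow> nat \<Rightarrow> bool" where
  "lies_on_right n k j x m \<longleftrightarrow> (\<exists>p q u. x m = {p, q} \<and> default_dir n j x p q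
     \<and> tri n k x m = {p, q, u} \<and> cw p q u)"

definition pos_greater :: "nat \<Rightarrow> nat \<Rightarrow> nat \<Rightarrow> (nat \<Rightarrow> nat set) \<Rightarrow> nat \<Rightarrow> nat \<Rightarrow> bool" where
  "pos_greater n k j x r s \<longleftrightarrow>
     r < s \<and> lies_on_right n k j x r \<or> s < r \<and> \<not> lies_on_right n k j x s"

definition pos_product ::
  "nat \<Rightarrow> nat \<Rightarrow> nat \<Rightarrow> (nat \<Rightarrow> nat set) \<Rightarrow> (nat \<Rightarrow> grassmann) \<Rightarrow> nat set \<Rightarrow> grassmann" where
  "pos_product n k j x \<theta> S = prod_list (map \<theta>
     (THE ms. set ms = S \<and> distinct ms \<and> sorted_wrt (pos_greater n k j x) ms))"

text \<open>The triangulation with its default orientation; boundary sides are oriented arbitrarily.\<close>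

definition default_decorated ::
  "nat \<Rightarrow> nat \<Rightarrow> nat \<Rightarrow> (nat \<Rightarrow> nat set) \<Rightarrow> nat set set \<Rightarrow> (nat set \<Rightarrow> real) \<Rightarrow> decorated \<Rightarrow> bool" where
  "default_decorated n k j x T w D \<longleftrightarrow>
     arcs D = T \<union> boundary (n + 2) \<and>
     (\<forall>u v. u \<noteq> v \<and> {u, v} \<in> arcs D \<longrightarrow> dir D u v \<noteq> dir D v u) \<and>
     (\<forall>u v. {u, v} \<in> T \<longrightarrow> dir D u v = default_dir n j x u v) \<and>
     (\<forall>d\<in>arcs D. len D d = of_real (w d)) \<and>
     (\<forall>m\<in>{1..n}. mu D (tri n k x m) = odd_var m)"

text \<open>
  An orientation equivalent to the default one, obtained by reversing every triangle whose fan
  center is to the right of \<open>f\<close>: it differs from the default one exactly on the diagonals that join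
  two consecutive fan centers.  Toggling \<open>\<theta>\<^sub>n\<close> without a sign computes the mu-invariant of \<open>(i, j, k)\<close>
  when the odd variables are the mu-invariants in this representative; with the default one it
  does so only if there is a single fan center.
\<close>

definition reverse_right_fans ::
  "nat \<Rightarrow> nat \<Rightarrow> nat \<Rightarrow> (nat \<Rightarrow> nat set) \<Rightarrow> decorated \<Rightarrow> decorated" where
  "reverse_right_fans n k j x D =
     reverse_triangles (tri n k x ` {m \<in> {1..n}. k < fan_center n j x m}) D"

text \<open>
  The mu-invariant of \<open>(i, j, k)\<close> obtained by flipping \<open>e = (j, l)\<close>, oriented \<open>j \<rightarrow> l\<close>, in the
  quadrilateral \<open>i, l, k, j\<close>.  Of the representatives that differ by reversals, the ones with
  mu-invariant \<open>+\<theta>\<^sub>n\<close> of the last triangle are used.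
\<close>

definition flipped_mu :: "nat \<Rightarrow> nat \<Rightarrow> nat \<Rightarrow> nat \<Rightarrow> decorated \<Rightarrow> grassmann" where
  "flipped_mu n j k l D = (THE y. \<exists>E E'. move\<^sup>*\<^sup>* D E \<and> mu E {j, k, l} = odd_var n
     \<and> flip j k l 0 E E' \<and> y = mu E' {0, j, k})"


section \<open>The labelled snake graph and its double dimer covers\<close>

datatype side = Left | Bottom | Top | Right

definition tile_label :: "nat \<Rightarrow> nat \<Rightarrow> (nat \<Rightarrow> nat set) \<Rightarrow> nat \<Rightarrow> side \<Rightarrow> nat set" where
  "tile_label n k x m sd =
     (let p = Min (x m); q = Max (x m);
          u = the_elem (tri n k x m - x m); v = the_elem (tri n k x (Suc m) - x m)
      in if odd m
         then (case sd of Left \<Rightarrow> {u, p} | Bottom \<Rightarrow> {u, q} | Top \<Rightarrow> {p, v} | Right \<Rightarrow> {q, v})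
         else (case sd of Left \<Rightarrow> {u, q} | Bottom \<Rightarrow> {u, p} | Top \<Rightarrow> {q, v} | Right \<Rightarrow> {p, v}))"

text \<open>The side of \<open>\<Delta>\<^bsub>m+1\<^esub>\<close> other than \<open>x m\<close> and \<open>x (m + 1)\<close>.\<close>

definition third_side :: "nat \<Rightarrow> nat \<Rightarrow> (nat \<Rightarrow> nat set) \<Rightarrow> nat \<Rightarrow> nat set" where
  "third_side n k x m =
     (THE d. d \<subseteq> tri n k x (Suc m) \<and> card d = 2 \<and> d \<noteq> x m \<and> d \<noteq> x (Suc m))"

text \<open>
  The snake graph is drawn in the integer grid, its tiles being unit squares; \<open>tile_pos\<close> is the
  bottom-left corner of a tile, and the first tile is number 1.
\<close>

primrec tile_pos :: "nat \<Rightarrow> nat \<Rightarrow> (nat \<Rightarrow> nat set) \<Rightarrow> nat \<Rightarrow> nat \<times> nat" where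
  "tile_pos n k x 0 = (0, 0)"
| "tile_pos n k x (Suc m) = (if m = 0 then (0, 0)
     else case tile_pos n k x m of (a, b) \<Rightarrow>
       if third_side n k x m = tile_label n k x m Right then (Suc a, b) else (a, Suc b))"

definition tile_edge ::
  "nat \<Rightarrow> nat \<Rightarrow> (nat \<Rightarrow> nat set) \<Rightarrow> nat \<Rightarrow> side \<Rightarrow> (nat \<times> nat) set" where
  "tile_edge n k x m sd = (case tile_pos n k x m of (a, b) \<Rightarrow>
     (case sd of Left \<Rightarrow> {(a, b), (a, Suc b)} | Bottom \<Rightarrow> {(a, b), (Suc a, b)}
      | Top \<Rightarrow> {(a, Suc b), (Suc a, Suc b)} | Right \<Rightarrow> {(Suc a, b), (Suc a, Suc b)}))"

definition snake_edges :: "nat \<Rightarrow> nat \<Rightarrow> (nat \<Rightarrow> nat set) \<Rightarrow> (nat \<times> nat) set set" where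
  "snake_edges n k x = (\<Union>m\<in>{1..n - 1}. range (tile_edge n k x m))"

definition edge_label ::
  "nat \<Rightarrow> nat \<Rightarrow> (nat \<Rightarrow> nat set) \<Rightarrow> (nat \<times> nat) set \<Rightarrow> nat set" where
  "edge_label n k x g =
     (THE d. \<exists>m\<in>{1..n - 1}. \<exists>sd. g = tile_edge n k x m sd \<and> d = tile_label n k x m sd)"

definition double_dimers ::
  "nat \<Rightarrow> nat \<Rightarrow> (nat \<Rightarrow> nat set) \<Rightarrow> (nat \<times> nat) set multiset set" where
  "double_dimers n k x = {M. set_mset M \<subseteq> snake_edges n k x
     \<and> (\<forall>v\<in>\<Union>(snake_edges n k x). size {#g \<in># M. v \<in> g#} = 2)}"

definition double_dimers_using ::
  "side \<Rightarrow> nat \<Rightarrow> nat \<Rightarrow> (nat \<Rightarrow> nat set) \<Rightarrow> (nat \<times> nat) set multiset set" where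
  "double_dimers_using sd n k x = {M \<in> double_dimers n k x. tile_edge n k x (n - 1) sd \<in># M}"

text \<open>The edges of the cycle surrounding the tiles number \<open>s, \<dots>, t\<close>.\<close>

definition cycle_around ::
  "nat \<Rightarrow> nat \<Rightarrow> (nat \<Rightarrow> nat set) \<Rightarrow> nat \<Rightarrow> nat \<Rightarrow> (nat \<times> nat) set set" where
  "cycle_around n k x s t =
     {g. card {m \<in> {s..t}. g \<in> range (tile_edge n k x m)} = 1}"

text \<open>
  The indices of the odd variables in the weight of \<open>M\<close>.  Distinct cycles of \<open>M\<close> are
  vertex-disjoint, so they contribute distinct odd variables.
\<close>

definition odd_indices ::
  "nat \<Rightarrow> nat \<Rightarrow> (nat \<Rightarrow> nat set) \<Rightarrow> (nat \<times> nat) set multiset \<Rightarrow> nat set" where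
  "odd_indices n k x M = \<Union>{{s, Suc t} | s t. 1 \<le> s \<and> s \<le> t \<and> t \<le> n - 1
     \<and> (\<forall>g\<in>cycle_around n k x s t. count M g = 1)}"

definition even_weight ::
  "nat \<Rightarrow> nat \<Rightarrow> (nat \<Rightarrow> nat set) \<Rightarrow> (nat set \<Rightarrow> real) \<Rightarrow> (nat \<times> nat) set multiset \<Rightarrow> real" where
  "even_weight n k x w M = (\<Prod>g\<in>#M. sqrt (w (edge_label n k x g)))"

text \<open>In \<open>wt\<close> and \<open>wt_star\<close>, \<open>\<theta> m\<close> is the odd variable of \<open>\<Delta>\<^sub>m\<close>.\<close>

definition wt ::
  "nat \<Rightarrow> nat \<Rightarrow> nat \<Rightarrow> (nat \<Rightarrow> nat set) \<Rightarrow> (nat set \<Rightarrow> real) \<Rightarrow> (nat \<Rightarrow> grassmann)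
     \<Rightarrow> (nat \<times> nat) set multiset \<Rightarrow> grassmann" where
  "wt n k j x w \<theta> M = even_weight n k x w M *\<^sub>R pos_product n k j x \<theta> (odd_indices n k x M)"

definition toggle :: "nat \<Rightarrow> nat set \<Rightarrow> nat set" where
  "toggle m S = (if m \<in> S then S - {m} else insert m S)"

definition wt_star ::
  "nat \<Rightarrow> nat \<Rightarrow> nat \<Rightarrow> (nat \<Rightarrow> nat set) \<Rightarrow> (nat set \<Rightarrow> real) \<Rightarrow> (nat \<Rightarrow> grassmann)
     \<Rightarrow> (nat \<times> nat) set multiset \<Rightarrow> grassmann" where
  "wt_star n k j x w \<theta> M =
     even_weight n k x w M *\<^sub>R pos_product n k j x \<theta> (toggle n (odd_indices n k x M))"

definition cross :: "nat \<Rightarrow> (nat \<Rightarrow> nat set) \<Rightarrow> (nat set \<Rightarrow> real) \<Rightarrow> real" where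
  "cross n x w = (\<Prod>m\<in>{1..n - 1}. w (x m))"

end

theory Submission
  imports Defs "HOL-Computational_Algebra.Formal_Power_Series"
begin

text \<open>
  Put a vector of the super plane \<open>\<real>\<^bsup>2|1\<^esup>\<close> at every vertex of the polygon.  Two vectors have an even
  pairing \<open>bracket\<close>, three have an odd cubic invariant \<open>odd_det\<close>.  If lambda-lengths are
  brackets, and mu-invariants are the odd invariants divided by the square roots of the three sides,
  then the super Ptolemy relations become polynomial identities between four vectors
  (\<open>bracket_ptolemy\<close>, \<open>odd_det_exchange\<close>).  A triangulation is realized by vectors one vertex at
  a time, because the two lengths and the mu-invariant of a new triangle can be prescribed
  (\<open>super_vector_exists\<close>, \<open>vectors_exist\<close>).  Flips and reversals then keep the vectors and change only
  signs of the odd invariants, and these signs can be read off the orientation (\<open>compatible_flip\<close>,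
  \<open>compatible_reverse\<close>).  So a super lambda-length does not depend on the flips that lead to it: it
  is a bracket, and the mu-invariant of \<open>(i, j, k)\<close> is an odd invariant of the vectors at its vertices.

  Both quantities are computed along the chain of crossed diagonals.  Passing one triangle expresses
  the bracket of \<open>0\<close> with the new vertex, and the odd invariant of \<open>0\<close> and the next diagonal, linearly
  in the two brackets and the odd invariant that belong to the previous diagonal (\<open>fan_relations\<close>).
  Double dimer covers obey the same recursion.  A cover of a snake graph with one more tile is a
  cover of the smaller graph together with the number \<open>h\<close> of copies of the common edge that are
  replaced by the two sides of the new tile (\<open>bij_attach\<close>).  The sums over \<open>h = 0\<close> and \<open>h = 2\<close> are the
  two brackets; the sum over \<open>h = 1\<close>, where a cycle reaches the new tile and may still be prolonged,
  is the odd invariant (\<open>before_tile_def\<close>, \<open>after_tile\<close>).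

  It remains to compare signs.  The variable \<open>\<theta>\<^sub>m\<close> is larger than all later ones if the fan center of
  \<open>\<Delta>\<^sub>m\<close> is to the left of \<open>f\<close>, and smaller than all later ones otherwise.  Moving the factors into the
  order of their indices therefore costs a sign for every right fan whose variable is followed by an
  odd number of factors.  In a product of cycle weights these are the variables that open a cycle
  (\<open>pos_product_even\<close>), and this is the sign by which the recursion of the odd invariants differs
  between left and right fans.  After toggling \<open>\<theta>\<^sub>n\<close> it is the closing variables that get the sign, and
  reversing the right fans moves it back to the opening ones (\<open>pos_product_odd\<close>).
\<close>

section \<open>Parity, inverses and square roots in the Grassmann algebra\<close>

lemma coeff_simps [simp]:
  "coeff 0 S = 0" "coeff 1 S = (if S = {} then 1 else 0)"
  "coeff (x + y) S = coeff x S + coeff y S" "coeff (- x) S = - coeff x S"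
  "coeff (x - y) S = coeff x S - coeff y S" "coeff (r *\<^sub>R x) S = r * coeff x S"
proof -
  show "coeff (x - y) S = coeff x S - coeff y S"
    unfolding minus_grassmann_def by transfer simp
qed (transfer; simp)+

lemma coeff_mult: "coeff (x * y) S = gmult (coeff x) (coeff y) S"
  by transfer simp

lemma coeff_odd_var: "coeff (odd_var m) S = (if S = {m} then 1 else 0)"
  by transfer simp

lemma coeff_of_real: "coeff (of_real r) S = (if S = {} then r else 0)"
  by (simp add: of_real_def)

lemma grassmann_eqI: "(\<And>S. coeff x S = coeff y S) \<Longrightarrow> x = y"
  using coeff_inject by blast

lemma coeff_bounded: "\<exists>N. \<forall>S. coeff x S \<noteq> 0 \<longrightarrow> S \<subseteq> {..<N}"
  using coeff[of x] by simp

lemma coeff_finite: "coeff x S \<noteq> 0 \<Longrightarrow> finite S"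
  using coeff_bounded finite_lessThan finite_subset by metis

lemma gmult_nonzero:
  assumes "gmult f g S \<noteq> 0"
  obtains A where "A \<subseteq> S" "f A \<noteq> 0" "g (S - A) \<noteq> 0"
proof -
  from assms obtain A where "A \<in> Pow S" "f A \<noteq> 0" "g (S - A) \<noteq> 0"
    unfolding gmult_def by (metis (no_types, lifting) mult_eq_0_iff sum.neutral)
  then show thesis using that by auto
qed

definition geven :: "grassmann \<Rightarrow> bool" where
  "geven x \<longleftrightarrow> (\<forall>S. coeff x S \<noteq> 0 \<longrightarrow> even (card S))"

definition godd :: "grassmann \<Rightarrow> bool" where
  "godd x \<longleftrightarrow> (\<forall>S. coeff x S \<noteq> 0 \<longrightarrow> odd (card S))"

lemma card_coeff_mult:
  assumes "coeff (x * y) S \<noteq> 0"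
  obtains A where "coeff x A \<noteq> 0" "coeff y (S - A) \<noteq> 0" "A \<subseteq> S" "card S = card A + card (S - A)"
proof -
  obtain A where A: "A \<subseteq> S" "coeff x A \<noteq> 0" "coeff y (S - A) \<noteq> 0"
    using assms gmult_nonzero unfolding coeff_mult by metis
  have "finite S" using assms coeff_finite by blast
  then have "card S = card A + card (S - A)"
    using A by (simp add: card_Diff_subset card_mono finite_subset)
  with A that show thesis by blast
qed

lemma geven_iff: "geven x \<longleftrightarrow> (\<forall>S. odd (card S) \<longrightarrow> coeff x S = 0)"
  and godd_iff: "godd x \<longleftrightarrow> (\<forall>S. even (card S) \<longrightarrow> coeff x S = 0)"
  unfolding geven_def godd_def by blast+

lemma geven_closed [simp, intro]:
  "geven 0" "geven 1" "geven (of_real r)"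
  "geven x \<Longrightarrow> geven y \<Longrightarrow> geven (x + y)"
  "geven x \<Longrightarrow> geven y \<Longrightarrow> geven (x - y)"
  "geven x \<Longrightarrow> geven (- x)" "geven x \<Longrightarrow> geven (r *\<^sub>R x)"
  by (auto simp: geven_iff coeff_of_real)

lemma godd_closed [simp, intro]:
  "godd 0" "godd (odd_var m)"
  "godd x \<Longrightarrow> godd y \<Longrightarrow> godd (x + y)"
  "godd x \<Longrightarrow> godd y \<Longrightarrow> godd (x - y)"
  "godd x \<Longrightarrow> godd (- x)" "godd x \<Longrightarrow> godd (r *\<^sub>R x)"
  by (auto simp: godd_iff coeff_odd_var)

lemma geven_mult [simp, intro]: "geven x \<Longrightarrow> geven y \<Longrightarrow> geven (x * y)"
  unfolding geven_def by (fastforce elim!: card_coeff_mult)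

lemma godd_mult [simp, intro]: "godd x \<Longrightarrow> godd y \<Longrightarrow> geven (x * y)"
  unfolding godd_def geven_def by (fastforce elim!: card_coeff_mult)

lemma geven_godd_mult [simp, intro]:
  "geven x \<Longrightarrow> godd y \<Longrightarrow> godd (x * y)" "godd x \<Longrightarrow> geven y \<Longrightarrow> godd (x * y)"
  unfolding godd_def geven_def by (fastforce elim!: card_coeff_mult)+

lemma geven_power [simp, intro]: "geven x \<Longrightarrow> geven (x ^ r)"
  by (induction r) auto

lemma geven_sum [simp, intro]: "(\<And>i. i \<in> I \<Longrightarrow> geven (f i)) \<Longrightarrow> geven (sum f I)"
  by (induction I rule: infinite_finite_induct) auto

lemma inversions_swap:
  assumes "finite A" "finite B" "A \<inter> B = {}"
  shows "inversions A B + inversions B A = card A * card B"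
proof -
  define P where "P = {(a, b). a \<in> A \<and> b \<in> B \<and> b < a}"
  define Q where "Q = {(a, b). a \<in> A \<and> b \<in> B \<and> a < b}"
  have "{(b, a). b \<in> B \<and> a \<in> A \<and> a < b} = prod.swap ` Q"
    unfolding Q_def by force
  then have "inversions B A = card Q"
    unfolding inversions_def by (simp add: card_image)
  moreover have "finite P" "finite Q"
    unfolding P_def Q_def by (rule finite_subset[of _ "A \<times> B"]; use assms in auto)+
  moreover have "P \<inter> Q = {}" unfolding P_def Q_def by auto
  moreover have "A \<times> B = P \<union> Q"
    using assms(3) unfolding P_def Q_def by auto
  ultimately show ?thesis
    unfolding inversions_def P_def[symmetric] by (simp add: card_Un_disjoint flip: card_cartesian_product)
qed

text \<open>
  Exchanging a block of \<open>a\<close> odd variables with a block of \<open>b\<close> others takes \<open>a b\<close> transpositions, so the sign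
  depends on the parities only.
\<close>

lemma mult_swap_sign:
  assumes "\<And>A B. coeff x A \<noteq> 0 \<Longrightarrow> coeff y B \<noteq> 0 \<Longrightarrow> finite A \<Longrightarrow> finite B \<Longrightarrow> (- 1 :: real) ^ (card A * card B) = c"
  shows "x * y = c *\<^sub>R (y * x)"
proof (rule grassmann_eqI)
  fix S
  show "coeff (x * y) S = coeff (c *\<^sub>R (y * x)) S"
  proof (cases "finite S")
    case False
    then show ?thesis by (simp add: coeff_mult gmult_def finite_Pow_iff)
  next
    case True
    have "gmult (coeff x) (coeff y) S
       = (\<Sum>A\<in>Pow S. (- 1) ^ inversions (S - A) A * coeff x (S - A) * coeff y A)"
      unfolding gmult_def
      by (rule sum.reindex_bij_witness[of _ "\<lambda>A. S - A" "\<lambda>A. S - A"]) (auto simp: double_diff)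
    also have "\<dots> = (\<Sum>A\<in>Pow S. c * ((- 1) ^ inversions A (S - A) * coeff y A * coeff x (S - A)))"
    proof (rule sum.cong[OF refl])
      fix A assume A: "A \<in> Pow S"
      show "(- 1) ^ inversions (S - A) A * coeff x (S - A) * coeff y A
         = c * ((- 1) ^ inversions A (S - A) * coeff y A * coeff x (S - A))"
      proof (cases "coeff x (S - A) = 0 \<or> coeff y A = 0")
        case False
        have fin: "finite A" "finite (S - A)" using A True finite_subset by auto
        have "c = (- 1) ^ (card (S - A) * card A)" using assms False fin by metis
        also have "\<dots> = (- 1) ^ inversions (S - A) A * (- 1) ^ inversions A (S - A)"
          using inversions_swap[of "S - A" A] fin by (simp add: power_add[symmetric] Int_commute)
        finally have "c * (- 1) ^ inversions A (S - A) = (- 1) ^ inversions (S - A) A"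
          by (simp add: minus_one_power_iff)
        then show ?thesis by (simp add: mult_ac)
      qed auto
    qed
    finally show ?thesis by (simp add: coeff_mult gmult_def sum_distrib_left)
  qed
qed

lemma geven_commute: "geven a \<Longrightarrow> x * a = a * x"
  using mult_swap_sign[of x a 1] by (auto simp: geven_def)

lemma geven_left_commute: "geven a \<Longrightarrow> x * (a * y) = a * (x * y)"
  by (metis geven_commute mult.assoc)

lemma godd_anticommute: "godd x \<Longrightarrow> godd y \<Longrightarrow> y * x = - (x * y)"
  using mult_swap_sign[of y x "- 1"] by (auto simp: godd_def)

lemma godd_square: "godd x \<Longrightarrow> x * x = 0"
proof (rule grassmann_eqI)
  fix S assume "godd x"
  then have "x * x = - (x * x)" by (intro godd_anticommute)
  then have "coeff (x * x) S = coeff (- (x * x)) S" by (rule arg_cong)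
  then show "coeff (x * x) S = coeff 0 S" by simp
qed

lemma body_simps [simp]:
  "body 0 = 0" "body 1 = 1" "body (of_real r) = r" "body (x + y) = body x + body y"
  "body (- x) = - body x" "body (x - y) = body x - body y" "body (r *\<^sub>R x) = r * body x"
  "body (x * y) = body x * body y"
  by (simp_all add: body_def coeff_of_real coeff_mult gmult_def inversions_empty)

lemma body_godd: "godd x \<Longrightarrow> body x = 0"
  unfolding body_def godd_def by force

lemma body_sum: "body (sum f I) = (\<Sum>i\<in>I. body (f i))"
  by (induction I rule: infinite_finite_induct) auto

lemma body_power: "body (x ^ r) = body x ^ r"
  by (induction r) auto

lemma card_coeff_power: "body u = 0 \<Longrightarrow> coeff (u ^ r) S \<noteq> 0 \<Longrightarrow> r \<le> card S"
proof (induction r arbitrary: S)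
  case (Suc r)
  then have "coeff (u * u ^ r) S \<noteq> 0" by simp
  then obtain A where A: "coeff u A \<noteq> 0" "coeff (u ^ r) (S - A) \<noteq> 0" "card S = card A + card (S - A)"
    using card_coeff_mult by blast
  then have "A \<noteq> {}" using Suc.prems(1) by (auto simp: body_def)
  then have "card A \<noteq> 0" using A(1) coeff_finite by auto
  then show ?case using Suc.IH[OF Suc.prems(1) A(2)] A(3) by simp
qed simp

text \<open>
  All terms of \<open>u\<^sup>r\<close> have degree at least \<open>r\<close>, but only finitely many odd variables occur in \<open>u\<close>.  The
  binomial expansions that define inverses and square roots are therefore finite sums.
\<close>

lemma nilpotent_if_body_0:
  assumes "body u = 0"
  obtains K where "K \<ge> 2" "\<And>r. r \<ge> K \<Longrightarrow> u ^ r = 0"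
proof -
  obtain N where N: "\<And>S. coeff u S \<noteq> 0 \<Longrightarrow> S \<subseteq> {..<N}"
    using coeff_bounded by blast
  have sub: "S \<subseteq> {..<N}" if "coeff (u ^ r) S \<noteq> 0" for r S
    using that
  proof (induction r arbitrary: S)
    case (Suc r)
    then have "coeff (u * u ^ r) S \<noteq> 0" by simp
    then obtain A where "coeff u A \<noteq> 0" "coeff (u ^ r) (S - A) \<noteq> 0" "A \<subseteq> S"
      using card_coeff_mult by blast
    then show ?case using N Suc.IH by blast
  qed (auto split: if_splits)
  show thesis
  proof (rule that[of "N + 2"])
    fix r assume r: "N + 2 \<le> r"
    show "u ^ r = 0"
    proof (rule grassmann_eqI, rule ccontr)
      fix S assume "coeff (u ^ r) S \<noteq> coeff 0 S"
      then have "coeff (u ^ r) S \<noteq> 0" by simp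
      then have "r \<le> card S" "S \<subseteq> {..<N}" using card_coeff_power[OF assms] sub by auto
      then show False using card_mono[of "{..<N}" S] r by simp
    qed
  qed simp
qed

lemma soul_decomposition:
  assumes "body x \<noteq> 0"
  defines "u \<equiv> soul x /\<^sub>R body x"
  shows "x = body x *\<^sub>R (1 + u)" "body u = 0" "geven x \<Longrightarrow> geven u"
  using assms by (auto simp: soul_def scaleR_add_right of_real_def)

text \<open>
  The geometric series telescopes.
\<close>

lemma mult_inverse_grassmann:
  assumes "body x \<noteq> 0"
  shows "x * inverse x = 1"
proof -
  define u where "u = soul x /\<^sub>R body x"
  note u = soul_decomposition[OF assms, folded u_def]
  obtain K where K: "\<And>r. r \<ge> K \<Longrightarrow> u ^ r = 0" using nilpotent_if_body_0[OF u(2)] by blast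
  have "(\<Sum>r | u ^ r \<noteq> 0. (- u) ^ r) = (\<Sum>r<K. (- u) ^ r)"
    by (rule sum.mono_neutral_left) (use K in \<open>auto simp: power_minus[of u] not_le intro: ccontr\<close>)
  moreover have "(1 + u) * (\<Sum>r<L. (- u) ^ r) = 1 - (- u) ^ L" for L
    by (induction L) (auto simp: algebra_simps)
  moreover have "(- u) ^ K = 0" using K[of K] by (simp add: power_minus[of u])
  ultimately have "(1 + u) * (\<Sum>r | u ^ r \<noteq> 0. (- u) ^ r) = 1" by simp
  then show ?thesis
    using assms by (subst u(1)) (simp add: inverse_grassmann_def Let_def u_def[symmetric])
qed

lemma geven_inverse [simp, intro]:
  assumes "geven x" "body x \<noteq> 0"
  shows "geven (inverse x)"
  using assms soul_decomposition(3)[OF assms(2)] by (auto simp: inverse_grassmann_def Let_def)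

lemma mult_left_cancel_grassmann:
  assumes "geven c" "body c \<noteq> 0" "c * x = c * y"
  shows "x = y"
proof -
  have "inverse c * (c * x) = inverse c * (c * y)" using assms by simp
  then show ?thesis
    using mult_inverse_grassmann[OF assms(2)] geven_commute[OF assms(1), of "inverse c"]
    by (simp flip: mult.assoc)
qed

lemma divide_eqI:
  assumes "geven c" "body c \<noteq> 0" "c * y = x"
  shows "x / c = y"
  unfolding divide_grassmann_def
  by (metis assms geven_commute geven_inverse geven_left_commute mult.right_neutral mult_inverse_grassmann)

lemma divide_mult_cancel:
  assumes "geven c" "body c \<noteq> 0"
  shows "c * (x / c) = x"
  unfolding divide_grassmann_def
  by (metis assms geven_left_commute mult.right_neutral mult_inverse_grassmann)

text \<open>
  By Vandermonde's identity the square of the binomial series with exponent \<open>1/2\<close> is the one with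
  exponent \<open>1\<close>, which is \<open>1 + u\<close>.
\<close>

lemma gsqrt_props:
  assumes "body x > 0"
  shows "gsqrt x * gsqrt x = x" "body (gsqrt x) = sqrt (body x)" "geven x \<Longrightarrow> geven (gsqrt x)"
proof -
  define u where "u = soul x /\<^sub>R body x"
  have b: "body x \<noteq> 0" using assms by simp
  note u = soul_decomposition[OF b, folded u_def]
  obtain K where K: "K \<ge> 2" "\<And>r. r \<ge> K \<Longrightarrow> u ^ r = 0" using nilpotent_if_body_0[OF u(2)] by blast
  define c where "c r = (1 / 2 :: real) gchoose r" for r
  define s where "s = (\<Sum>r<K. c r *\<^sub>R u ^ r)"
  have "(\<Sum>r | u ^ r \<noteq> 0. c r *\<^sub>R u ^ r) = s"
    unfolding s_def by (rule sum.mono_neutral_left) (use K in \<open>auto simp: not_le intro: ccontr\<close>)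
  then have gs: "gsqrt x = sqrt (body x) *\<^sub>R s"
    by (simp add: gsqrt_def Let_def u_def[symmetric] c_def)
  have "s * s = (\<Sum>(i, j)\<in>{..<K} \<times> {..<K}. (c i * c j) *\<^sub>R u ^ (i + j))"
    unfolding s_def sum_product by (simp add: sum.cartesian_product power_add mult.commute)
  also have "\<dots> = (\<Sum>(i, j)\<in>{(i, j). i + j < K}. (c i * c j) *\<^sub>R u ^ (i + j))"
    by (rule sum.mono_neutral_right) (use K in \<open>auto simp: not_less intro: ccontr\<close>)
  also have "\<dots> = (\<Sum>m<K. \<Sum>i\<le>m. (c i * c (m - i)) *\<^sub>R u ^ m)"
    by (subst sum.triangle_reindex) simp
  also have "\<dots> = (\<Sum>m<K. (1 gchoose m :: real) *\<^sub>R u ^ m)"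
    using gbinomial_Vandermonde[where a = "1/2 :: real" and b = "1/2"]
    by (simp add: c_def scaleR_sum_left[symmetric] atLeast0AtMost)
  also have "\<dots> = (\<Sum>m<2. (1 gchoose m :: real) *\<^sub>R u ^ m)"
  proof (rule sum.mono_neutral_right)
    have "(1 gchoose m :: real) = 0" if "m \<ge> 2" for m
      using that binomial_gbinomial[of 1 m, where 'a = real] by (simp add: binomial_eq_0)
    then show "\<forall>m\<in>{..<K} - {..<2}. (1 gchoose m :: real) *\<^sub>R u ^ m = 0" by auto
  qed (use K in auto)
  also have "\<dots> = 1 + u" by (simp add: numeral_2_eq_2)
  finally have ss: "s * s = 1 + u" .
  show "gsqrt x * gsqrt x = x"
    using assms by (subst (3) u(1)) (simp add: gs ss)
  have "body s = (\<Sum>r<K. if r = 0 then 1 else 0)"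
    unfolding s_def body_sum by (intro sum.cong) (auto simp: body_power u(2) c_def)
  then show "body (gsqrt x) = sqrt (body x)" using K by (simp add: gs)
  show "geven x \<Longrightarrow> geven (gsqrt x)" using u(3) by (auto simp: gs s_def)
qed

text \<open>
  If \<open>g\<^sup>2 = y\<^sup>2\<close> then \<open>(g + y) (g - y) = 0\<close>, and the first factor is invertible because its body is
  positive.  This makes the square root multiplicative.
\<close>

lemma gsqrt_unique:
  assumes "geven x" "body x > 0" "geven y" "body y > 0" "y * y = x"
  shows "gsqrt x = y"
proof -
  define g where "g = gsqrt x"
  have g: "g * g = x" "body g > 0" "geven g"
    using gsqrt_props[OF assms(2)] assms(1,2) by (simp_all add: g_def)
  have "(g + y) * g = (g + y) * y"
    unfolding distrib_right g(1) assms(5) geven_commute[OF assms(3), of g] by (rule add.commute)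
  moreover have "geven (g + y)" "body (g + y) \<noteq> 0"
    using g assms by simp_all
  ultimately show ?thesis using mult_left_cancel_grassmann g_def by blast
qed

lemma gsqrt_mult:
  assumes "geven x" "body x > 0" "geven y" "body y > 0"
  shows "gsqrt (x * y) = gsqrt x * gsqrt y"
proof (rule gsqrt_unique)
  note gx = gsqrt_props[OF assms(2)] and gy = gsqrt_props[OF assms(4)]
  have "gsqrt x * gsqrt y * (gsqrt x * gsqrt y) = gsqrt x * (gsqrt y * (gsqrt x * gsqrt y))"
    by (rule mult.assoc)
  also have "\<dots> = gsqrt x * (gsqrt x * (gsqrt y * gsqrt y))"
    by (subst geven_left_commute) (use gx assms in auto)
  also have "\<dots> = x * y" by (simp add: gx(1) gy(1) flip: mult.assoc)
  finally show "gsqrt x * gsqrt y * (gsqrt x * gsqrt y) = x * y" .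
qed (use assms gsqrt_props[OF assms(2)] gsqrt_props[OF assms(4)] in auto)

lemma gsqrt_of_real:
  assumes "r > 0"
  shows "gsqrt (of_real r) = of_real (sqrt r)"
proof (rule gsqrt_unique)
  show "of_real (sqrt r) * of_real (sqrt r) = (of_real r :: grassmann)"
    unfolding of_real_mult[symmetric] using assms by simp
qed (use assms in auto)

section \<open>Vectors of the super plane and their invariants\<close>

type_synonym super_vector = "grassmann \<times> grassmann \<times> grassmann"

definition super_vector :: "super_vector \<Rightarrow> bool" where
  "super_vector v \<longleftrightarrow> (case v of (x, y, z) \<Rightarrow> geven x \<and> geven y \<and> godd z)"

text \<open>
  The bilinear form preserved by the orthosymplectic group \<open>OSp(1|2)\<close>; the third component of a
  vector is odd.
\<close>

definition bracket :: "super_vector \<Rightarrow> super_vector \<Rightarrow> grassmann" where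
  "bracket u v = (case (u, v) of ((x, y, z), (x', y', z')) \<Rightarrow> x * y' - y * x' + z * z')"

text \<open>
  If the odd components of \<open>u\<close> and \<open>v\<close> vanish, this is the odd component of \<open>w\<close> times \<open>bracket u v\<close>.  The
  cubic term is the correction with which the exchange relations below hold exactly.
\<close>

definition odd_det :: "super_vector \<Rightarrow> super_vector \<Rightarrow> super_vector \<Rightarrow> grassmann" where
  "odd_det u v w = bracket v w * snd (snd u) + bracket w u * snd (snd v) + bracket u v * snd (snd w)
     - snd (snd u) * snd (snd v) * snd (snd w)"

lemma godd_left_anticommute: "godd x \<Longrightarrow> godd y \<Longrightarrow> y * (x * w) = - (x * (y * w))"
  by (metis godd_anticommute mult.assoc mult_minus_left)

lemma godd_left_square: "godd x \<Longrightarrow> x * (x * w) = 0"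
  by (metis godd_square mult.assoc mult_zero_left)

lemma geven_bracket [simp, intro]: "super_vector u \<Longrightarrow> super_vector v \<Longrightarrow> geven (bracket u v)"
  by (auto simp: super_vector_def bracket_def)

lemma godd_odd_det [simp, intro]:
  "super_vector u \<Longrightarrow> super_vector v \<Longrightarrow> super_vector w \<Longrightarrow> godd (odd_det u v w)"
proof -
  assume a: "super_vector u" "super_vector v" "super_vector w"
  then have "godd (snd (snd u))" "godd (snd (snd v))" "godd (snd (snd w))"
    by (auto simp: super_vector_def)
  with a show ?thesis by (auto simp: odd_det_def)
qed

lemma bracket_antisym:
  assumes "super_vector u" "super_vector v"
  shows "bracket v u = - bracket u v"
proof -
  obtain xa ya za xb yb zb where uv: "u = (xa, ya, za)" "v = (xb, yb, zb)" by (metis prod_cases3)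
  then have "xa * yb = yb * xa" "xb * ya = ya * xb" "zb * za = - (za * zb)"
    using assms by (auto simp: super_vector_def intro: geven_commute godd_anticommute)
  then show ?thesis by (simp add: uv bracket_def)
qed

lemma odd_det_rotate:
  assumes "super_vector u" "super_vector v" "super_vector w"
  shows "odd_det v w u = odd_det u v w"
proof -
  have "godd (snd (snd u))" "geven (snd (snd v) * snd (snd w))"
    using assms by (auto simp: super_vector_def)
  then have "snd (snd v) * snd (snd w) * snd (snd u) = snd (snd u) * (snd (snd v) * snd (snd w))"
    by (intro geven_commute[symmetric])
  then show ?thesis by (simp add: odd_det_def algebra_simps)
qed

lemma odd_det_swap:
  assumes "super_vector u" "super_vector v" "super_vector w"
  shows "odd_det v u w = - odd_det u v w"
proof -
  have "godd (snd (snd u))" "godd (snd (snd v))"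
    using assms by (auto simp: super_vector_def)
  then have "snd (snd v) * snd (snd u) = - (snd (snd u) * snd (snd v))"
    by (rule godd_anticommute)
  then show ?thesis
    using assms bracket_antisym[of u v] bracket_antisym[of u w] bracket_antisym[of v w]
    by (simp add: odd_det_def algebra_simps)
qed

context
  fixes a b c d :: super_vector
    and xa ya za xb yb zb xc yc zc xd yd zd :: grassmann
  assumes abcd: "a = (xa, ya, za)" "b = (xb, yb, zb)" "c = (xc, yc, zc)" "d = (xd, yd, zd)"
    and ev: "geven xa" "geven ya" "geven xb" "geven yb" "geven xc" "geven yc" "geven xd" "geven yd"
    and od: "godd za" "godd zb" "godd zc" "godd zd"
begin

lemmas normal_order = mult.assoc geven_commute geven_left_commute ev
  godd_square[OF od(1)] godd_square[OF od(2)] godd_square[OF od(3)] godd_square[OF od(4)]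
  godd_left_square[OF od(1)] godd_left_square[OF od(2)] godd_left_square[OF od(3)] godd_left_square[OF od(4)]
  godd_anticommute[OF od(1) od(2)] godd_left_anticommute[OF od(1) od(2)]
  godd_anticommute[OF od(1) od(3)] godd_left_anticommute[OF od(1) od(3)]
  godd_anticommute[OF od(1) od(4)] godd_left_anticommute[OF od(1) od(4)]
  godd_anticommute[OF od(2) od(3)] godd_left_anticommute[OF od(2) od(3)]
  godd_anticommute[OF od(2) od(4)] godd_left_anticommute[OF od(2) od(4)]
  godd_anticommute[OF od(3) od(4)] godd_left_anticommute[OF od(3) od(4)]

text \<open>
  The identities below are polynomial in eight central and four anticommuting elements.  Sorting
  every monomial with \<open>normal_order\<close> makes both sides literally equal.
\<close>

lemma linear_identity_coordinates:
  "bracket a c * odd_det a b d = bracket a b * odd_det a c d + bracket a d * odd_det a b c"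
  unfolding odd_det_def bracket_def abcd
  by (simp add: normal_order distrib_left distrib_right left_diff_distrib right_diff_distrib)

lemma ptolemy_coordinates:
  "bracket a c * (bracket a c * bracket b d - bracket a b * bracket c d - bracket a d * bracket b c)
     = odd_det a c d * odd_det a b c"
  unfolding odd_det_def bracket_def abcd
  by (simp add: normal_order distrib_left distrib_right left_diff_distrib right_diff_distrib)

lemma linear_identity'_coordinates:
  "bracket a c * odd_det b c d = bracket b c * odd_det a c d - bracket c d * odd_det a b c"
  unfolding odd_det_def bracket_def abcd
  by (simp add: normal_order distrib_left distrib_right left_diff_distrib right_diff_distrib)

end

context
  fixes a b c d :: super_vector
  assumes sv: "super_vector a" "super_vector b" "super_vector c" "super_vector d"
begin

text \<open>
  These are the rules for the mu-invariants of a flip, cleared of denominators and square roots.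
\<close>

lemma odd_det_exchange:
  "bracket a c * odd_det a b d = bracket a b * odd_det a c d + bracket a d * odd_det a b c"
  "bracket a c * odd_det b c d = bracket b c * odd_det a c d - bracket c d * odd_det a b c"
proof -
  obtain xa ya za xb yb zb xc yc zc xd yd zd where
    v: "a = (xa, ya, za)" "b = (xb, yb, zb)" "c = (xc, yc, zc)" "d = (xd, yd, zd)"
    by (metis prod_cases3)
  with sv have "geven xa" "geven ya" "geven xb" "geven yb" "geven xc" "geven yc" "geven xd" "geven yd"
    "godd za" "godd zb" "godd zc" "godd zd"
    by (simp_all add: super_vector_def)
  note c = v this
  show "bracket a c * odd_det a b d = bracket a b * odd_det a c d + bracket a d * odd_det a b c"
    by (rule linear_identity_coordinates[OF c])
  show "bracket a c * odd_det b c d = bracket b c * odd_det a c d - bracket c d * odd_det a b c"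
    by (rule linear_identity'_coordinates[OF c])
qed

text \<open>
  For vectors without odd components the left-hand side is the Pluecker relation times a bracket.  The
  product of the two odd invariants is the term \<open>\<sigma>\<theta>\<close> of the super Ptolemy relation.
\<close>

lemma bracket_ptolemy:
  "bracket a c * (bracket a c * bracket b d - bracket a b * bracket c d - bracket a d * bracket b c)
     = odd_det a c d * odd_det a b c"
proof -
  obtain xa ya za xb yb zb xc yc zc xd yd zd where
    v: "a = (xa, ya, za)" "b = (xb, yb, zb)" "c = (xc, yc, zc)" "d = (xd, yd, zd)"
    by (metis prod_cases3)
  with sv have "geven xa" "geven ya" "geven xb" "geven yb" "geven xc" "geven yc" "geven xd" "geven yd"
    "godd za" "godd zb" "godd zc" "godd zd"
    by (simp_all add: super_vector_def)
  note c = v this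
  show ?thesis by (rule ptolemy_coordinates[OF c])
qed

end

text \<open>
  The prescribed odd invariant is linear in the odd component of \<open>v\<close>, because the cubic term only
  changes its coefficient into \<open>k\<close>; once this component is known, the two brackets are linear equations
  for the even ones, with the same invertible determinant \<open>k\<close>.
\<close>

lemma super_vector_exists:
  assumes sv: "super_vector a" "super_vector c" and b: "body (bracket a c) \<noteq> 0"
    and par: "geven \<alpha>" "geven \<gamma>" "godd \<delta>"
  obtains v where "super_vector v" "bracket a v = \<alpha>" "bracket v c = \<gamma>" "odd_det a v c = \<delta>"
proof -
  obtain xa ya za xc yc zc where v: "a = (xa, ya, za)" "c = (xc, yc, zc)" by (metis prod_cases3)
  with sv have ev: "geven xa" "geven ya" "geven xc" "geven yc" and od: "godd za" "godd zc"
    by (simp_all add: super_vector_def)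
  define k where "k = xa * yc - ya * xc"
  define j where "j = inverse k"
  have k: "geven k" "bracket a c = k + za * zc" using ev by (auto simp: k_def v bracket_def)
  have "body k \<noteq> 0" using b od by (simp add: k(2) body_godd)
  then have kj: "k * j = 1" and j: "geven j"
    using k(1) mult_inverse_grassmann by (auto simp: j_def)
  define z where "z = j * (\<gamma> * za + \<alpha> * zc - \<delta>)"
  define p where "p = \<alpha> - za * z"
  define q where "q = \<gamma> - z * zc"
  define x where "x = j * (q * xa + p * xc)"
  define y where "y = j * (q * ya + p * yc)"
  have z: "godd z" unfolding z_def using j par od by blast
  have pq: "geven p" "geven q" using par od z by (auto simp: p_def q_def)
  have jk: "j * k = 1" using kj geven_commute[OF k(1), of j] by simp
  have "xa * y - ya * x = p * (j * k)" "x * yc - y * xc = q * (j * k)"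
    unfolding x_def y_def k_def using pq j ev
    by (simp_all add: mult.assoc geven_commute geven_left_commute distrib_left right_diff_distrib)
  then have xy: "xa * y - ya * x = p" "x * yc - y * xc = q" by (simp_all add: jk)
  have b: "bracket a (x, y, z) = \<alpha>" "bracket (x, y, z) c = \<gamma>"
    using xy by (simp_all add: v bracket_def p_def q_def)
  have sx: "super_vector (x, y, z)" using ev pq j z by (auto simp: super_vector_def x_def y_def)
  have kz: "k * z = \<gamma> * za + \<alpha> * zc - \<delta>" unfolding z_def by (simp add: kj flip: mult.assoc)
  have "odd_det a (x, y, z) c = \<gamma> * za - (k + za * zc) * z + \<alpha> * zc - za * z * zc"
    using bracket_antisym[OF sv] by (simp add: odd_det_def b k(2)) (simp add: v algebra_simps)
  also have "\<dots> = \<gamma> * za + \<alpha> * zc - k * z - (za * (zc * z) + za * (z * zc))"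
    by (simp add: algebra_simps)
  also have "\<dots> = \<delta>" using godd_anticommute[OF z od(2)] by (simp add: kz)
  finally show thesis using that sx b by blast
qed

section \<open>Noncrossing arcs and the quadrilateral of a flip\<close>

lemma cw_rotate: "cw p q r \<longleftrightarrow> cw q r p"
  by (auto simp: cw_def)

lemma cw_distinct: "cw p q r \<Longrightarrow> p \<noteq> q \<and> q \<noteq> r \<and> p \<noteq> r"
  by (auto simp: cw_def)

lemma cw_asym: "cw p q r \<Longrightarrow> \<not> cw p r q"
  by (auto simp: cw_def)

lemma cw_trans: "cw p q r \<Longrightarrow> cw p r s \<Longrightarrow> cw p q s"
  unfolding cw_def by auto
lemma cw_trans': "cw p q r \<Longrightarrow> cw p r s \<Longrightarrow> cw q r s"
  unfolding cw_def by auto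
lemma cw_between:
  assumes "cw a x b" "cw a y b"
  shows "x = y \<or> cw a x y \<and> cw x y b \<or> cw a y x \<and> cw y x b"
proof (cases x y rule: linorder_cases)
  case less then show ?thesis using assms unfolding cw_def by auto
next
  case greater then show ?thesis using assms unfolding cw_def by auto
qed simp
lemma cw_sides: assumes "a \<noteq> b" "r \<noteq> a" "r \<noteq> b" shows "cw a r b \<or> cw b r a"
  using assms unfolding cw_def by auto

lemma cw_four:
  assumes "cw p t q" "cw p q s" shows "cw p t s" "cw t q s" "cw t s p" "cw q s p" "cw q s t" "cw s p t" "cw s p q" "cw s t q" "cw t q p" "cw q p t"
  using cw_trans[OF assms] cw_trans'[OF assms] assms cw_rotate by metis+

lemma cw_same_triple:
  assumes "cw u v w" "cw p q r" "{u, v, w} = {p, q, r}"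
  shows "u = p \<and> v = q \<and> w = r \<or> u = q \<and> v = r \<and> w = p \<or> u = r \<and> v = p \<and> w = q"
proof -
  have n: "\<not> cw p r q" "\<not> cw r q p" "\<not> cw q p r"
    using cw_asym[OF assms(2)] cw_rotate by blast+
  have "u \<noteq> v" "v \<noteq> w" "u \<noteq> w" using cw_distinct[OF assms(1)] by auto
  moreover have "u \<in> {p, q, r}" "v \<in> {p, q, r}" "w \<in> {p, q, r}" using assms(3) by auto
  ultimately consider "u = p \<and> v = q \<and> w = r \<or> u = q \<and> v = r \<and> w = p \<or> u = r \<and> v = p \<and> w = q"
    | "u = p" "v = r" "w = q" | "u = r" "v = q" "w = p" | "u = q" "v = p" "w = r"
    by blast
  then show ?thesis using assms(1) n by cases auto
qed

definition noncrossing :: "nat set set \<Rightarrow> bool" where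
  "noncrossing A \<longleftrightarrow> (\<forall>p q r s. {p, q} \<in> A \<and> {r, s} \<in> A \<longrightarrow> \<not> (cw p r q \<and> cw q s p))"

lemma noncrossingD: "noncrossing A \<Longrightarrow> {p, q} \<in> A \<Longrightarrow> {r, s} \<in> A \<Longrightarrow> cw p r q \<Longrightarrow> cw q s p \<Longrightarrow> False"
  unfolding noncrossing_def by blast

text \<open>
  Of two different apexes on one side of \<open>{p, q}\<close> the second side of one crosses the first side of the
  other.
\<close>

lemma noncrossing_apex_unique:
  assumes "noncrossing A" "cw p t q" "cw p t' q" "{p, t} \<in> A" "{t, q} \<in> A" "{p, t'} \<in> A" "{t', q} \<in> A"
  shows "t = t'"
proof (rule ccontr)
  assume "t \<noteq> t'"
  then consider "cw p t t'" | "cw p t' t" using cw_between[OF assms(2,3)] by auto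
  then show False
  proof cases
    case 1
    moreover have "cw t' q p" using assms(3) cw_rotate by blast
    ultimately show ?thesis using assms noncrossingD[of A p t' t q] by blast
  next
    case 2
    moreover have "cw t q p" using assms(2) cw_rotate by blast
    ultimately show ?thesis using assms noncrossingD[of A p t t' q] by blast
  qed
qed

lemma crossing_sym:
  assumes "cw u r v" "cw v w u"
  shows "cw r v w" "cw w u r"
proof -
  have "cw u v w" using assms(2) cw_rotate by blast
  note cw_trans'[OF assms(1) this] cw_trans[OF assms(1) this]
  then show "cw r v w" "cw w u r" using cw_rotate by blast+
qed

text \<open>
  A chord that crosses the new diagonal \<open>{s, t}\<close> leaves the quadrilateral through one of its sides,
  unless it is the old diagonal.
\<close>

lemma crossing_side:
  assumes "cw p t q" "cw p q s" "cw s r t" "cw t w s" "{r, w} \<noteq> {p, q}"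
  shows "cw p r t \<and> cw t w p \<or> cw t w q \<and> cw q p t \<and> r = p \<or> cw q w s \<and> cw s p q \<and> r = p \<or> cw s r p \<and> cw p w s"
proof -
  note f = cw_four[OF assms(1,2)]
  consider "r = p" | "cw p r t" | "cw s r p"
    using cw_between[OF assms(3) f(6)] by auto
  then show ?thesis
  proof cases
    case 1
    then have "w \<noteq> q" using assms(5) by auto
    then have "cw t w q \<or> cw q w s" using cw_between[OF assms(4), of q] f by auto
    with 1 f show ?thesis by auto
  next
    case 2
    with cw_trans[OF assms(4) f(3)] show ?thesis by auto
  next
    case 3
    have "cw p w s" using cw_trans'[of s p t w] f(6) assms(4) cw_rotate cw_trans by metis
    with 3 show ?thesis by auto
  qed
qed

lemma apex_position:
  assumes "cw p t q" "cw p q s" "r \<noteq> s" "r \<noteq> t" "r \<noteq> p" "r \<noteq> q"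
  shows "(cw p r t \<and> cw t s p) \<or> (cw t r q \<and> cw q s t) \<or> (cw q r s \<and> cw s t q) \<or> (cw s r p \<and> cw p t s)"
proof -
  note f = cw_four[OF assms(1,2)]
  have "s \<noteq> t" using f(1) cw_distinct by blast
  then consider "cw s r t" | "cw t r s" using cw_sides[of s t r] assms by auto
  then show ?thesis
    by cases (use cw_between[of s r t p] cw_between[of t r s q] f assms in auto)
qed

locale quad =
  fixes A p t q s
  assumes nc: "noncrossing A" and cw: "cw p t q" "cw p q s"
    and sides: "{p, q} \<in> A" "{p, t} \<in> A" "{t, q} \<in> A" "{q, s} \<in> A" "{s, p} \<in> A"
begin

definition A' where "A' = insert {s, t} (A - {{p, q}})"

lemma not_crossing_new:
  assumes "{r, w} \<in> A - {{p, q}}"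
  shows "\<not> (cw s r t \<and> cw t w s)"
proof
  assume c: "cw s r t \<and> cw t w s"
  have rw: "{r, w} \<in> A" "{w, r} \<in> A" "{r, w} \<noteq> {p, q}" using assms by (auto simp: insert_commute)
  consider "cw p r t" "cw t w p" | "cw t w q" "cw q p t" "r = p" | "cw q w s" "cw s p q" "r = p"
    | "cw s r p" "cw p w s"
    using crossing_side[OF cw, of r w] c rw(3) by blast
  then show False
  proof cases
    case 1 then show ?thesis using noncrossingD[OF nc sides(2) rw(1)] by blast
  next
    case 2 then show ?thesis using noncrossingD[OF nc sides(3) rw(2)] by blast
  next
    case 3 then show ?thesis using noncrossingD[OF nc sides(4) rw(2)] by blast
  next
    case 4 then show ?thesis using noncrossingD[OF nc sides(5) rw(1)] by blast
  qed
qed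

lemma noncrossing_new: "noncrossing A'"
  unfolding noncrossing_def
proof (intro allI impI)
  fix u v r w assume "{u, v} \<in> A' \<and> {r, w} \<in> A'"
  then have "{u, v} = {s, t} \<or> {u, v} \<in> A - {{p, q}}" "{r, w} = {s, t} \<or> {r, w} \<in> A - {{p, q}}"
    unfolding A'_def by simp_all
  then show "\<not> (cw u r v \<and> cw v w u)"
  proof (elim disjE)
    assume "{u, v} = {s, t}" "{r, w} = {s, t}"
    then show ?thesis
      using cw_distinct[of u r v] cw_distinct[of v w u] by (auto simp: doubleton_eq_iff)
  next
    assume a: "{u, v} = {s, t}" "{r, w} \<in> A - {{p, q}}"
    then have "{w, r} \<in> A - {{p, q}}" by (simp add: insert_commute)
    with a show ?thesis using not_crossing_new by (auto simp: doubleton_eq_iff)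
  next
    assume a: "{u, v} \<in> A - {{p, q}}" "{r, w} = {s, t}"
    then have "{v, u} \<in> A - {{p, q}}" by (simp add: insert_commute)
    with a have "\<not> (cw s v t \<and> cw t u s)" "\<not> (cw s u t \<and> cw t v s)"
      using not_crossing_new by blast+
    with a show ?thesis using crossing_sym[of u r v w] by (auto simp: doubleton_eq_iff)
  next
    assume "{u, v} \<in> A - {{p, q}}" "{r, w} \<in> A - {{p, q}}"
    then show ?thesis using nc noncrossingD by blast
  qed
qed

text \<open>
  Elsewhere the apex would see \<open>s\<close> or \<open>t\<close> only across a side of the quadrilateral.
\<close>

lemma apex_new:
  assumes "{s, r} \<in> A" "{t, r} \<in> A" "r \<noteq> s" "r \<noteq> t"
  shows "r = p \<or> r = q"
proof (rule ccontr)
  assume "\<not> ?thesis"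
  then consider "cw p r t" "cw t s p" | "cw t r q" "cw q s t" | "cw q r s" "cw s t q" | "cw s r p" "cw p t s"
    using apex_position[OF cw, of r] assms(3,4) by blast
  then show False
  proof cases
    case 1 then show ?thesis using noncrossingD[OF nc sides(2), of r s] assms by (simp add: insert_commute)
  next
    case 2 then show ?thesis using noncrossingD[OF nc sides(3), of r s] assms by (simp add: insert_commute)
  next
    case 3 then show ?thesis using noncrossingD[OF nc sides(4), of r t] assms by (simp add: insert_commute)
  next
    case 4 then show ?thesis using noncrossingD[OF nc sides(5), of r t] assms by (simp add: insert_commute)
  qed
qed

end

section \<open>Decorations that come from vectors\<close>

text \<open>
  Going once around the polygon turns the vector of a vertex into its negative.  This sign makes up
  for it, so that \<open>lam\<close> below is symmetric.
\<close>

definition sg :: "nat \<Rightarrow> nat \<Rightarrow> real" where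
  "sg p q = (if p < q then 1 else - 1)"

lemma sg_square [simp]: "sg p q * sg p q = 1" "sg p q * (sg p q * r) = r"
  by (auto simp: sg_def)

lemma sg_flip: "p \<noteq> q \<Longrightarrow> sg q p = - sg p q"
  by (auto simp: sg_def)

lemma sg_cw:
  assumes "cw p q r"
  shows "sg p q * sg q r = sg p r" "sg p q * sg p r = sg q r" "sg q r * sg p r = sg p q"
  using assms by (auto simp: sg_def cw_def)

definition lam :: "(nat \<Rightarrow> super_vector) \<Rightarrow> nat \<Rightarrow> nat \<Rightarrow> grassmann" where
  "lam V p q = sg p q *\<^sub>R bracket (V p) (V q)"

definition det3 :: "(nat \<Rightarrow> super_vector) \<Rightarrow> nat \<Rightarrow> nat \<Rightarrow> nat \<Rightarrow> grassmann" where
  "det3 V p q r = odd_det (V p) (V q) (V r)"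

text \<open>
  Capital letters stand for the square roots of the lambda-lengths in the definition of a flip; on the
  left of the first two identities is a new mu-invariant, normalized by the sides of its triangle.
\<close>

lemma flip_algebra:
  fixes A B C D E F \<theta> \<sigma> :: grassmann
  assumes ev: "geven A" "geven B" "geven C" "geven D" "geven E" "geven F"
    and pos: "body E > 0" "body F > 0"
  shows "(E * E) * ((\<theta> * (B * D) + \<sigma> * (A * C)) / (E * F) * (A * (F * D)))
           = (D * D) * (\<theta> * (A * (B * E))) + (A * A) * (\<sigma> * (C * (D * E)))"
    and "(E * E) * ((\<sigma> * (B * D) - \<theta> * (A * C)) / (E * F) * (B * (C * F)))
           = (B * B) * (\<sigma> * (C * (D * E))) - (C * C) * (\<theta> * (A * (B * E)))"
    and "E * E * (A * (B * (C * D)) * \<sigma> * \<theta>) = (\<sigma> * (C * (D * E))) * (\<theta> * (A * (B * E)))"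
proof -
  note order = mult.assoc geven_commute geven_left_commute ev distrib_left distrib_right
    left_diff_distrib right_diff_distrib
  have EF: "geven (E * F)" "body (E * F) \<noteq> 0" using ev pos by auto
  have c: "E * F * (u / (E * F)) = u" for u by (rule divide_mult_cancel[OF EF])
  have "(E * E) * (u / (E * F) * (A * (F * D))) = E * (A * D) * u" for u
    by (subst (3) c[symmetric]) (simp add: order)
  then show "(E * E) * ((\<theta> * (B * D) + \<sigma> * (A * C)) / (E * F) * (A * (F * D)))
           = (D * D) * (\<theta> * (A * (B * E))) + (A * A) * (\<sigma> * (C * (D * E)))"
    by (simp add: order)
  have "(E * E) * (u / (E * F) * (B * (C * F))) = E * (B * C) * u" for u
    by (subst (3) c[symmetric]) (simp add: order)
  then show "(E * E) * ((\<sigma> * (B * D) - \<theta> * (A * C)) / (E * F) * (B * (C * F)))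
           = (B * B) * (\<sigma> * (C * (D * E))) - (C * C) * (\<theta> * (A * (B * E)))"
    by (simp add: order)
  show "E * E * (A * (B * (C * D)) * \<sigma> * \<theta>) = (\<sigma> * (C * (D * E))) * (\<theta> * (A * (B * E)))"
    by (simp add: order)
qed

locale super_vectors =
  fixes V :: "nat \<Rightarrow> super_vector"
  assumes sv [simp]: "super_vector (V i)"
begin

abbreviation "rt p q \<equiv> gsqrt (lam V p q)"
abbreviation "det \<equiv> det3 V"

lemma geven_lam [simp]: "geven (lam V p q)"
  by (simp add: lam_def)

lemma godd_det3 [simp]: "godd (det3 V p q r)"
  by (simp add: det3_def)

lemma lam_sym: "p \<noteq> q \<Longrightarrow> lam V q p = lam V p q"
  using bracket_antisym[of "V p" "V q"] by (simp add: lam_def sg_flip[of p q])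

lemma bracket_lam: "bracket (V p) (V q) = sg p q *\<^sub>R lam V p q"
  by (simp add: lam_def)

lemma det3_rotate: "det q r p = det p q r"
  by (simp add: det3_def odd_det_rotate)

text \<open>
  By \<open>sg_cw\<close> the three products of brackets in the Ptolemy relation carry the same sign.
\<close>

lemma lam_ptolemy:
  assumes cw: "cw p t q" "cw p q s"
  shows "lam V p q * (lam V p q * lam V t s - lam V p t * lam V q s - lam V t q * lam V p s)
           = sg t s *\<^sub>R (det p q s * det p t q)"
proof -
  note f = cw_four[OF cw]
  have "sg p t * sg q s = sg p t * sg t q * sg t s" using sg_cw(2)[OF f(2)] by (simp add: mult.assoc)
  then have 1: "sg p t * sg q s = sg p q * sg t s" using sg_cw(1)[OF cw(1)] by simp
  have "sg t q * sg p s = sg p q * (sg t q * sg q s)" using sg_cw(1)[OF cw(2)] by (simp add: mult_ac)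
  then have 2: "sg t q * sg p s = sg p q * sg t s" using sg_cw(1)[OF f(2)] by simp
  have "bracket (V p) (V q) * (bracket (V p) (V q) * bracket (V t) (V s)
      - bracket (V p) (V t) * bracket (V q) (V s) - bracket (V p) (V s) * bracket (V t) (V q))
     = det p q s * det p t q"
    unfolding det3_def by (rule bracket_ptolemy) simp_all
  also have "bracket (V p) (V s) * bracket (V t) (V q) = bracket (V t) (V q) * bracket (V p) (V s)"
    by (simp add: geven_commute)
  finally have "sg p q *\<^sub>R (lam V p q * ((sg p q * sg t s) *\<^sub>R (lam V p q * lam V t s)
      - (sg p t * sg q s) *\<^sub>R (lam V p t * lam V q s) - (sg t q * sg p s) *\<^sub>R (lam V t q * lam V p s)))
     = det p q s * det p t q"
    by (simp add: bracket_lam mult.commute)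
  then have "sg t s *\<^sub>R (lam V p q * (lam V p q * lam V t s - lam V p t * lam V q s - lam V t q * lam V p s))
     = det p q s * det p t q"
    unfolding 1 2 scaleR_diff_right[symmetric] by simp
  then have "sg t s *\<^sub>R (sg t s *\<^sub>R (lam V p q * (lam V p q * lam V t s - lam V p t * lam V q s - lam V t q * lam V p s)))
     = sg t s *\<^sub>R (det p q s * det p t q)" by simp
  then show ?thesis by simp
qed

lemma det3_exchange:
  assumes cw: "cw p t q" "cw p q s"
  shows "(sg p q * sg p s) *\<^sub>R (lam V p q * det p t s) = sg t s *\<^sub>R (lam V p t * det p q s) + lam V p s * det p t q"
    and "(sg p q * sg q s) *\<^sub>R (lam V p q * det t q s) = sg t s *\<^sub>R (lam V t q * det p q s) - lam V q s * det p t q"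
proof -
  note f = cw_four[OF cw]
  have s: "sg p s * sg p t = sg t s" "sg q s * sg t q = sg t s"
    using sg_cw(2)[OF f(1)] sg_cw(1)[OF f(2)] by (simp_all add: mult.commute)
  have "bracket (V p) (V q) * det p t s = bracket (V p) (V t) * det p q s + bracket (V p) (V s) * det p t q"
    unfolding det3_def by (rule odd_det_exchange) simp_all
  then have "sg p s *\<^sub>R (bracket (V p) (V q) * det p t s)
      = sg p s *\<^sub>R (bracket (V p) (V t) * det p q s + bracket (V p) (V s) * det p t q)" by simp
  then show "(sg p q * sg p s) *\<^sub>R (lam V p q * det p t s) = sg t s *\<^sub>R (lam V p t * det p q s) + lam V p s * det p t q"
    by (simp add: bracket_lam scaleR_add_right s mult.commute)
  have "bracket (V p) (V q) * det t q s = bracket (V t) (V q) * det p q s - bracket (V q) (V s) * det p t q"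
    unfolding det3_def by (rule odd_det_exchange) simp_all
  then have "sg q s *\<^sub>R (bracket (V p) (V q) * det t q s)
      = sg q s *\<^sub>R (bracket (V t) (V q) * det p q s - bracket (V q) (V s) * det p t q)" by simp
  then show "(sg p q * sg q s) *\<^sub>R (lam V p q * det t q s) = sg t s *\<^sub>R (lam V t q * det p q s) - lam V q s * det p t q"
    by (simp add: bracket_lam scaleR_diff_right s mult.commute)
qed

lemma body_lam_new:
  assumes cw: "cw p t q" "cw p q s"
    and pos: "body (lam V p q) > 0" "body (lam V p t) > 0" "body (lam V t q) > 0" "body (lam V q s) > 0"
      "body (lam V p s) > 0"
  shows "body (lam V t s) > 0"
proof -
  have "body (lam V p q) * (body (lam V p q) * body (lam V t s)) = body (lam V p q)
      * (body (lam V p t) * body (lam V q s) + body (lam V t q) * body (lam V p s))"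
    using arg_cong[OF lam_ptolemy[OF cw], of body] by (simp add: body_godd algebra_simps)
  then have "body (lam V p q) * body (lam V t s)
     = body (lam V p t) * body (lam V q s) + body (lam V t q) * body (lam V p s)"
    using pos(1) by simp
  moreover have "\<dots> > 0" using pos by (simp add: add_pos_pos)
  ultimately show ?thesis using pos(1) by (metis zero_less_mult_pos)
qed

text \<open>
  A flip applied to decorations that come from vectors gives the decorations that come from the same
  vectors, provided that the signs \<open>k\<close> and \<open>k'\<close> of the two odd invariants are related as in the last
  assumption.
\<close>

lemma flip_values:
  assumes cw: "cw p t q" "cw p q s"
    and pos: "body (lam V p q) > 0" "body (lam V p t) > 0" "body (lam V t q) > 0" "body (lam V q s) > 0"
      "body (lam V p s) > 0"
    and th: "\<theta> * (rt p t * (rt t q * rt p q)) = k *\<^sub>R det p t q"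
    and si: "\<sigma> * (rt q s * (rt p s * rt p q)) = k' *\<^sub>R det p q s"
    and k: "k * k = 1" "k' = k * sg t s"
  shows "(lam V p t * lam V q s + lam V t q * lam V p s
      + gsqrt (lam V p t * lam V t q * lam V q s * lam V p s) * \<sigma> * \<theta>) / lam V p q = lam V t s"
    and "(\<theta> * gsqrt (lam V t q * lam V p s) + \<sigma> * gsqrt (lam V p t * lam V q s)) / gsqrt (lam V p q * lam V t s)
      * (rt p t * (rt t s * rt p s)) = (k * sg p q * sg p s) *\<^sub>R det p t s"
    and "(\<sigma> * gsqrt (lam V t q * lam V p s) - \<theta> * gsqrt (lam V p t * lam V q s)) / gsqrt (lam V p q * lam V t s)
      * (rt t q * (rt q s * rt t s)) = (k * sg p q * sg q s) *\<^sub>R det t q s"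
proof -
  have ts: "body (lam V t s) > 0" by (rule body_lam_new[OF cw pos])
  note r = gsqrt_props[OF pos(1)] gsqrt_props[OF pos(2)] gsqrt_props[OF pos(3)] gsqrt_props[OF pos(4)]
    gsqrt_props[OF pos(5)] gsqrt_props[OF ts]
  note pos' = pos ts
  have roots: "gsqrt (lam V p t * lam V t q * lam V q s * lam V p s)
       = rt p t * (rt t q * (rt q s * rt p s))"
     "gsqrt (lam V t q * lam V p s) = rt t q * rt p s"
     "gsqrt (lam V p t * lam V q s) = rt p t * rt q s"
     "gsqrt (lam V p q * lam V t s) = rt p q * rt t s"
    using pos' by (simp_all add: gsqrt_mult mult.assoc)
  have e: "geven (rt p t)" "geven (rt t q)" "geven (rt q s)" "geven (rt p s)" "geven (rt p q)"
     "geven (rt t s)" "body (rt p q) > 0" "body (rt t s) > 0"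
    using r pos' by simp_all
  note alg = flip_algebra[OF e]
  have nz: "body (lam V p q) \<noteq> 0" using pos(1) by simp
  note cancel = mult_left_cancel_grassmann[OF geven_lam nz]
  have "lam V p q * (rt p t * (rt t q * (rt q s * rt p s)) * \<sigma> * \<theta>)
      = (k' * k) *\<^sub>R (det p q s * det p t q)"
    using alg(3)[of \<sigma> \<theta>] by (simp add: r th si)
  also have "k' * k = sg t s" using k by (simp add: mult_ac)
  finally have "lam V p q * (rt p t * (rt t q * (rt q s * rt p s)) * \<sigma> * \<theta>)
     = lam V p q * (lam V p q * lam V t s - lam V p t * lam V q s - lam V t q * lam V p s)"
    using lam_ptolemy[OF cw] by simp
  then have "rt p t * (rt t q * (rt q s * rt p s)) * \<sigma> * \<theta>
     = lam V p q * lam V t s - lam V p t * lam V q s - lam V t q * lam V p s" by (rule cancel)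
  then show "(lam V p t * lam V q s + lam V t q * lam V p s
      + gsqrt (lam V p t * lam V t q * lam V q s * lam V p s) * \<sigma> * \<theta>) / lam V p q = lam V t s"
    unfolding roots by (intro divide_eqI[OF geven_lam nz]) simp
  show "(\<theta> * gsqrt (lam V t q * lam V p s) + \<sigma> * gsqrt (lam V p t * lam V q s)) / gsqrt (lam V p q * lam V t s)
      * (rt p t * (rt t s * rt p s)) = (k * sg p q * sg p s) *\<^sub>R det p t s"
  proof (rule cancel)
    have "lam V p q * ((\<theta> * gsqrt (lam V t q * lam V p s) + \<sigma> * gsqrt (lam V p t * lam V q s)) / gsqrt (lam V p q * lam V t s)
      * (rt p t * (rt t s * rt p s))) = k *\<^sub>R (sg t s *\<^sub>R (lam V p t * det p q s) + lam V p s * det p t q)"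
      using alg(1)[of \<theta> \<sigma>] k unfolding roots by (simp add: r th si scaleR_add_right)
    also have "\<dots> = (k * (sg p q * sg p s)) *\<^sub>R (lam V p q * det p t s)"
      by (simp only: det3_exchange[OF cw, symmetric]) simp
    finally show "lam V p q * ((\<theta> * gsqrt (lam V t q * lam V p s) + \<sigma> * gsqrt (lam V p t * lam V q s)) / gsqrt (lam V p q * lam V t s)
      * (rt p t * (rt t s * rt p s))) = lam V p q * (k * sg p q * sg p s) *\<^sub>R det p t s"
      by (simp add: mult.assoc)
  qed
  show "(\<sigma> * gsqrt (lam V t q * lam V p s) - \<theta> * gsqrt (lam V p t * lam V q s)) / gsqrt (lam V p q * lam V t s)
      * (rt t q * (rt q s * rt t s)) = (k * sg p q * sg q s) *\<^sub>R det t q s"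
  proof (rule cancel)
    have "lam V p q * ((\<sigma> * gsqrt (lam V t q * lam V p s) - \<theta> * gsqrt (lam V p t * lam V q s)) / gsqrt (lam V p q * lam V t s)
      * (rt t q * (rt q s * rt t s))) = k *\<^sub>R (sg t s *\<^sub>R (lam V t q * det p q s) - lam V q s * det p t q)"
      using alg(2)[of \<sigma> \<theta>] k unfolding roots by (simp add: r th si scaleR_diff_right)
    also have "\<dots> = (k * (sg p q * sg q s)) *\<^sub>R (lam V p q * det t q s)"
      by (simp only: det3_exchange[OF cw, symmetric]) simp
    finally show "lam V p q * ((\<sigma> * gsqrt (lam V t q * lam V p s) - \<theta> * gsqrt (lam V p t * lam V q s)) / gsqrt (lam V p q * lam V t s)
      * (rt t q * (rt q s * rt t s))) = lam V p q * (k * sg p q * sg q s) *\<^sub>R det t q s"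
      by (simp add: mult.assoc)
  qed
qed

text \<open>
  The mu-invariant is the odd invariant divided by the square roots of the sides, up to the sign
  \<open>\<epsilon>\<close> of the triangle.
\<close>

definition triangle_ok :: "decorated \<Rightarrow> (nat set \<Rightarrow> real) \<Rightarrow> nat \<Rightarrow> nat \<Rightarrow> nat \<Rightarrow> bool" where
  "triangle_ok D \<epsilon> p q r \<longleftrightarrow>
     mu D {p, q, r} * (rt p q * (rt q r * rt p r)) = \<epsilon> {p, q, r} *\<^sub>R det p q r"

text \<open>
  The last clause says what an orientation is: up to the cocycle \<open>sg\<close>, it records whether the two
  triangles next to an interior arc have the same sign.  Nothing is claimed about boundary sides, whose
  orientation never matters.
\<close>

definition compatible :: "(nat set \<Rightarrow> real) \<Rightarrow> decorated \<Rightarrow> bool" where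
  "compatible \<epsilon> D \<longleftrightarrow> (\<forall>t. \<epsilon> t * \<epsilon> t = 1) \<and> noncrossing (arcs D) \<and>
     (\<forall>p q. {p, q} \<in> arcs D \<and> p \<noteq> q \<longrightarrow> len D {p, q} = lam V p q \<and> body (lam V p q) > 0) \<and>
     (\<forall>p q r. cw p q r \<and> {p, q} \<in> arcs D \<and> {q, r} \<in> arcs D \<and> {p, r} \<in> arcs D \<longrightarrow> triangle_ok D \<epsilon> p q r) \<and>
     (\<forall>p t q s. cw p t q \<and> cw p q s \<and> {{p, q}, {p, t}, {t, q}, {q, s}, {s, p}} \<subseteq> arcs D \<longrightarrow>
        (dir D p q \<longleftrightarrow> \<epsilon> {p, t, q} * \<epsilon> {p, q, s} = sg t s))"

lemma triangle_ok_rotate: "triangle_ok D \<epsilon> p q r \<Longrightarrow> p \<noteq> q \<Longrightarrow> p \<noteq> r \<Longrightarrow>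
   body (lam V p q) > 0 \<Longrightarrow> body (lam V q r) > 0 \<Longrightarrow> body (lam V p r) > 0 \<Longrightarrow> triangle_ok D \<epsilon> q r p"
  using gsqrt_props(3)[of "lam V p q"] gsqrt_props(3)[of "lam V q r"] gsqrt_props(3)[of "lam V p r"]
  unfolding triangle_ok_def
  by (simp add: det3_rotate lam_sym[of p q] lam_sym[of p r] insert_commute geven_commute geven_left_commute)

end

context quad
begin

lemma distinct: "p \<noteq> t" "p \<noteq> q" "p \<noteq> s" "t \<noteq> q" "t \<noteq> s" "q \<noteq> s"
  using cw cw_four[OF cw] cw_distinct by blast+

lemma triangle_cases:
  assumes "cw u v w" "{u, v} \<in> A'" "{v, w} \<in> A'" "{u, w} \<in> A'"
  obtains (new) "{u, v, w} = {p, t, s} \<or> {u, v, w} = {q, t, s}"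
    | (old) "{u, v} \<in> A" "{v, w} \<in> A" "{u, w} \<in> A" "\<not> {s, t} \<subseteq> {u, v, w}"
proof (cases "{s, t} \<subseteq> {u, v, w}")
  case False
  then have "{u, v} \<in> A" "{v, w} \<in> A" "{u, w} \<in> A" using assms unfolding A'_def by auto
  with False show thesis using old by blast
next
  case True
  obtain r where r: "{u, v, w} = {s, t, r}" "r \<noteq> s" "r \<noteq> t"
    and sides: "{s, r} \<in> A'" "{t, r} \<in> A'"
  proof -
    have d: "u \<noteq> v" "v \<noteq> w" "u \<noteq> w" using cw_distinct[OF assms(1)] by auto
    consider "{u, v} = {s, t}" | "{v, w} = {s, t}" | "{u, w} = {s, t}"
      using True distinct(5) by auto
    then show thesis
    proof cases
      case 1 with d assms show thesis by (intro that[of w]) (auto simp: doubleton_eq_iff insert_commute)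
    next
      case 2 with d assms show thesis by (intro that[of u]) (auto simp: doubleton_eq_iff insert_commute)
    next
      case 3 with d assms show thesis by (intro that[of v]) (auto simp: doubleton_eq_iff insert_commute)
    qed
  qed
  then have "{s, r} \<in> A" "{t, r} \<in> A" unfolding A'_def by (auto simp: doubleton_eq_iff)
  then have "r = p \<or> r = q" using apex_new r by blast
  with r(1) show thesis using new by (auto simp: insert_commute)
qed

end

text \<open>
  Used for two apexes \<open>a\<close>, \<open>b\<close> on one side of the arc \<open>{u, w}\<close>, before and after a flip, and the apex \<open>z\<close> on
  its other side.
\<close>

lemma cw_five: "cw u a b \<Longrightarrow> cw u b w \<Longrightarrow> cw u w z \<Longrightarrow> cw a b z"
  using cw_trans cw_trans' by blast

lemma sg_transfer:
  assumes "sg a1 a2 * sg c1 c2 = b"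
  shows "x * y = sg a1 a2 \<longleftrightarrow> x * (y * b) = sg c1 c2" "y * x = sg a1 a2 \<longleftrightarrow> y * b * x = sg c1 c2"
  using assms by (auto simp: sg_def split: if_splits)

context super_vectors
begin

lemma compatibleD:
  assumes "compatible \<epsilon> D"
  shows "\<epsilon> t * \<epsilon> t = 1" "noncrossing (arcs D)"
    and "{p, q} \<in> arcs D \<Longrightarrow> p \<noteq> q \<Longrightarrow> len D {p, q} = lam V p q"
    and "{p, q} \<in> arcs D \<Longrightarrow> p \<noteq> q \<Longrightarrow> body (lam V p q) > 0"
    and "cw p q r \<Longrightarrow> {p, q} \<in> arcs D \<Longrightarrow> {q, r} \<in> arcs D \<Longrightarrow> {p, r} \<in> arcs D \<Longrightarrow> triangle_ok D \<epsilon> p q r"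
    and "cw u v w \<Longrightarrow> cw u w z \<Longrightarrow> {u, w} \<in> arcs D \<Longrightarrow> {u, v} \<in> arcs D \<Longrightarrow> {v, w} \<in> arcs D \<Longrightarrow>
      {w, z} \<in> arcs D \<Longrightarrow> {u, z} \<in> arcs D \<Longrightarrow> dir D u w \<longleftrightarrow> \<epsilon> {u, v, w} * \<epsilon> {u, w, z} = sg v z"
  using assms unfolding compatible_def by (auto simp: insert_commute)

text \<open>
  Only the two new triangles get new signs.  Around the quadrilateral the clause on orientations is
  checked for the new diagonal and for the four sides, once for each position of the new triangle; the
  reversal of the side \<open>{t, q}\<close> in the definition of a flip is exactly what the change of signs requires
  there.
\<close>

lemma compatible_flip:
  assumes comp: "compatible \<epsilon> D" and flip: "flip p t q s D D'"
  shows "\<exists>\<epsilon>'. compatible \<epsilon>' D' \<and> \<epsilon>' {p, t, s} = \<epsilon> {p, t, q} * sg q s"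
proof -
  have cw: "cw p t q" "cw p q s"
    and arcs: "{p, q} \<in> arcs D" "{p, t} \<in> arcs D" "{t, q} \<in> arcs D" "{q, s} \<in> arcs D" "{s, p} \<in> arcs D"
    and dpq: "dir D p q"
    using flip unfolding flip_def by auto
  note C = compatibleD[OF comp]
  interpret quad "arcs D" p t q s by unfold_locales (use C(2) cw arcs in auto)
  note f = cw_four[OF cw] and d = distinct distinct[THEN not_sym]
  have arcs': "{p, s} \<in> arcs D" "{q, t} \<in> arcs D" "{t, p} \<in> arcs D" "{s, q} \<in> arcs D" "{q, p} \<in> arcs D"
    using arcs by (simp_all add: insert_commute)
  have len: "len D {p, q} = lam V p q" "len D {p, t} = lam V p t" "len D {t, q} = lam V t q"
    "len D {q, s} = lam V q s" "len D {s, p} = lam V p s"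
    using C(3)[OF arcs(1)] C(3)[OF arcs(2)] C(3)[OF arcs(3)] C(3)[OF arcs(4)] C(3)[OF arcs(5)] d lam_sym[of p s]
    by simp_all
  have pos: "body (lam V p q) > 0" "body (lam V p t) > 0" "body (lam V t q) > 0" "body (lam V q s) > 0"
    "body (lam V p s) > 0"
    using C(4) arcs arcs' d by simp_all
  note ev = gsqrt_props(3)[OF pos(1)] gsqrt_props(3)[OF pos(4)] gsqrt_props(3)[OF pos(5)]
  define k where "k = \<epsilon> {p, t, q}"
  define k' where "k' = \<epsilon> {p, q, s}"
  have k: "k * k = 1" by (simp add: k_def C(1))
  have "k * k' = sg t s" using C(6)[OF cw] arcs arcs' dpq unfolding k_def k'_def by simp
  then have "k * (k * k') = k * sg t s" by simp
  then have k': "k' = k * sg t s" using k by (simp flip: mult.assoc)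
  have th: "mu D {p, t, q} * (rt p t * (rt t q * rt p q)) = k *\<^sub>R det p t q"
    using C(5)[OF cw(1)] arcs unfolding triangle_ok_def k_def by simp
  have "mu D {p, q, s} * (rt p q * (rt q s * rt p s)) = k' *\<^sub>R det p q s"
    using C(5)[OF cw(2)] arcs arcs' unfolding triangle_ok_def k'_def by simp
  then have si: "mu D {p, q, s} * (rt q s * (rt p s * rt p q)) = k' *\<^sub>R det p q s"
    using ev by (simp add: geven_commute geven_left_commute)
  note val = flip_values[OF cw pos th si k k']
  have D': "arcs D' = A'"
    "dir D' u v = (if {u, v} = {s, t} then u = s \<and> v = t else if {u, v} = {t, q} then dir D v u else dir D u v)"
    "len D' = (len D)({s, t} := lam V t s)"
    "mu D' {p, t, s} * (rt p t * (rt t s * rt p s)) = (k * sg p q * sg p s) *\<^sub>R det p t s"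
    "mu D' {q, t, s} * (rt t q * (rt q s * rt t s)) = (k * sg p q * sg q s) *\<^sub>R det t q s"
    "T \<noteq> {p, t, s} \<Longrightarrow> T \<noteq> {q, t, s} \<Longrightarrow> mu D' T = mu D T" for u v T
  proof -
    have ne: "{p, t, s} \<noteq> {q, t, s}" using d by auto
    from flip have eq: "D' = \<lparr>arcs = insert {s, t} (arcs D - {{p, q}}),
       dir = (\<lambda>u v. if {u, v} = {s, t} then u = s \<and> v = t
                            else if {u, v} = {t, q} then dir D v u else dir D u v),
       len = (len D)({s, t} := lam V t s),
       mu = (mu D)({p, t, s} := (mu D {p, t, q} * gsqrt (lam V t q * lam V p s) + mu D {p, q, s} * gsqrt (lam V p t * lam V q s))
              / gsqrt (lam V p q * lam V t s),
          {q, t, s} := (mu D {p, q, s} * gsqrt (lam V t q * lam V p s) - mu D {p, t, q} * gsqrt (lam V p t * lam V q s))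
              / gsqrt (lam V p q * lam V t s))\<rparr>"
      unfolding flip_def Let_def len val(1) by blast
    show "arcs D' = A'" unfolding eq A'_def by simp
    show "dir D' u v = (if {u, v} = {s, t} then u = s \<and> v = t else if {u, v} = {t, q} then dir D v u else dir D u v)"
      unfolding eq by simp
    show "len D' = (len D)({s, t} := lam V t s)" unfolding eq by simp
    show "mu D' {p, t, s} * (rt p t * (rt t s * rt p s)) = (k * sg p q * sg p s) *\<^sub>R det p t s"
      unfolding eq using val(2) ne by simp
    show "mu D' {q, t, s} * (rt t q * (rt q s * rt t s)) = (k * sg p q * sg q s) *\<^sub>R det t q s"
      unfolding eq using val(3) by simp
    show "T \<noteq> {p, t, s} \<Longrightarrow> T \<noteq> {q, t, s} \<Longrightarrow> mu D' T = mu D T" unfolding eq by simp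
  qed
  \<comment> \<open>These are the signs of the two new mu-invariants above, simplified with the cocycle rule for \<open>sg\<close>.\<close>
  define \<epsilon>' where "\<epsilon>' = \<epsilon>({p, t, s} := k * sg q s, {q, t, s} := k * sg p s)"
  have e1: "\<epsilon>' {p, t, s} = \<epsilon> {p, t, q} * sg q s" and e2: "\<epsilon>' {q, t, s} = \<epsilon> {p, t, q} * sg p s"
    using d by (auto simp: \<epsilon>'_def k_def)
  have "sg t s * sg q s = sg t q" "sg t s * sg p s = sg p t"
    using sg_cw[OF f(1)] sg_cw[OF f(2)] by (simp_all add: mult.commute)
  then have "k * sg q s = k' * sg t q" "k * sg p s = k' * sg p t"
    unfolding k' by (simp_all add: sg_def split: if_splits)
  then have e1': "\<epsilon>' {p, t, s} = \<epsilon> {p, q, s} * sg t q" and e2': "\<epsilon>' {q, t, s} = \<epsilon> {p, q, s} * sg p t"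
    using e1 e2 unfolding k_def k'_def by simp_all
  have e_old: "\<epsilon>' T = \<epsilon> T" if "\<not> {s, t} \<subseteq> T" for T
    using that by (auto simp: \<epsilon>'_def)
  have kk: "k * sg p q * sg p s = \<epsilon>' {p, t, s}" "k * sg p q * sg q s = \<epsilon>' {q, t, s}"
    using sg_cw[OF cw(2)] unfolding e1 e2 k_def by (simp_all add: mult.assoc)
  have pos_ts: "body (lam V t s) > 0" by (rule body_lam_new[OF cw pos])
  have ok1: "triangle_ok D' \<epsilon>' p t s" and ok2: "triangle_ok D' \<epsilon>' t q s"
    using D'(4,5) unfolding kk triangle_ok_def by (simp_all add: insert_commute)
  have ok1': "triangle_ok D' \<epsilon>' t s p" "triangle_ok D' \<epsilon>' s p t"
    and ok2': "triangle_ok D' \<epsilon>' q s t" "triangle_ok D' \<epsilon>' s t q"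
    using triangle_ok_rotate[OF ok1] triangle_ok_rotate[OF ok2]
      triangle_ok_rotate[of D' \<epsilon>' t s p] triangle_ok_rotate[of D' \<epsilon>' q s t]
      d pos pos_ts lam_sym[OF d(1)] lam_sym[OF d(2)] lam_sym[OF d(3)] lam_sym[OF d(4)] lam_sym[OF d(5)] lam_sym[OF d(6)]
    by simp_all
  \<comment> \<open>The arc \<open>{u, w}\<close> is the new diagonal, or at most one of the two triangles next to it is new.  If one
      is, the arc is a side of the quadrilateral, and the old triangle on its inner side had the apex \<open>p\<close> or \<open>q\<close>.\<close>
  have rule: "dir D' u w \<longleftrightarrow> \<epsilon>' {u, v, w} * \<epsilon>' {u, w, z} = sg v z"
    if c: "cw u v w" "cw u w z"
      and a: "{u, w} \<in> A'" "{u, v} \<in> A'" "{v, w} \<in> A'" "{w, z} \<in> A'" "{u, z} \<in> A'" for u v w z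
  proof -
    note dd = cw_distinct[OF c(1)] cw_distinct[OF c(2)]
    have vz: "v \<noteq> z" using c cw_asym by blast
    have c': "cw w z u" "cw w u v" using c cw_rotate by blast+
    consider "u = s" "w = t" | "u = t" "w = s" | "{u, w} \<noteq> {s, t}" by (auto simp: doubleton_eq_iff)
    then show ?thesis
    proof cases
      case 1
      have "v = p \<or> v = q" "z = p \<or> z = q"
        using apex_new[of v] apex_new[of z] a dd 1 unfolding A'_def by (auto simp: doubleton_eq_iff insert_commute)
      moreover have "\<not> cw s q t" "\<not> cw s t p" using f cw_asym by blast+
      ultimately have "v = p" "z = q" using c 1 by auto
      then show ?thesis using 1 e1 e2 k sg_cw(3)[OF cw(2)]
        by (simp add: D' insert_commute k_def mult.assoc) (simp add: mult_ac)
    next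
      case 2
      have "v = p \<or> v = q" "z = p \<or> z = q"
        using apex_new[of v] apex_new[of z] a dd 2 unfolding A'_def by (auto simp: doubleton_eq_iff insert_commute)
      moreover have "\<not> cw t p s" "\<not> cw t s q" using f cw_asym cw_rotate by blast+
      ultimately have vz: "v = q" "z = p" using c 2 by auto
      have "\<epsilon>' {t, q, s} * \<epsilon>' {t, s, p} = sg p q"
        using e1 e2 k sg_cw(3)[OF cw(2)]
        by (simp add: D' insert_commute k_def mult.assoc) (simp add: mult_ac)
      then show ?thesis using 2 vz d by (simp add: D' insert_commute sg_def)
    next
      case 3
      then have uw: "{u, w} \<in> arcs D" "{w, u} \<in> arcs D"
        using a(1) unfolding A'_def by (auto simp: insert_commute)
      note a' = a(2-5)
      have left: ?thesis if new: "{u, v, w} = {p, t, s} \<or> {u, v, w} = {q, t, s}"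
      proof -
        have old: "\<not> ({u, w, z} = {p, t, s} \<or> {u, w, z} = {q, t, s})"
        proof
          assume "{u, w, z} = {p, t, s} \<or> {u, w, z} = {q, t, s}"
          then have "{s, t} \<subseteq> {u, w, z}" by auto
          moreover have "{s, t} \<subseteq> {u, v, w}" using new by auto
          ultimately have "{s, t} \<subseteq> {u, w}" using vz dd by auto
          then have "{u, w} = {s, t}" using d(5) by auto
          then show False using 3 by simp
        qed
        have "{w, z} \<in> arcs D \<and> {u, z} \<in> arcs D \<and> \<not> {s, t} \<subseteq> {u, w, z}"
          by (rule triangle_cases[OF c(2) a(1) a(4) a(5)]) (use old in simp_all)
        then have z: "{w, z} \<in> arcs D" "{u, z} \<in> arcs D" "\<not> {s, t} \<subseteq> {u, w, z}"
          by simp_all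
        have z': "{z, w} \<in> arcs D" "{z, u} \<in> arcs D" using z by (simp_all add: insert_commute)
        note ez = e_old[OF z(3)]
        have nst: "\<not> (u = s \<and> w = t)" "\<not> (u = t \<and> w = s)" using 3 by auto
        have "{q, t, s} = {t, q, s}" by auto
        with new have "{u, v, w} = {p, t, s} \<or> {u, v, w} = {t, q, s}" by simp
        then consider "u = p" "v = t" "w = s" | "u = t" "v = s" "w = p"
          | "u = q" "v = s" "w = t" | "u = s" "v = t" "w = q"
        proof (elim disjE)
          assume "{u, v, w} = {p, t, s}"
          from cw_same_triple[OF c(1) f(1) this] nst that show thesis by blast
        next
          assume "{u, v, w} = {t, q, s}"
          from cw_same_triple[OF c(1) f(2) this] nst that show thesis by blast
        qed
        then show ?thesis
        proof cases
          case 1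
          have "sg q z * sg t z = sg t q" using sg_cw(3)[OF cw_five[OF cw(1) cw(2)]] c(2) 1 by blast
          note sg_transfer(2)[OF this, of "\<epsilon> {p, q, s}" "\<epsilon> {p, s, z}"]
          with C(6)[of p q s z] cw c(2) arcs arcs' z uw 1 ez e1' d show ?thesis
            by (simp add: D' doubleton_eq_iff)
        next
          case 2
          have "cw q s z" using cw_five[of t q s p z] f c(2) 2 by blast
          then have "sg q z * sg s z = sg q s" using sg_cw by (simp add: mult.commute)
          note sg_transfer(2)[OF this, of "\<epsilon> {t, q, p}" "\<epsilon> {t, p, z}"]
          with C(6)[of t q p z] f c(2) arcs arcs' z uw 2 ez e1 d show ?thesis
            by (simp add: D' doubleton_eq_iff insert_commute)
        next
          case 3
          have "cw s p z" using cw_five[of q s p t z] f c(2) 3 by blast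
          then have "sg z p * sg s z = sg p s"
            using sg_cw(2)[of s p z] cw_distinct[of s p z] sg_flip[of p z] sg_flip[of s p]
            by (auto simp: sg_def split: if_splits)
          note sg_transfer(2)[OF this, of "\<epsilon> {p, t, q}" "\<epsilon> {t, z, q}"]
          moreover have "dir D t q \<longleftrightarrow> \<epsilon> {t, z, q} * \<epsilon> {t, q, p} = sg z p"
            using C(6)[of t z q p] f c'(1) arcs arcs' z z' uw 3 by simp
          ultimately show ?thesis using 3 ez e2 d
            by (simp add: D' doubleton_eq_iff insert_commute mult.commute)
        next
          case 4
          have "cw p t z" using cw_five[of s p t q z] f c(2) 4 by blast
          then have "sg p z * sg t z = sg p t" using sg_cw by (simp add: mult.commute)
          note sg_transfer(2)[OF this, of "\<epsilon> {s, p, q}" "\<epsilon> {s, q, z}"]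
          with C(6)[of s p q z] f c(2) arcs arcs' z uw 4 ez e2' d show ?thesis
            by (simp add: D' doubleton_eq_iff insert_commute)
        qed
      qed
      have right: ?thesis if new: "{u, w, z} = {p, t, s} \<or> {u, w, z} = {q, t, s}"
      proof -
        have old: "\<not> ({u, v, w} = {p, t, s} \<or> {u, v, w} = {q, t, s})"
        proof
          assume "{u, v, w} = {p, t, s} \<or> {u, v, w} = {q, t, s}"
          then have "{s, t} \<subseteq> {u, v, w}" by auto
          moreover have "{s, t} \<subseteq> {u, w, z}" using new by auto
          ultimately have "{s, t} \<subseteq> {u, w}" using vz dd by auto
          then have "{u, w} = {s, t}" using d(5) by auto
          then show False using 3 by simp
        qed
        have "{u, v} \<in> arcs D \<and> {v, w} \<in> arcs D \<and> \<not> {s, t} \<subseteq> {u, v, w}"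
          by (rule triangle_cases[OF c(1) a(2) a(3) a(1)]) (use old in simp_all)
        then have v: "{u, v} \<in> arcs D" "{v, w} \<in> arcs D" "\<not> {s, t} \<subseteq> {u, v, w}"
          by simp_all
        have v': "{v, u} \<in> arcs D" "{w, v} \<in> arcs D" using v by (simp_all add: insert_commute)
        note ez = e_old[OF v(3)]
        have nst: "\<not> (u = s \<and> w = t)" "\<not> (u = t \<and> w = s)" using 3 by auto
        have "{q, t, s} = {t, q, s}" by auto
        with new have "{u, w, z} = {p, t, s} \<or> {u, w, z} = {t, q, s}" by simp
        then consider "u = p" "w = t" "z = s" | "u = s" "w = p" "z = t"
          | "u = t" "w = q" "z = s" | "u = q" "w = s" "z = t"
        proof (elim disjE)
          assume "{u, w, z} = {p, t, s}"
          from cw_same_triple[OF c(2) f(1) this] nst that show thesis by blast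
        next
          assume "{u, w, z} = {t, q, s}"
          from cw_same_triple[OF c(2) f(2) this] nst that show thesis by blast
        qed
        then show ?thesis
        proof cases
          case 1
          have "cw q s v" using cw_five[of t q s p v] f c'(2) 1 by blast
          then have "sg v q * sg v s = sg q s"
            using sg_cw(3)[of q s v] sg_flip[of q v] sg_flip[of s v] cw_distinct[of q s v] by (auto simp: sg_def cw_def split: if_splits)
          note sg_transfer(1)[OF this, of "\<epsilon> {p, v, t}" "\<epsilon> {p, t, q}"]
          with C(6)[of p v t q] f cw c(1) arcs arcs' v uw 1 ez e1 d show ?thesis
            by (simp add: D' doubleton_eq_iff)
        next
          case 2
          have "cw t q v" using cw_five[of p t q s v] cw c'(2) 2 by blast
          then have "sg v q * sg v t = sg t q"
            by (auto simp: sg_def cw_def split: if_splits)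
          note sg_transfer(1)[OF this, of "\<epsilon> {s, v, p}" "\<epsilon> {s, p, q}"]
          with C(6)[of s v p q] f c(1) arcs arcs' v uw 2 ez e1' d show ?thesis
            by (simp add: D' doubleton_eq_iff insert_commute)
        next
          case 3
          have "cw s p v" using cw_five[of q s p t v] f c'(2) 3 by blast
          then have "sg p v * sg v s = sg p s"
            by (auto simp: sg_def cw_def split: if_splits)
          note sg_transfer(1)[OF this, of "\<epsilon> {t, v, q}" "\<epsilon> {p, t, q}"]
          moreover have "dir D q t \<longleftrightarrow> \<epsilon> {q, p, t} * \<epsilon> {q, t, v} = sg p v"
            using C(6)[of q p t v] f c'(2) arcs arcs' v v' uw 3 by simp
          ultimately show ?thesis using 3 ez e2 d
            by (simp add: D' doubleton_eq_iff insert_commute mult.commute)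
        next
          case 4
          have "cw p t v" using cw_five[of s p t q v] f c'(2) 4 by blast
          then have "sg v p * sg v t = sg p t"
            by (auto simp: sg_def cw_def split: if_splits)
          note sg_transfer(1)[OF this, of "\<epsilon> {q, v, s}" "\<epsilon> {q, s, p}"]
          with C(6)[of q v s p] f c(1) arcs arcs' v uw 4 ez e2' d show ?thesis
            by (simp add: D' doubleton_eq_iff insert_commute)
        qed
      qed
      show ?thesis
      proof (rule triangle_cases[OF c(1) a(2) a(3) a(1)])
        assume v: "{u, v} \<in> arcs D" "{v, w} \<in> arcs D" "\<not> {s, t} \<subseteq> {u, v, w}"
        show ?thesis
        proof (rule triangle_cases[OF c(2) a(1) a(4) a(5)])
          assume z: "{w, z} \<in> arcs D" "{u, z} \<in> arcs D" "\<not> {s, t} \<subseteq> {u, w, z}"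
          have "{u, w} \<noteq> {t, q}"
          proof
            assume "{u, w} = {t, q}"
            then consider "u = t" "w = q" | "u = q" "w = t" by (auto simp: doubleton_eq_iff)
            then show False
            proof cases
              case 1
              then have "z = s"
                using noncrossing_apex_unique[OF noncrossing_new, of q z t s] a f c'(1) arcs d
                unfolding A'_def by (auto simp: insert_commute doubleton_eq_iff)
              then show False using 1 z(3) by auto
            next
              case 2
              then have "v = s"
                using noncrossing_apex_unique[OF noncrossing_new, of q v t s] a f c(1) arcs d
                unfolding A'_def by (auto simp: insert_commute doubleton_eq_iff)
              then show False using 2 v(3) by auto
            qed
          qed
          then show ?thesis using C(6)[OF c uw(1) v(1,2) z(1,2)] 3 e_old[OF v(3)] e_old[OF z(3)]
            by (simp add: D')
        qed (rule right)
      qed (rule left)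
    qed
  qed
  have "compatible \<epsilon>' D'"
    unfolding compatible_def
  proof (intro conjI allI impI)
    show "\<epsilon>' T * \<epsilon>' T = 1" for T
      using C(1)[of T] k by (simp add: \<epsilon>'_def mult_ac)
    show "noncrossing (arcs D')" unfolding D' by (rule noncrossing_new)
  next
    fix u v assume uv: "{u, v} \<in> arcs D' \<and> u \<noteq> v"
    then have "len D' {u, v} = lam V u v \<and> body (lam V u v) > 0"
    proof (cases "{u, v} = {s, t}")
      case True
      then show ?thesis using pos_ts d uv lam_sym[of s t] by (auto simp: D' doubleton_eq_iff)
    next
      case False
      with uv show ?thesis using C(3,4) by (auto simp: D' A'_def)
    qed
    then show "len D' {u, v} = lam V u v" "body (lam V u v) > 0" by auto
  next
    fix u v w assume "cw u v w \<and> {u, v} \<in> arcs D' \<and> {v, w} \<in> arcs D' \<and> {u, w} \<in> arcs D'"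
    then have c: "cw u v w" and a: "{u, v} \<in> A'" "{v, w} \<in> A'" "{u, w} \<in> A'" by (auto simp: D')
    show "triangle_ok D' \<epsilon>' u v w"
    proof (rule triangle_cases[OF c a])
      assume "{u, v, w} = {p, t, s} \<or> {u, v, w} = {q, t, s}"
      moreover have "{q, t, s} = {t, q, s}" by auto
      ultimately have "{u, v, w} = {p, t, s} \<or> {u, v, w} = {t, q, s}" by simp
      then show ?thesis
      proof
        assume "{u, v, w} = {p, t, s}"
        from cw_same_triple[OF c f(1) this] ok1 ok1' show ?thesis by blast
      next
        assume "{u, v, w} = {t, q, s}"
        from cw_same_triple[OF c f(2) this] ok2 ok2' show ?thesis by blast
      qed
    next
      assume old: "{u, v} \<in> arcs D" "{v, w} \<in> arcs D" "{u, w} \<in> arcs D" "\<not> {s, t} \<subseteq> {u, v, w}"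
      then have "{u, v, w} \<noteq> {p, t, s}" "{u, v, w} \<noteq> {q, t, s}" by blast+
      then have "mu D' {u, v, w} = mu D {u, v, w}" "\<epsilon>' {u, v, w} = \<epsilon> {u, v, w}"
        using e_old[OF old(4)] D'(6) by simp_all
      then show ?thesis using C(5)[OF c old(1-3)] by (simp add: triangle_ok_def)
    qed
  next
    fix u v w z
    assume "cw u v w \<and> cw u w z \<and> {{u, w}, {u, v}, {v, w}, {w, z}, {z, u}} \<subseteq> arcs D'"
    then show "dir D' u w \<longleftrightarrow> \<epsilon>' {u, v, w} * \<epsilon>' {u, w, z} = sg v z"
      by (intro rule) (auto simp: D' insert_commute)
  qed
  with e1 show ?thesis by blast
qed

end

context super_vectors
begin

text \<open>
  Changing the sign of a triangle changes the relative sign across each of its sides, as does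
  reversing these sides.
\<close>

lemma compatible_reverse:
  assumes comp: "compatible \<epsilon> D" and tri: "is_triangle D t"
  shows "compatible (\<epsilon>(t := - \<epsilon> t)) (reverse_triangles {t} D)"
proof -
  define \<epsilon>' where "\<epsilon>' = \<epsilon>(t := - \<epsilon> t)"
  note C = compatibleD[OF comp]
  define D' where "D' = reverse_triangles {t} D"
  have "card {t' \<in> {t}. {u, v} \<subseteq> t'} = (if {u, v} \<subseteq> t then 1 else 0)" for u v
  proof -
    have "{t' \<in> {t}. {u, v} \<subseteq> t'} = (if {u, v} \<subseteq> t then {t} else {})" by auto
    then show ?thesis by simp
  qed
  then have D': "arcs D' = arcs D" "len D' = len D"
    "dir D' u v = (if {u, v} \<subseteq> t then dir D v u else dir D u v)"
    "mu D' s = (if s = t then - mu D s else mu D s)" for u v s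
    by (simp_all add: D'_def reverse_triangles_def)
  have "compatible \<epsilon>' D'"
    unfolding compatible_def
  proof (intro conjI allI impI)
    show "\<epsilon>' s * \<epsilon>' s = 1" for s using C(1) by (simp add: \<epsilon>'_def)
    show "noncrossing (arcs D')" using C(2) by (simp add: D')
    show "len D' {p, q} = lam V p q" "body (lam V p q) > 0" if "{p, q} \<in> arcs D' \<and> p \<noteq> q" for p q
      using C(3,4) that by (simp_all add: D')
    show "triangle_ok D' \<epsilon>' p q r"
      if "cw p q r \<and> {p, q} \<in> arcs D' \<and> {q, r} \<in> arcs D' \<and> {p, r} \<in> arcs D'" for p q r
      using C(5)[of p q r] that by (auto simp: D' triangle_ok_def \<epsilon>'_def)
  next
    fix u v w z
    assume "cw u v w \<and> cw u w z \<and> {{u, w}, {u, v}, {v, w}, {w, z}, {z, u}} \<subseteq> arcs D'"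
    then have c: "cw u v w" "cw u w z" and a: "{u, w} \<in> arcs D" "{u, v} \<in> arcs D" "{v, w} \<in> arcs D"
      "{w, z} \<in> arcs D" "{u, z} \<in> arcs D" by (auto simp: D' insert_commute)
    then have a': "{w, u} \<in> arcs D" "{v, u} \<in> arcs D" "{w, v} \<in> arcs D" "{z, w} \<in> arcs D" "{z, u} \<in> arcs D"
      by (simp_all add: insert_commute)
    have c': "cw w z u" "cw w u v" using c cw_rotate by blast+
    have dd: "u \<noteq> v" "v \<noteq> w" "u \<noteq> w" "w \<noteq> z" "u \<noteq> z" "v \<noteq> z"
      using cw_distinct[OF c(1)] cw_distinct[OF c(2)] cw_asym[OF c(1)] c by auto
    have ne: "{u, v, w} \<noteq> {u, w, z}" using dd by auto
    have old: "dir D u w \<longleftrightarrow> \<epsilon> {u, v, w} * \<epsilon> {u, w, z} = sg v z"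
      "dir D w u \<longleftrightarrow> \<epsilon> {u, w, z} * \<epsilon> {u, v, w} = sg z v"
      using C(6)[OF c a] C(6)[OF c' a'(1) a(4) a'(5) a(2) a'(3)] by (simp_all add: insert_commute)
    show "dir D' u w \<longleftrightarrow> \<epsilon>' {u, v, w} * \<epsilon>' {u, w, z} = sg v z"
    proof (cases "{u, w} \<subseteq> t")
      case False
      then have "{u, v, w} \<noteq> t" "{u, w, z} \<noteq> t" by auto
      then have "\<epsilon>' {u, v, w} = \<epsilon> {u, v, w}" "\<epsilon>' {u, w, z} = \<epsilon> {u, w, z}" by (simp_all add: \<epsilon>'_def)
      then show ?thesis using old(1) unfolding D'(3) if_not_P[OF False] by simp
    next
      case True
      have "card (t - {u, w}) = 1"
        using tri True dd(3) unfolding is_triangle_def by (subst card_Diff_subset) auto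
      then obtain y where y: "t - {u, w} = {y}" by (auto simp: card_1_singleton_iff)
      then have t: "t = {u, w, y}" "y \<noteq> u" "y \<noteq> w" using True by auto
      have ya: "{u, y} \<in> arcs D" "{y, w} \<in> arcs D" "{w, y} \<in> arcs D" "{y, u} \<in> arcs D"
        using tri t unfolding is_triangle_def by auto
      have "y = v \<or> y = z"
        using cw_sides[OF dd(3) t(2,3)]
      proof
        assume "cw u y w"
        then show ?thesis using noncrossing_apex_unique[OF C(2) c(1)] a ya by blast
      next
        assume "cw w y u"
        then show ?thesis using noncrossing_apex_unique[OF C(2) c'(1)] a a' ya by blast
      qed
      then have "t = {u, v, w} \<or> t = {u, w, z}" using t(1) by auto
      then have "\<epsilon>' {u, v, w} * \<epsilon>' {u, w, z} = - (\<epsilon> {u, w, z} * \<epsilon> {u, v, w})"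
        using ne by (auto simp: \<epsilon>'_def)
      then show ?thesis using True old(2) sg_flip[OF dd(6)] by (auto simp: D')
    qed
  qed
  then show ?thesis by (simp add: \<epsilon>'_def D'_def)
qed

lemma compatible_moves:
  assumes "move\<^sup>*\<^sup>* D E" "compatible \<epsilon> D"
  shows "\<exists>\<epsilon>'. compatible \<epsilon>' E"
  using assms(1)
proof induction
  case base
  then show ?case using assms(2) by blast
next
  case (step E E')
  then obtain \<epsilon>' where "compatible \<epsilon>' E" by blast
  with step(2) show ?case
    unfolding move_def using compatible_flip compatible_reverse by blast
qed

end

context super_vectors
begin

lemma lam_less: "p < q \<Longrightarrow> lam V p q = bracket (V p) (V q)"
  by (simp add: lam_def sg_def)

text \<open>
  On an interior arc the clause on orientations leaves exactly one direction, so that one of the two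
  drawings of the quadrilateral admits a flip.
\<close>

lemma compatible_dir_antisym:
  assumes comp: "compatible \<epsilon> E" and cw: "cw p t q" "cw p q s"
    and arcs: "{p, q} \<in> arcs E" "{p, t} \<in> arcs E" "{t, q} \<in> arcs E" "{q, s} \<in> arcs E" "{p, s} \<in> arcs E"
  shows "dir E q p \<longleftrightarrow> \<not> dir E p q"
proof -
  note C = compatibleD[OF comp]
  have cw': "cw q s p" "cw q p t" using cw cw_rotate by blast+
  have arcs': "{q, p} \<in> arcs E" "{s, p} \<in> arcs E" "{q, t} \<in> arcs E" using arcs by (simp_all add: insert_commute)
  have "t \<noteq> s" using cw cw_asym by blast
  have 1: "dir E p q \<longleftrightarrow> \<epsilon> {p, t, q} * \<epsilon> {p, q, s} = sg t s"
    using C(6)[OF cw arcs] .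
  have 2: "dir E q p \<longleftrightarrow> \<epsilon> {p, t, q} * \<epsilon> {p, q, s} = - sg t s"
    using C(6)[OF cw' arcs'(1) arcs(4) arcs'(2) arcs(2) arcs'(3)] sg_flip[OF \<open>t \<noteq> s\<close>]
    by (simp add: insert_commute mult.commute)
  have "\<epsilon> {p, t, q} = 1 \<or> \<epsilon> {p, t, q} = - 1" "\<epsilon> {p, q, s} = 1 \<or> \<epsilon> {p, q, s} = - 1"
    using C(1) by (auto simp: square_eq_1_iff)
  then show ?thesis unfolding 1 2 by (auto simp: sg_def)
qed

lemma flip_exists:
  assumes "cw p t q" "cw p q s" "{{p, q}, {p, t}, {t, q}, {q, s}, {s, p}} \<subseteq> arcs E" "dir E p q"
  obtains E' where "flip p t q s E E'" "arcs E' = insert {s, t} (arcs E - {{p, q}})"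
proof -
  obtain E' where E': "flip p t q s E E'"
    using assms unfolding flip_def Let_def by blast
  then have "\<exists>dr ln m. E' = \<lparr>arcs = insert {s, t} (arcs E - {{p, q}}), dir = dr, len = ln, mu = m\<rparr>"
    unfolding flip_def Let_def by blast
  then have "arcs E' = insert {s, t} (arcs E - {{p, q}})" by auto
  with E' show thesis by (rule that)
qed

lemma flip_possible:
  assumes comp: "compatible \<epsilon> E" and cw: "cw p t q" "cw p q s"
    and arcs: "{p, q} \<in> arcs E" "{p, t} \<in> arcs E" "{t, q} \<in> arcs E" "{q, s} \<in> arcs E" "{p, s} \<in> arcs E"
  obtains E' where "move E E'" "arcs E' = insert {s, t} (arcs E - {{p, q}})"
proof (cases "dir E p q")
  case True
  have "{{p, q}, {p, t}, {t, q}, {q, s}, {s, p}} \<subseteq> arcs E" using arcs by (simp add: insert_commute)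
  then obtain E' where E': "flip p t q s E E'" "arcs E' = insert {s, t} (arcs E - {{p, q}})"
    using flip_exists[OF cw _ True] by blast
  then have "move E E'" unfolding move_def by blast
  then show ?thesis using E'(2) by (rule that)
next
  case False
  then have d: "dir E q p" using compatible_dir_antisym[OF comp cw arcs] by simp
  have cw': "cw q s p" "cw q p t" using cw cw_rotate by blast+
  have "{{q, p}, {q, s}, {s, p}, {p, t}, {t, q}} \<subseteq> arcs E" using arcs by (simp add: insert_commute)
  from flip_exists[OF cw' this d] obtain E' where "flip q s p t E E'" "arcs E' = insert {t, s} (arcs E - {{q, p}})"
    by blast
  moreover from this(1) have "move E E'" unfolding move_def by blast
  ultimately show ?thesis using that[of E'] by (simp add: insert_commute)
qed

end

section \<open>The chain of crossed diagonals\<close>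

locale crossed_triangulation =
  fixes n k j l :: nat
    and T :: "nat set set"
    and x :: "nat \<Rightarrow> nat set"
    and w :: "nat set \<Rightarrow> real"
    and D :: decorated
  assumes n2: "n \<ge> 2"
    and triangulation: "triangulation (n + 2) T"
    and k_less: "k < n + 2" and crosses: "\<forall>d\<in>T. crosses {0, k} d"
    and x_bij: "bij_betw x {1..n - 1} T"
    and x_ordered: "\<forall>m m'. 1 \<le> m \<and> m < m' \<and> m' \<le> n - 1 \<longrightarrow> crossed_before (x m) (x m')"
    and last_diagonal: "x (n - 1) = {j, l}" and last_center: "fan_center n j x n = j" and j_left: "j < k"
    and w_pos: "\<forall>d \<in> T \<union> boundary (n + 2). w d > 0"
    and D_default: "default_decorated n k j x T w D"
begin

definition lft :: "nat \<Rightarrow> nat" where "lft m = Min (x m)"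
definition rgt :: "nat \<Rightarrow> nat" where "rgt m = Max (x m)"

lemma diagonal:
  assumes "1 \<le> m" "m \<le> n - 1"
  shows "x m = {lft m, rgt m}" "0 < lft m" "lft m < k" "k < rgt m" "rgt m < n + 2"
proof -
  have T: "x m \<in> T" using x_bij assms by (auto simp: bij_betw_def)
  then obtain a b r s where c: "{0, k} = {a, b}" "x m = {r, s}" "cw a r b" "cw b s a"
    using crosses unfolding crosses_def by metis
  have "x m \<in> diagonals (n + 2)" using T triangulation unfolding triangulation_def by blast
  then have "x m \<subseteq> {..<n + 2}" unfolding diagonals_def by auto
  with c have N: "r < n + 2" "s < n + 2" by auto
  have "\<exists>r s. x m = {r, s} \<and> 0 < r \<and> r < k \<and> k < s \<and> s < n + 2"
  proof (cases "a = 0")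
    case True
    then have "b = k" using c(1) by (auto simp: doubleton_eq_iff)
    then have "0 < r" "r < k" "k < s" using True c(3,4) unfolding cw_def by simp_all
    with N c(2) show ?thesis by blast
  next
    case False
    then have "a = k" "b = 0" using c(1) by (auto simp: doubleton_eq_iff)
    then have "0 < s" "s < k" "k < r" using False c(3,4) unfolding cw_def by simp_all
    with N c(2) show ?thesis by (metis insert_commute)
  qed
  then obtain r s where rs: "x m = {r, s}" "0 < r" "r < k" "k < s" "s < n + 2" by blast
  then have "lft m = r" "rgt m = s" unfolding lft_def rgt_def by simp_all
  with rs show "x m = {lft m, rgt m}" "0 < lft m" "lft m < k" "k < rgt m" "rgt m < n + 2" by simp_all
qed

lemma diagonal_strict:
  assumes "1 \<le> m" "m < m'" "m' \<le> n - 1"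
  shows "lft m \<le> lft m'" "rgt m' \<le> rgt m" "lft m + rgt m' < lft m' + rgt m"
proof -
  show le: "lft m \<le> lft m'" "rgt m' \<le> rgt m"
    using x_ordered assms unfolding crossed_before_def lft_def rgt_def by blast+
  have "x m \<noteq> x m'" using inj_onD[of x "{1..n - 1}" m m'] x_bij assms unfolding bij_betw_def by auto
  then have "lft m \<noteq> lft m' \<or> rgt m \<noteq> rgt m'" using diagonal(1) assms by auto
  with le show "lft m + rgt m' < lft m' + rgt m" by linarith
qed

text \<open>
  The number of vertices below the diagonal grows strictly along the chain of \<open>n - 1\<close> diagonals and
  takes values in a range of \<open>n - 1\<close> integers, so it grows by one each time.
\<close>

lemma diagonal_index:
  assumes "1 \<le> m" "m \<le> n - 1"
  shows "lft m + (n + 2) = rgt m + m + 1"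
proof -
  have up: "lft 1 + rgt m + (m - 1) \<le> lft m + rgt 1" if "1 \<le> m" "m \<le> n - 1" for m
    using that
  proof (induction m rule: dec_induct)
    case (step m)
    then have "lft 1 + rgt m + (m - 1) \<le> lft m + rgt 1" by simp
    moreover have "lft m + rgt (Suc m) < lft (Suc m) + rgt m"
      using diagonal_strict(3)[of m "Suc m"] step by simp
    ultimately show ?case using step(1) by linarith
  qed simp
  have down: "lft m + rgt (n - 1) + (n - 1 - m) \<le> lft (n - 1) + rgt m" if "1 \<le> m" "m \<le> n - 1" for m
    using that(2,1)
  proof (induction m rule: inc_induct)
    case (step m)
    then have "lft (Suc m) + rgt (n - 1) + (n - 1 - Suc m) \<le> lft (n - 1) + rgt (Suc m)" by simp
    moreover have "lft m + rgt (Suc m) < lft (Suc m) + rgt m"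
      using diagonal_strict(3)[of m "Suc m"] step by simp
    ultimately show ?case using step(2) by linarith
  qed simp
  have "1 \<le> n - 1" using n2 by simp
  then have "0 < lft 1" "rgt 1 < n + 2" "lft (n - 1) < k" "k < rgt (n - 1)"
    using diagonal[of 1] diagonal[of "n - 1"] by auto
  then show ?thesis using up[OF assms] down[OF assms] assms by linarith
qed

lemma diagonal_first: "lft 1 = 1" "rgt 1 = n + 1"
proof -
  have "1 \<le> n - 1" using n2 by simp
  note d = diagonal[OF order_refl this] diagonal_index[OF order_refl this]
  show "lft 1 = 1" "rgt 1 = n + 1" using d(2,5,6) by linarith+
qed

lemma diagonal_last: "lft (n - 1) = k - 1" "rgt (n - 1) = k + 1" "j = k - 1" "l = k + 1"
proof -
  have n1: "1 \<le> n - 1" using n2 by simp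
  note d = diagonal[OF n1 order_refl] diagonal_index[OF n1 order_refl]
  show 1: "lft (n - 1) = k - 1" "rgt (n - 1) = k + 1" using d(2-6) n1 by linarith+
  have "j \<in> {k - 1, k + 1}" "{j, l} = {k - 1, k + 1}"
    using d(1) last_diagonal unfolding 1 by auto
  then show "j = k - 1" "l = k + 1"
    using j_left by (auto simp: doubleton_eq_iff)
qed

lemma diagonal_step:
  assumes "1 \<le> m" "Suc m \<le> n - 1"
  shows "lft (Suc m) = lft m \<and> Suc (rgt (Suc m)) = rgt m
       \<or> lft (Suc m) = Suc (lft m) \<and> rgt (Suc m) = rgt m"
  using diagonal_index[of m] diagonal_index[of "Suc m"] diagonal_strict[of m "Suc m"] assms
  by simp linarith

lemma k_bounds: "1 < k" "k \<le> n"
proof -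
  have n1: "1 \<le> n - 1" using n2 by simp
  show "1 < k" using diagonal(3)[OF order_refl n1] diagonal_first by simp
  show "k \<le> n" using diagonal(4)[OF order_refl n1] diagonal_first by simp
qed

text \<open>
  The apexes of \<open>\<Delta>\<^bsub>m+1\<^esub>\<close> and \<open>\<Delta>\<^sub>m\<close> over the side \<open>x m\<close>.
\<close>

definition above :: "nat \<Rightarrow> nat" where
  "above m = (if m = n - 1 then k else if lft (Suc m) = lft m then rgt (Suc m) else lft (Suc m))"

definition below :: "nat \<Rightarrow> nat" where
  "below m = (if m = 1 then 0 else if lft (m - 1) = lft m then rgt (m - 1) else lft (m - 1))"

lemma above_cases:
  assumes "1 \<le> m" "m \<le> n - 1"
  obtains (last) "m = n - 1" "above m = k" "lft m = k - 1" "rgt m = k + 1"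
  | (left) "m < n - 1" "lft (Suc m) = lft m" "rgt (Suc m) = above m" "rgt m = Suc (above m)"
  | (right) "m < n - 1" "lft (Suc m) = above m" "rgt (Suc m) = rgt m" "above m = Suc (lft m)"
proof (cases "m = n - 1")
  case True
  then show ?thesis using last diagonal_last by (simp add: above_def)
next
  case False
  then have "m < n - 1" using assms by simp
  then show ?thesis
    using diagonal_step[of m] assms left right by (fastforce simp: above_def)
qed

lemma below_cases:
  assumes "1 \<le> m" "m \<le> n - 1"
  obtains (first) "m = 1" "below m = 0" "lft m = 1" "rgt m = n + 1"
  | (left) i where "m = Suc i" "1 \<le> i" "lft i = lft m" "below m = rgt i" "rgt i = Suc (rgt m)"
  | (right) i where "m = Suc i" "1 \<le> i" "rgt i = rgt m" "below m = lft i" "lft m = Suc (lft i)"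
proof (cases "m = 1")
  case True
  then show ?thesis using first diagonal_first by (simp add: below_def)
next
  case False
  then obtain i where i: "m = Suc i" "1 \<le> i" using assms by (cases m) auto
  then show ?thesis
    using diagonal_step[of i] assms left right by (fastforce simp: below_def)
qed

lemma above_between:
  assumes "1 \<le> m" "m \<le> n - 1"
  shows "lft m < above m" "above m < rgt m"
proof -
  note d = diagonal(2-5)[OF assms]
  have "lft m < above m \<and> above m < rgt m"
  proof (cases rule: above_cases[OF assms])
    case 1 then show ?thesis using d by simp
  next
    case 2 then show ?thesis using d diagonal(4)[of "Suc m"] by simp
  next
    case 3 then show ?thesis using d diagonal(3)[of "Suc m"] by simp
  qed
  then show "lft m < above m" "above m < rgt m" by simp_all
qed

lemma below_outside:
  assumes "1 \<le> m" "m \<le> n - 1"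
  shows "below m < lft m \<or> rgt m < below m \<and> below m < n + 2"
proof (cases rule: below_cases[OF assms])
  case (2 i) then show ?thesis using diagonal(5)[of i] assms by simp
qed auto

lemma tri_above:
  assumes "1 \<le> m" "m \<le> n - 1"
  shows "tri n k x (Suc m) = {lft m, above m, rgt m}"
proof (cases rule: above_cases[OF assms])
  case 1 then show ?thesis using diagonal(1)[OF assms] assms n2 by (auto simp: tri_def)
next
  case 2
  then have "tri n k x (Suc m) = x m \<union> x (Suc m)" using assms by (auto simp: tri_def)
  then show ?thesis using diagonal(1)[OF assms] diagonal(1)[of "Suc m"] 2 by auto
next
  case 3
  then have "tri n k x (Suc m) = x m \<union> x (Suc m)" using assms by (auto simp: tri_def)
  then show ?thesis using diagonal(1)[OF assms] diagonal(1)[of "Suc m"] 3 by auto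
qed

lemma tri_below:
  assumes "1 \<le> m" "m \<le> n - 1"
  shows "tri n k x m = {lft m, rgt m, below m}"
proof (cases rule: below_cases[OF assms])
  case 1 then show ?thesis using diagonal(1)[OF assms] assms n2 by (auto simp: tri_def)
next
  case (2 i)
  then have "tri n k x m = x i \<union> x m" using assms by (auto simp: tri_def)
  then show ?thesis using diagonal(1)[OF assms] diagonal(1)[of i] 2 assms by auto
next
  case (3 i)
  then have "tri n k x m = x i \<union> x m" using assms by (auto simp: tri_def)
  then show ?thesis using diagonal(1)[OF assms] diagonal(1)[of i] 3 assms by auto
qed

lemma tri_inj: "inj_on (tri n k x) {1..n}"
proof (rule linorder_inj_onI)
  fix a b assume ab: "a < b" "a \<in> {1..n}" "b \<in> {1..n}"
  then have a: "1 \<le> a" "a \<le> n - 1" and b: "1 \<le> b - 1" "b - 1 \<le> n - 1" "Suc (b - 1) = b" by auto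
  have le: "lft a \<le> lft (b - 1)" "rgt (b - 1) \<le> rgt a"
    using diagonal_strict(1,2)[of a "b - 1"] ab a b by (cases "a = b - 1"; simp)+
  have "below a \<notin> {lft (b - 1), above (b - 1), rgt (b - 1)}"
    using above_between[OF b(1,2)] below_outside[OF a] le by auto
  then have "below a \<notin> tri n k x b" using tri_above[OF b(1,2)] b(3) by simp
  moreover have "below a \<in> tri n k x a" using tri_below[OF a] by simp
  ultimately show "tri n k x a \<noteq> tri n k x b" by blast
qed auto

end

section \<open>Fan centers and the default orientation\<close>

text \<open>
  Since \<open>remdups\<close> keeps last occurrences, its head is the first value only if equal values are
  adjacent.
\<close>

lemma hd_remdups_map_upt:
  assumes "a < b" "\<And>i. a \<le> i \<Longrightarrow> Suc i < b \<Longrightarrow> f i \<in> f ` {Suc i..<b} \<Longrightarrow> f (Suc i) = f i"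
  obtains ys where "remdups (map f [a..<b]) = f a # ys"
  using assms
proof (induction "b - a" arbitrary: a thesis)
  case (Suc d)
  show ?case
  proof (cases "f a \<in> f ` {Suc a..<b}")
    case False
    then show ?thesis using Suc.prems by (simp add: upt_conv_Cons)
  next
    case True
    then have "Suc a < b" by auto
    then have eq: "f (Suc a) = f a" using Suc.prems(3)[of a] True by simp
    obtain ys where "remdups (map f [Suc a..<b]) = f (Suc a) # ys"
      using Suc.hyps(1)[of "Suc a"] Suc.hyps(2) \<open>Suc a < b\<close> Suc.prems(3) by (metis Suc_eq_plus1 Suc_leD diff_Suc_eq_diff_pred diff_diff_left diff_Suc_1 plus_1_eq_Suc)
    then show ?thesis using True Suc.prems eq by (simp add: upt_conv_Cons)
  qed
qed simp

lemma consecutive_remdups: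
  fixes f :: "nat \<Rightarrow> 'a"
  assumes "a \<le> m" "Suc m < b" "f m \<noteq> f (Suc m)"
    and contiguous: "\<And>i. a \<le> i \<Longrightarrow> Suc i < b \<Longrightarrow> f i \<in> f ` {Suc i..<b} \<Longrightarrow> f (Suc i) = f i"
  shows "\<exists>s. Suc s < length (remdups (map f [a..<b])) \<and> remdups (map f [a..<b]) ! s = f m
     \<and> remdups (map f [a..<b]) ! Suc s = f (Suc m)"
proof -
  have "f m \<notin> f ` {Suc m..<b}" using contiguous[of m] assms by auto
  moreover obtain ys where "remdups (map f [Suc m..<b]) = f (Suc m) # ys"
    using hd_remdups_map_upt[of "Suc m" b f] assms by auto
  moreover have "[m..<b] = m # [Suc m..<b]" using assms by (simp add: upt_conv_Cons)
  ultimately have *: "remdups (map f [m..<b]) = f m # f (Suc m) # ys"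
    by (simp del: upt_Suc)
  have split: "[a..<b] = [a..<m] @ [m..<b]"
    using upt_add_eq_append[of a m "b - m"] assms by simp
  have "\<exists>zs. remdups (xs @ us) = zs @ remdups us" for xs us :: "'a list"
  proof (induction xs)
    case (Cons z xs)
    then obtain zs where "remdups (xs @ us) = zs @ remdups us" by blast
    then show ?case by (cases "z \<in> set (xs @ us)") (auto intro: exI[of _ "z # zs"])
  qed simp
  then obtain zs where "remdups (map f [a..<b]) = zs @ f m # f (Suc m) # ys"
    unfolding split map_append * [symmetric] by blast
  then show ?thesis by (intro exI[of _ "length zs"]) (simp add: nth_append)
qed

context crossed_triangulation
begin

abbreviation "center \<equiv> fan_center n j x"

text \<open>
  The sign of the variable \<open>\<theta>\<^sub>m\<close> in the comparison of the positive order with the order of indices.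
\<close>

definition eta :: "nat \<Rightarrow> real" where
  "eta m = (if center m < k then 1 else - 1)"

lemma center_interior:
  assumes "2 \<le> r" "r \<le> n - 1"
  shows "center r = (if lft (r - 1) = lft r then lft r else rgt r)"
proof -
  obtain i where i: "r = Suc i" "1 \<le> i" using assms by (cases r) auto
  have r: "max 2 (min (n - 1) r) = r" "n \<noteq> 2" using assms by auto
  have i': "1 \<le> i" "i \<le> n - 1" "1 \<le> r" "r \<le> n - 1" "Suc i \<le> n - 1" using i assms by simp_all
  note d = diagonal[OF i'(1,2)] diagonal[OF i'(3,4)]
  have "x i \<inter> x r = {if lft i = lft r then lft r else rgt r}"
  proof (cases "lft i = lft r")
    case True
    then have "rgt i \<noteq> rgt r" using diagonal_step[OF i'(1,5)] i by auto
    then show ?thesis unfolding d(1,6) using True d(3,4,8,9) by auto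
  next
    case False
    then have "rgt i = rgt r" using diagonal_step[OF i'(1,5)] i by auto
    then show ?thesis unfolding d(1,6) using False d(3,4,8,9) by auto
  qed
  then have "x (r - 1) \<inter> x r = {if lft (r - 1) = lft r then lft r else rgt r}" using i by simp
  then show ?thesis unfolding fan_center_def Let_def r(1) using r(2) by simp
qed

lemma center_first: "n \<noteq> 2 \<Longrightarrow> center 1 = center 2"
  using n2 by (auto simp: fan_center_def numeral_2_eq_2)

lemma center_last: "n \<noteq> 2 \<Longrightarrow> center n = center (n - 1)"
  using n2 by (auto simp: fan_center_def)

lemma center_2: "n = 2 \<Longrightarrow> center m = j"
  by (simp add: fan_center_def)

text \<open>
  The first and the last triangle share the fan center of their neighbour.
\<close>

lemma center_clamp:
  assumes "n \<noteq> 2" "1 \<le> m" "m \<le> n"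
  obtains r where "2 \<le> r" "r \<le> n - 1" "center m = center r" "m = r \<or> m = 1 \<and> r = 2 \<or> m = n \<and> r = n - 1"
proof -
  consider "m = 1" | "m = n" | "2 \<le> m" "m \<le> n - 1" using assms by linarith
  then show thesis
  proof cases
    case 1 then show ?thesis using that[of 2] center_first assms(1) n2 by simp
  next
    case 2 then show ?thesis using that[of "n - 1"] center_last assms(1) n2 by simp
  next
    case 3 then show ?thesis using that[of m] by simp
  qed
qed

lemma lft_mono: "1 \<le> a \<Longrightarrow> a \<le> b \<Longrightarrow> b \<le> n - 1 \<Longrightarrow> lft a \<le> lft b"
  and rgt_mono: "1 \<le> a \<Longrightarrow> a \<le> b \<Longrightarrow> b \<le> n - 1 \<Longrightarrow> rgt b \<le> rgt a"
  using diagonal_strict(1,2)[of a b] by (cases "a = b"; simp)+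

lemma interior_left:
  assumes "2 \<le> r" "r \<le> n - 1" "center r < k"
  shows "center r = lft r" "lft (r - 1) = lft r" "rgt (r - 1) = Suc (rgt r)"
proof -
  have "lft (r - 1) = lft r"
    using center_interior[OF assms(1,2)] assms diagonal(4)[of r] by (auto split: if_splits)
  then show "center r = lft r" "lft (r - 1) = lft r" "rgt (r - 1) = Suc (rgt r)"
    using center_interior[OF assms(1,2)] diagonal_step[of "r - 1"] assms by auto
qed

lemma interior_right:
  assumes "2 \<le> r" "r \<le> n - 1" "\<not> center r < k"
  shows "center r = rgt r" "rgt (r - 1) = rgt r" "lft r = Suc (lft (r - 1))"
proof -
  have "lft (r - 1) \<noteq> lft r"
    using center_interior[OF assms(1,2)] assms diagonal(3)[of r] by (auto split: if_splits)
  then show "center r = rgt r" "rgt (r - 1) = rgt r" "lft r = Suc (lft (r - 1))"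
    using center_interior[OF assms(1,2)] diagonal_step[of "r - 1"] assms by auto
qed

lemma center_interior_between:
  assumes "2 \<le> a" "a \<le> i" "i \<le> b" "b \<le> n - 1" "center a = center b"
  shows "center i = center a"
proof (cases "center a < k")
  case True
  then have "lft (a - 1) = lft b" using interior_left[of a] interior_left[of b] assms by simp
  moreover have "lft (a - 1) \<le> lft (i - 1)" "lft (i - 1) \<le> lft i" "lft i \<le> lft b"
    by (rule lft_mono; use assms in linarith)+
  ultimately have "lft (i - 1) = lft i" "lft i = lft b" by linarith+
  then show ?thesis
    using center_interior[of i] interior_left[of b] True assms by simp
next
  case False
  then have "rgt (a - 1) = rgt b" using interior_right[of a] interior_right[of b] assms by simp
  moreover have "rgt (i - 1) \<le> rgt (a - 1)" "rgt i \<le> rgt (i - 1)" "rgt b \<le> rgt i"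
    by (rule rgt_mono; use assms in linarith)+
  ultimately have r: "rgt (i - 1) = rgt i" "rgt i = rgt b" by linarith+
  then have "lft (i - 1) \<noteq> lft i"
    using diagonal_step[of "i - 1"] assms by auto
  then show ?thesis
    using center_interior[of i] interior_right[of b] False assms r by simp
qed

text \<open>
  A fan consists of consecutive triangles: while the center is some left vertex, all diagonals end
  there, and afterwards the left ends are larger.
\<close>

lemma center_contiguous:
  assumes "1 \<le> i" "Suc i < Suc n" "center i \<in> center ` {Suc i..<Suc n}"
  shows "center (Suc i) = center i"
proof (cases "n = 2")
  case True
  then show ?thesis using center_2 by simp
next
  case False
  obtain b where b: "Suc i \<le> b" "b \<le> n" "center i = center b" using assms(3) by auto
  obtain r where r: "2 \<le> r" "r \<le> n - 1" "center i = center r" "i = r \<or> i = 1 \<and> r = 2 \<or> i = n \<and> r = n - 1"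
    using center_clamp[OF False, of i] assms by auto
  obtain s where s: "2 \<le> s" "s \<le> n - 1" "center b = center s" "b = s \<or> b = 1 \<and> s = 2 \<or> b = n \<and> s = n - 1"
    using center_clamp[OF False, of b] assms b by auto
  obtain t where t: "2 \<le> t" "t \<le> n - 1" "center (Suc i) = center t"
    "Suc i = t \<or> Suc i = 1 \<and> t = 2 \<or> Suc i = n \<and> t = n - 1"
    using center_clamp[OF False, of "Suc i"] assms by auto
  have "r \<le> t" "t \<le> s" using r s t b assms by linarith+
  then show ?thesis using center_interior_between[of r t s] r s t b(3) by simp
qed

lemma center_in_diagonal:
  assumes m: "1 \<le> m" "m \<le> n - 1"
  shows "center m \<in> {lft m, rgt m}" "center (Suc m) \<in> {lft m, rgt m}"
proof -
  have "center m \<in> {lft m, rgt m} \<and> center (Suc m) \<in> {lft m, rgt m}"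
  proof (cases "n = 2")
    case True
    then have "m = n - 1" using m by simp
    then show ?thesis using True center_2[of m] center_2[of "Suc m"] diagonal_last by simp
  next
    case False
    have A: "center r \<in> {lft r, rgt r} \<and> center r \<in> {lft (r - 1), rgt (r - 1)}" if "2 \<le> r" "r \<le> n - 1" for r
    proof (cases "center r < k")
      case True
      show ?thesis unfolding interior_left(1)[OF that True] interior_left(2)[OF that True] by simp
    next
      case False
      show ?thesis unfolding interior_right(1)[OF that False] interior_right(2)[OF that False] by simp
    qed
    have n3: "3 \<le> n" using False n2 by simp
    have 1: "center m \<in> {lft m, rgt m}"
    proof (cases "m = 1")
      case True
      have "center 2 \<in> {lft (2 - 1), rgt (2 - 1)}" using A[of 2] n3 by linarith
      then show ?thesis using True center_first[OF False] by simp
    next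
      case False
      then show ?thesis using A[of m] m by linarith
    qed
    have 2: "center (Suc m) \<in> {lft m, rgt m}"
    proof (cases "m = n - 1")
      case True
      then have "center (Suc m) = center m" using center_last[OF False] n2 by simp
      then show ?thesis using 1 by simp
    next
      case False
      then show ?thesis using A[of "Suc m"] m by simp
    qed
    from 1 2 show ?thesis by simp
  qed
  then show "center m \<in> {lft m, rgt m}" "center (Suc m) \<in> {lft m, rgt m}" by auto
qed

text \<open>
  A diagonal inside a fan is not an edge between two fan centers.
\<close>

lemma other_end_no_center:
  assumes m: "1 \<le> m" "m \<le> n - 1" and eq: "center (Suc m) = center m" and i: "1 \<le> i" "i \<le> n"
  shows "center m < k \<Longrightarrow> center i \<noteq> rgt m" "\<not> center m < k \<Longrightarrow> center i \<noteq> lft m"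
proof -
  note dm = diagonal[OF m]
  have "(center m < k \<longrightarrow> center i \<noteq> rgt m) \<and> (\<not> center m < k \<longrightarrow> center i \<noteq> lft m)"
  proof (cases "n = 2")
    case True
    then show ?thesis using center_2 dm j_left by simp
  next
    case False
    obtain r where r: "2 \<le> r" "r \<le> n - 1" "center i = center r"
      using center_clamp[OF False i] by metis
    \<comment> \<open>The neighbours of \<open>x m\<close> in the chain both end elsewhere on the side opposite to the center, and the
      ends on one side never return to an earlier value.\<close>
    show ?thesis
    proof (intro conjI impI notI)
      assume c: "center m < k" "center i = rgt m"
      then have r': "\<not> center r < k" using r dm by simp
      note R = interior_right[OF r(1,2) r']
      have q: "rgt r = rgt m" "rgt (r - 1) = rgt m" using R r(3) c(2) by simp_all
      have "r \<le> m"
      proof (rule ccontr)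
        assume "\<not> r \<le> m"
        then have s: "2 \<le> Suc m" "Suc m \<le> n - 1" using m r by auto
        have "rgt m = Suc (rgt (Suc m))" using interior_left(3)[OF s] c eq by simp
        moreover have "rgt r \<le> rgt (Suc m)" using rgt_mono[of "Suc m" r] \<open>\<not> r \<le> m\<close> m r by simp
        ultimately show False using q by simp
      qed
      moreover have "2 \<le> m" using \<open>r \<le> m\<close> r by simp
      then have "rgt (m - 1) = Suc (rgt m)" using interior_left(3)[OF _ m(2)] c by simp
      moreover have "rgt (m - 1) \<le> rgt (r - 1)"
        using rgt_mono[of "r - 1" "m - 1"] r \<open>r \<le> m\<close> m by simp
      ultimately show False using q by simp
    next
      assume c: "\<not> center m < k" "center i = lft m"
      then have r': "center r < k" using r dm by simp
      note L = interior_left[OF r(1,2) r']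
      have q: "lft r = lft m" "lft (r - 1) = lft m" using L r(3) c(2) by simp_all
      have "r \<le> m"
      proof (rule ccontr)
        assume "\<not> r \<le> m"
        then have s: "2 \<le> Suc m" "Suc m \<le> n - 1" using m r by auto
        have "lft (Suc m) = Suc (lft m)" using interior_right(3)[OF s] c eq by simp
        moreover have "lft (Suc m) \<le> lft r" using lft_mono[of "Suc m" r] \<open>\<not> r \<le> m\<close> m r by simp
        ultimately show False using q by simp
      qed
      moreover have "2 \<le> m" using \<open>r \<le> m\<close> r by simp
      then have "lft m = Suc (lft (m - 1))" using interior_right(3)[OF _ m(2)] c by simp
      moreover have "lft (r - 1) \<le> lft (m - 1)"
        using lft_mono[of "r - 1" "m - 1"] r \<open>r \<le> m\<close> m by simp
      ultimately show False using q by simp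
    qed
  qed
  then show "center m < k \<Longrightarrow> center i \<noteq> rgt m" "\<not> center m < k \<Longrightarrow> center i \<noteq> lft m" by auto
qed

text \<open>
  A diagonal inside a fan is oriented away from the center of its fan, and one between two fans away
  from the center of the lower one.  Both are the center of \<open>\<Delta>\<^sub>m\<close>.
\<close>

lemma default_dir_diagonal:
  assumes m: "1 \<le> m" "m \<le> n - 1"
  shows "default_dir n j x (lft m) (rgt m) \<longleftrightarrow> center m < k"
    and "default_dir n j x (rgt m) (lft m) \<longleftrightarrow> \<not> center m < k"
proof -
  note dm = diagonal[OF m]
  define c where "c = fan_centers n j x"
  have c_eq: "c = remdups (map center [1..<Suc n])" by (simp add: c_def fan_centers_def)
  have c_set: "set c = center ` {1..n}" by (simp only: c_eq set_remdups set_map set_upt atLeastLessThanSuc_atLeastAtMost)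
  have dist: "distinct c" by (simp add: c_eq)
  define o' where "o' = (if center m < k then rgt m else lft m)"
  have co: "{center m, o'} = {lft m, rgt m}" "center m \<noteq> o'"
    using center_in_diagonal[OF m] dm by (auto simp: o'_def)
  have "default_dir n j x (center m) o' \<and> \<not> default_dir n j x o' (center m)"
  proof (cases "center (Suc m) = center m")
    case True
    have "o' \<notin> set c"
    proof
      assume "o' \<in> set c"
      then obtain i where "1 \<le> i" "i \<le> n" "o' = center i" unfolding c_set by auto
      then show False
        using other_end_no_center[OF m True, of i] by (cases "center m < k") (simp_all add: o'_def)
    qed
    moreover have "center m \<in> set c" unfolding c_set using m by simp
    moreover have "\<nexists>s. Suc s < length c \<and> {p, q} = {c ! s, c ! Suc s}" if "o' \<in> {p, q}" for p q
      using that \<open>o' \<notin> set c\<close> by (metis Suc_lessD insertE nth_mem singletonD)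
    ultimately show ?thesis unfolding default_dir_def c_def[symmetric] Let_def by auto
  next
    case False
    then have o': "center (Suc m) = o'"
      using center_in_diagonal[OF m] dm by (auto simp: o'_def split: if_splits)
    have "Suc m < Suc n" "center m \<noteq> center (Suc m)" using m n2 False by simp_all
    note consecutive_remdups[of 1 m "Suc n" center, OF m(1) this center_contiguous]
    then obtain s where s: "Suc s < length c" "c ! s = center m" "c ! Suc s = o'"
      unfolding c_eq o' by blast
    have uniq: "s' = s" if "Suc s' < length c" "c ! s' = center m" for s'
      using that s dist by (metis Suc_lessD nth_eq_iff_index_eq)
    have uniq': "s' = Suc s" if "Suc s' < length c" "c ! s' = o'" for s'
      using that s dist by (metis Suc_lessD nth_eq_iff_index_eq)
    have "\<not> (\<exists>s'. Suc s' < length c \<and> o' = c ! s' \<and> center m = c ! Suc s')"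
    proof
      assume "\<exists>s'. Suc s' < length c \<and> o' = c ! s' \<and> center m = c ! Suc s'"
      then obtain s' where s': "Suc s' < length c" "o' = c ! s'" "center m = c ! Suc s'" by blast
      then have "s' = Suc s" using uniq' by simp
      then have "c ! Suc (Suc s) = c ! s" "Suc (Suc s) < length c" using s s' by simp_all
      then show False using dist s nth_eq_iff_index_eq[of c "Suc (Suc s)" s] by simp
    qed
    moreover have "\<exists>s. Suc s < length c \<and> {center m, o'} = {c ! s, c ! Suc s}"
      "\<exists>s. Suc s < length c \<and> {o', center m} = {c ! s, c ! Suc s}"
      using s by (auto intro!: exI[of _ s])
    ultimately show ?thesis using s unfolding default_dir_def c_def[symmetric] Let_def by auto
  qed
  then show "default_dir n j x (lft m) (rgt m) \<longleftrightarrow> center m < k"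
    and "default_dir n j x (rgt m) (lft m) \<longleftrightarrow> \<not> center m < k"
    using co center_in_diagonal(1)[OF m] dm unfolding o'_def by (auto split: if_splits)
qed

text \<open>
  The triangle \<open>\<Delta>\<^sub>m\<close> is below \<open>x m\<close>, hence to the right of it if \<open>x m\<close> points from left to right.
\<close>

lemma lies_on_right_iff:
  assumes m: "1 \<le> m" "m \<le> n - 1"
  shows "lies_on_right n k j x m \<longleftrightarrow> center m < k"
proof -
  note dm = diagonal[OF m] and out = below_outside[OF m]
  have cw: "cw (lft m) (rgt m) (below m)" "\<not> cw (rgt m) (lft m) (below m)"
    using dm out by (auto simp: cw_def)
  have "u = below m" if "tri n k x m = {p, q, u}" "x m = {p, q}" "cw p q u" for p q u
  proof -
    have "u \<in> {lft m, rgt m, below m}" using that(1) tri_below[OF m] by auto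
    moreover have "u \<notin> {lft m, rgt m}" using cw_distinct[OF that(3)] that(2) dm(1) by auto
    ultimately show ?thesis by simp
  qed
  then have "lies_on_right n k j x m \<longleftrightarrow> default_dir n j x (lft m) (rgt m)"
    unfolding lies_on_right_def using cw tri_below[OF m] dm(1)
    by (metis doubleton_eq_iff)
  then show ?thesis using default_dir_diagonal[OF m] by simp
qed

end

section \<open>The triangles of the triangulation\<close>

lemma cw_boundary: "r < N \<Longrightarrow> v < N \<Longrightarrow> \<not> cw v r (Suc v mod N)"
  by (cases "Suc v = N") (auto simp: cw_def)

context crossed_triangulation
begin

abbreviation "boundary_sides \<equiv> boundary (n + 2)"
abbreviation "all_arcs \<equiv> T \<union> boundary (n + 2)"

lemma boundary_cases:
  assumes "d \<in> boundary_sides"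
  obtains v where "v \<le> n" "d = {v, Suc v}" | "d = {0, n + 1}"
proof -
  obtain v where v: "v < n + 2" "d = {v, Suc v mod (n + 2)}"
    using assms unfolding boundary_def by auto
  show thesis
  proof (cases "v = n + 1")
    case True then show ?thesis using v that by (simp add: insert_commute)
  next
    case False then show ?thesis using v that(1)[of v] by simp
  qed
qed

lemma boundary_in: "v \<le> n \<Longrightarrow> {v, Suc v} \<in> boundary_sides" "{0, n + 1} \<in> boundary_sides"
proof -
  show "v \<le> n \<Longrightarrow> {v, Suc v} \<in> boundary_sides"
    unfolding boundary_def by (rule image_eqI[of _ _ v]) auto
  show "{0, n + 1} \<in> boundary_sides"
    unfolding boundary_def by (rule image_eqI[of _ _ "n + 1"]) auto
qed

lemma T_eq: "T = x ` {1..n - 1}"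
  using x_bij by (auto simp: bij_betw_def)

lemma T_cases:
  assumes "d \<in> T"
  obtains m where "1 \<le> m" "m \<le> n - 1" "d = {lft m, rgt m}"
  using assms diagonal(1) unfolding T_eq by auto

lemma T_in: "1 \<le> m \<Longrightarrow> m \<le> n - 1 \<Longrightarrow> {lft m, rgt m} \<in> T"
  using diagonal(1) unfolding T_eq by (metis atLeastAtMost_iff image_eqI)

lemma arcs_D: "arcs D = all_arcs"
  using D_default by (simp add: default_decorated_def)

lemma arc_vertices:
  assumes "{a, b} \<in> all_arcs"
  shows "a < n + 2" "b < n + 2" "a \<noteq> b"
proof -
  have "a < n + 2 \<and> b < n + 2 \<and> a \<noteq> b"
    using assms
  proof
    assume "{a, b} \<in> T"
    then obtain m where m: "1 \<le> m" "m \<le> n - 1" "{a, b} = {lft m, rgt m}" using T_cases by blast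
    then show ?thesis using diagonal(3-5)[OF m(1,2)] by (auto simp: doubleton_eq_iff)
  next
    assume "{a, b} \<in> boundary_sides"
    then show ?thesis by (rule boundary_cases) (auto simp: doubleton_eq_iff)
  qed
  then show "a < n + 2" "b < n + 2" "a \<noteq> b" by auto
qed

text \<open>
  No vertex lies beyond a boundary side.
\<close>

lemma boundary_one_sided:
  assumes "{a, b} \<in> boundary_sides" "cw a r b" "cw b s a" "r < n + 2" "s < n + 2"
  shows False
proof -
  obtain v where "v < n + 2" "{a, b} = {v, Suc v mod (n + 2)}"
    using assms(1) unfolding boundary_def by auto
  then show False
    using cw_boundary[of r "n + 2" v] cw_boundary[of s "n + 2" v] assms by (auto simp: doubleton_eq_iff)
qed

lemma noncrossing_arcs: "noncrossing (all_arcs)"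
  unfolding noncrossing_def
proof (intro allI impI notI)
  fix a b r s
  assume ab: "{a, b} \<in> all_arcs \<and> {r, s} \<in> all_arcs" and c: "cw a r b \<and> cw b s a"
  have v: "a < n + 2" "b < n + 2" "r < n + 2" "s < n + 2"
    using ab arc_vertices by blast+
  have "{a, b} \<notin> boundary_sides" using boundary_one_sided c v by blast
  moreover have "{r, s} \<notin> boundary_sides"
    using boundary_one_sided[of r s b a] crossing_sym[of a r b s] c v by blast
  ultimately have "{a, b} \<in> T" "{r, s} \<in> T" using ab by auto
  then show False
    using triangulation c unfolding triangulation_def crosses_def by blast
qed

lemma arc_left_left:
  assumes "{a, b} \<in> all_arcs" "0 < a" "a < b" "b < k"
  shows "b = Suc a"
  using assms(1)
proof
  assume "{a, b} \<in> T"
  then show ?thesis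
  proof (rule T_cases)
    fix m assume "1 \<le> m" "m \<le> n - 1" "{a, b} = {lft m, rgt m}"
    then show ?thesis using diagonal(4)[of m] assms by (auto simp: doubleton_eq_iff)
  qed
next
  assume "{a, b} \<in> boundary_sides"
  then show ?thesis by (rule boundary_cases) (use assms in \<open>auto simp: doubleton_eq_iff\<close>)
qed

lemma arc_right_right:
  assumes "{a, b} \<in> all_arcs" "k < a" "a < b"
  shows "b = Suc a"
  using assms(1)
proof
  assume "{a, b} \<in> T"
  then show ?thesis
  proof (rule T_cases)
    fix m assume "1 \<le> m" "m \<le> n - 1" "{a, b} = {lft m, rgt m}"
    then show ?thesis using diagonal(3)[of m] assms by (auto simp: doubleton_eq_iff)
  qed
next
  assume "{a, b} \<in> boundary_sides"
  then show ?thesis by (rule boundary_cases) (use assms in \<open>auto simp: doubleton_eq_iff\<close>)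
qed

lemma arc_left_right:
  assumes "{a, b} \<in> all_arcs" "0 < a" "a < k" "k < b"
  obtains m where "1 \<le> m" "m \<le> n - 1" "a = lft m" "b = rgt m"
  using assms(1)
proof
  assume "{a, b} \<in> T"
  then show ?thesis
  proof (rule T_cases)
    fix m assume "1 \<le> m" "m \<le> n - 1" "{a, b} = {lft m, rgt m}"
    then show ?thesis using diagonal(3,4)[of m] assms that[of m] by (auto simp: doubleton_eq_iff)
  qed
next
  assume "{a, b} \<in> boundary_sides"
  then show ?thesis by (rule boundary_cases) (use assms in \<open>auto simp: doubleton_eq_iff\<close>)
qed

lemma arc_zero:
  assumes "{0, b} \<in> all_arcs"
  shows "b = 1 \<or> b = n + 1"
  using assms
proof
  assume "{0, b} \<in> T"
  then show ?thesis
  proof (rule T_cases)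
    fix m assume "1 \<le> m" "m \<le> n - 1" "{0, b} = {lft m, rgt m}"
    then show ?thesis using diagonal(2,4)[of m] by (auto simp: doubleton_eq_iff)
  qed
next
  assume "{0, b} \<in> boundary_sides"
  then show ?thesis by (rule boundary_cases) (auto simp: doubleton_eq_iff)
qed

lemma arc_top:
  assumes "{k, b} \<in> all_arcs"
  shows "b = k - 1 \<or> b = k + 1"
  using assms
proof
  assume "{k, b} \<in> T"
  then show ?thesis
  proof (rule T_cases)
    fix m assume "1 \<le> m" "m \<le> n - 1" "{k, b} = {lft m, rgt m}"
    then show ?thesis using diagonal(3,4)[of m] by (auto simp: doubleton_eq_iff)
  qed
next
  assume "{k, b} \<in> boundary_sides"
  then show ?thesis by (rule boundary_cases) (use k_bounds in \<open>auto simp: doubleton_eq_iff\<close>)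
qed

lemma tri_first: "tri n k x 1 = {0, 1, n + 1}"
  using tri_below[of 1] diagonal_first n2 by (auto simp: below_def)

lemma tri_last: "tri n k x n = {k - 1, k, k + 1}"
proof -
  have "1 \<le> n - 1" "Suc (n - 1) = n" using n2 by simp_all
  then show ?thesis using tri_above[of "n - 1"] diagonal_last by (auto simp: above_def)
qed

text \<open>
  The cases are the possible positions of the three vertices with respect to \<open>f\<close>.  Two vertices on the
  same side of \<open>f\<close> can be joined only by a boundary side, so the diagonals to the third vertex are
  consecutive in the chain.
\<close>

lemma triangle_is_tri_sorted:
  assumes abc: "a < b" "b < c"
    and arcs: "{a, b} \<in> all_arcs" "{b, c} \<in> all_arcs" "{a, c} \<in> all_arcs"
  shows "\<exists>m\<in>{1..n}. {a, b, c} = tri n k x m"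
proof -
  have n1: "1 \<in> {1..n}" "n \<in> {1..n}" using n2 by auto
  consider (zero) "a = 0" | (top) "0 < a" "k \<in> {a, b, c}" | (left) "0 < a" "c < k"
    | (ll) "0 < a" "b < k" "k < c" | (rr) "0 < a" "a < k" "k < b" | (right) "k < a"
    using abc by fastforce
  then show ?thesis
  proof cases
    case zero
    then have "b = 1 \<or> b = n + 1" "c = 1 \<or> c = n + 1" using arc_zero arcs by blast+
    then have "b = 1" "c = n + 1" using abc by linarith+
    then show ?thesis using zero tri_first n1 by auto
  next
    case top
    have arcs': "{b, a} \<in> all_arcs" "{c, b} \<in> all_arcs" "{c, a} \<in> all_arcs"
      using arcs by (simp_all add: insert_commute)
    have "k \<noteq> a" using arc_top[of b] arc_top[of c] arcs abc by auto
    moreover have "k \<noteq> c" using arc_top[of a] arc_top[of b] arcs' abc by auto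
    ultimately have "k = b" using top by simp
    then have "a = k - 1" "c = k + 1" using arc_top[of a] arc_top[of c] arcs arcs' abc by auto
    then have "{a, b, c} = {k - 1, k, k + 1}" using \<open>k = b\<close> by simp
    then show ?thesis using tri_last n1 by auto
  next
    case left
    then show ?thesis using arc_left_left[of a b] arc_left_left[of a c] arcs abc by auto
  next
    case ll
    have b: "b = Suc a" using arc_left_left arcs ll abc by blast
    obtain m where m: "1 \<le> m" "m \<le> n - 1" "a = lft m" "c = rgt m"
      using arc_left_right[OF arcs(3)] ll abc by auto
    obtain m' where m': "1 \<le> m'" "m' \<le> n - 1" "b = lft m'" "c = rgt m'"
      using arc_left_right[OF arcs(2)] ll abc by auto
    have "m' = Suc m" using diagonal_index[OF m(1,2)] diagonal_index[OF m'(1,2)] m m' b by linarith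
    then have "tri n k x m' = x m \<union> x m'" using m m' by (auto simp: tri_def)
    then have "{a, b, c} = tri n k x m'"
      using diagonal(1)[OF m(1,2)] diagonal(1)[OF m'(1,2)] m m' by auto
    then show ?thesis using m' by (intro bexI[of _ m']) auto
  next
    case rr
    have c: "c = Suc b" using arc_right_right arcs rr abc by blast
    obtain m where m: "1 \<le> m" "m \<le> n - 1" "a = lft m" "b = rgt m"
      using arc_left_right[OF arcs(1)] rr abc by auto
    obtain m' where m': "1 \<le> m'" "m' \<le> n - 1" "a = lft m'" "c = rgt m'"
      using arc_left_right[OF arcs(3)] rr abc by auto
    have "m = Suc m'" using diagonal_index[OF m(1,2)] diagonal_index[OF m'(1,2)] m m' c by linarith
    then have "tri n k x m = x m' \<union> x m" using m m' by (auto simp: tri_def)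
    then have "{a, b, c} = tri n k x m"
      using diagonal(1)[OF m(1,2)] diagonal(1)[OF m'(1,2)] m m' by auto
    then show ?thesis using m by (intro bexI[of _ m]) auto
  next
    case right
    then show ?thesis using arc_right_right[of a b] arc_right_right[of a c] arcs abc by auto
  qed
qed

lemma triangle_is_tri:
  assumes "cw a b c"
    and arcs: "{a, b} \<in> all_arcs" "{b, c} \<in> all_arcs" "{a, c} \<in> all_arcs"
  shows "\<exists>m\<in>{1..n}. {a, b, c} = tri n k x m"
proof -
  have arcs': "{b, a} \<in> all_arcs" "{c, b} \<in> all_arcs" "{c, a} \<in> all_arcs"
    using arcs by (simp_all add: insert_commute)
  consider "a < b" "b < c" | "b < c" "c < a" | "c < a" "a < b"
    using assms(1) unfolding cw_def by blast
  then show ?thesis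
  proof cases
    case 1 then show ?thesis using triangle_is_tri_sorted arcs by blast
  next
    case 2
    then have "\<exists>m\<in>{1..n}. {b, c, a} = tri n k x m" using triangle_is_tri_sorted arcs arcs' by blast
    then show ?thesis by (simp add: insert_commute)
  next
    case 3
    then have "\<exists>m\<in>{1..n}. {c, a, b} = tri n k x m" using triangle_is_tri_sorted arcs arcs' by blast
    then show ?thesis by (simp add: insert_commute)
  qed
qed

lemma side_arcs:
  assumes m: "1 \<le> m" "m \<le> n - 1"
  shows "{lft m, above m} \<in> all_arcs" "{above m, rgt m} \<in> all_arcs"
    "{lft m, below m} \<in> all_arcs" "{below m, rgt m} \<in> all_arcs"
proof -
  note d = diagonal[OF m]
  have "{lft m, above m} \<in> all_arcs \<and> {above m, rgt m} \<in> all_arcs"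
  proof (cases rule: above_cases[OF m])
    case 1
    then show ?thesis using boundary_in(1)[of "k - 1"] boundary_in(1)[of k] k_bounds by auto
  next
    case 2
    then show ?thesis using boundary_in(1)[of "above m"] T_in[of "Suc m"] d by auto
  next
    case 3
    then show ?thesis using boundary_in(1)[of "lft m"] T_in[of "Suc m"] d k_bounds by auto
  qed
  moreover have "{lft m, below m} \<in> all_arcs \<and> {below m, rgt m} \<in> all_arcs"
  proof (cases rule: below_cases[OF m])
    case 1
    then show ?thesis using boundary_in(1)[of 0] boundary_in(2) by (simp add: insert_commute)
  next
    case (2 i)
    then have i: "i \<le> n - 1" using m by simp
    have "rgt m \<le> n" using 2 diagonal(5)[OF 2(2) i] by simp
    then show ?thesis using boundary_in(1)[of "rgt m"] T_in[OF 2(2) i] 2 by (simp add: insert_commute)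
  next
    case (3 i)
    then have i: "i \<le> n - 1" using m by simp
    have "lft i \<le> n" using diagonal(3)[OF 3(2) i] k_bounds by simp
    then show ?thesis using boundary_in(1)[of "lft i"] T_in[OF 3(2) i] 3 by (simp add: insert_commute)
  qed
  ultimately show "{lft m, above m} \<in> all_arcs" "{above m, rgt m} \<in> all_arcs"
    "{lft m, below m} \<in> all_arcs" "{below m, rgt m} \<in> all_arcs" by auto
qed

end

section \<open>Vectors for the given triangulation\<close>

context crossed_triangulation
begin

definition length_ok :: "(nat \<Rightarrow> super_vector) \<Rightarrow> nat \<Rightarrow> nat \<Rightarrow> bool" where
  "length_ok V a b \<longleftrightarrow> lam V a b = of_real (w {a, b})"

text \<open>
  The signs in these two conditions are forced by the default orientation: it gives equal signs to all
  triangles, except that the sign of the first one is \<open>- \<eta>\<^sub>1\<close>, because the vertex below \<open>x 1\<close> is \<open>0\<close>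
  whichever end of \<open>x 1\<close> is the fan center.
\<close>

definition mu_ok :: "(nat \<Rightarrow> super_vector) \<Rightarrow> nat \<Rightarrow> bool" where
  "mu_ok V m \<longleftrightarrow> det3 V (lft m) (above m) (rgt m)
     = sqrt (w {lft m, above m} * w {above m, rgt m} * w {lft m, rgt m}) *\<^sub>R odd_var (Suc m)"

definition first_mu_ok :: "(nat \<Rightarrow> super_vector) \<Rightarrow> bool" where
  "first_mu_ok V \<longleftrightarrow> det3 V 0 1 (n + 1)
     = (- eta 1 * sqrt (w {0, 1} * w {1, n + 1} * w {0, n + 1})) *\<^sub>R odd_var 1"

text \<open>
  The vectors realize the first \<open>m\<close> triangles.
\<close>

definition stage :: "(nat \<Rightarrow> super_vector) \<Rightarrow> nat \<Rightarrow> bool" where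
  "stage V m \<longleftrightarrow> (\<forall>i. super_vector (V i)) \<and> length_ok V 0 1 \<and> length_ok V 0 (n + 1) \<and> first_mu_ok V \<and>
     (\<forall>i. 1 \<le> i \<and> i \<le> m \<and> i \<le> n - 1 \<longrightarrow> length_ok V (lft i) (rgt i)) \<and>
     (\<forall>i. 1 \<le> i \<and> i < m \<longrightarrow> length_ok V (lft i) (above i) \<and> length_ok V (above i) (rgt i) \<and> mu_ok V i)"

lemma stage_base: "\<exists>V. stage V 1"
proof -
  \<comment> \<open>The first two vectors may be taken without odd components; only the bracket of the pair matters.\<close>
  define a :: super_vector where "a = (1, 0, 0)"
  define c :: super_vector where "c = (0, of_real (w {1, n + 1}), 0)"
  have ac_sv: "super_vector a" "super_vector c" by (simp_all add: a_def c_def super_vector_def)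
  have ac: "bracket a c = of_real (w {1, n + 1})" by (simp add: a_def c_def bracket_def)
  have "{1, n + 1} \<in> T" using T_in[of 1] diagonal_first n2 by simp
  then have "w {1, n + 1} > 0" using w_pos by blast
  then have "body (bracket a c) \<noteq> 0" unfolding ac by simp
  from super_vector_exists[OF ac_sv this, of "- of_real (w {0, 1})" "of_real (w {0, n + 1})"
      "(eta 1 * sqrt (w {0, 1} * w {1, n + 1} * w {0, n + 1})) *\<^sub>R odd_var 1"]
  obtain v where v: "super_vector v" "bracket a v = - of_real (w {0, 1})" "bracket v c = of_real (w {0, n + 1})"
    "odd_det a v c = (eta 1 * sqrt (w {0, 1} * w {1, n + 1} * w {0, n + 1})) *\<^sub>R odd_var 1" by auto
  define V where "V i = (if i = 0 then v else if i = 1 then a else c)" for i :: nat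
  interpret super_vectors V by unfold_locales (use ac_sv v in \<open>simp add: V_def\<close>)
  have V: "V 0 = v" "V 1 = a" "V (n + 1) = c" using n2 by (simp_all add: V_def)
  have "det3 V 0 1 (n + 1) = - odd_det a v c"
    unfolding det3_def V by (rule odd_det_swap) (rule ac_sv(1) v(1) ac_sv(2))+
  then have d: "first_mu_ok V" unfolding first_mu_ok_def v(4) by simp
  have "bracket v a = of_real (w {0, 1})" using bracket_antisym[OF ac_sv(1) v(1)] v(2) by simp
  then have o: "length_ok V 0 1" "length_ok V 0 (n + 1)" "length_ok V 1 (n + 1)"
    unfolding length_ok_def using lam_less[of 0 1] lam_less[of 0 "n + 1"] lam_less[of 1 "n + 1"] n2 v(3) ac
    unfolding V by simp_all
  have "stage V 1"
    unfolding stage_def using d o diagonal_first by (auto simp: le_Suc_eq)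
  then show ?thesis by blast
qed

text \<open>
  The apex above \<open>x m\<close> has not been used before, so its vector can be chosen freely.
\<close>

lemma stage_step:
  assumes st: "stage V m" and m: "1 \<le> m" "m \<le> n - 1"
  shows "\<exists>V'. stage V' (Suc m)"
proof -
  interpret super_vectors V by unfold_locales (use st in \<open>auto simp: stage_def\<close>)
  note d = diagonal[OF m] and ab = above_between[OF m]
  define t where "t = above m"
  have pq: "bracket (V (lft m)) (V (rgt m)) = of_real (w {lft m, rgt m})"
    using st m lam_less[of "lft m" "rgt m"] d(3,4) unfolding stage_def length_ok_def by auto
  have "w {lft m, rgt m} > 0" using w_pos T_in[OF m] by blast
  then have "body (bracket (V (lft m)) (V (rgt m))) \<noteq> 0" unfolding pq by simp
  from super_vector_exists[OF sv sv this, of "of_real (w {lft m, t})" "of_real (w {t, rgt m})"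
      "sqrt (w {lft m, t} * w {t, rgt m} * w {lft m, rgt m}) *\<^sub>R odd_var (Suc m)"]
  obtain v where v: "super_vector v" "bracket (V (lft m)) v = of_real (w {lft m, t})"
    "bracket v (V (rgt m)) = of_real (w {t, rgt m})"
    "odd_det (V (lft m)) v (V (rgt m)) = sqrt (w {lft m, t} * w {t, rgt m} * w {lft m, rgt m}) *\<^sub>R odd_var (Suc m)"
    by auto
  define V' where "V' = V(t := v)"
  interpret V': super_vectors V' by unfold_locales (use v in \<open>simp add: V'_def\<close>)
  have V't: "V' t = v" by (simp add: V'_def)
  have V': "V' i = V i" if "i \<noteq> t" for i using that by (simp add: V'_def)
  \<comment> \<open>The ends of the diagonals up to \<open>x m\<close> and their apexes keep their vectors.\<close>
  have lr: "lft i \<noteq> t \<and> rgt i \<noteq> t" if "1 \<le> i" "i \<le> m" for i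
    using lft_mono[OF that m(2)] rgt_mono[OF that m(2)] ab by (auto simp: t_def)
  have ab': "above i \<noteq> t" if "1 \<le> i" "i < m" for i
  proof -
    have i: "i \<le> n - 1" using that m by simp
    show ?thesis
      by (cases rule: above_cases[OF that(1) i]) (use lr[of "Suc i"] that m in auto)
  qed
  have 01: "0 \<noteq> t" "1 \<noteq> t" "n + 1 \<noteq> t" using ab d by (auto simp: t_def)
  have keep: "length_ok V' a b \<longleftrightarrow> length_ok V a b" if "a \<noteq> t" "b \<noteq> t" for a b
    using that by (simp add: length_ok_def lam_def V')
  have new: "length_ok V' (lft m) t" "length_ok V' t (rgt m)"
    using V'.lam_less[of "lft m" t] V'.lam_less[of t "rgt m"] ab lr[of m] m v
    by (simp_all add: length_ok_def t_def[symmetric] V' V't)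
  have det_new: "mu_ok V' m"
    using lr[of m] m v(4) by (simp add: mu_ok_def det3_def t_def[symmetric] V' V't)
  have "stage V' (Suc m)"
    unfolding stage_def
  proof (intro conjI allI impI)
    show "super_vector (V' i)" for i by simp
    show "length_ok V' 0 1" "length_ok V' 0 (n + 1)" using keep 01 st by (simp_all add: stage_def)
    show "first_mu_ok V'" using 01 st by (simp add: stage_def first_mu_ok_def det3_def V')
  next
    fix i assume i: "1 \<le> i \<and> i \<le> Suc m \<and> i \<le> n - 1"
    show "length_ok V' (lft i) (rgt i)"
    proof (cases "i \<le> m")
      case True
      then show ?thesis using keep lr[of i] st i by (simp add: stage_def)
    next
      case False
      then have i: "i = Suc m" "m < n - 1" using i by auto
      show ?thesis using new i
        by (cases rule: above_cases[OF m]) (simp_all add: t_def)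
    qed
  next
    fix i assume i: "1 \<le> i \<and> i < Suc m"
    have "length_ok V' (lft i) (above i) \<and> length_ok V' (above i) (rgt i) \<and> mu_ok V' i"
    proof (cases "i = m")
      case True then show ?thesis using new det_new by (simp add: t_def)
    next
      case False
      then have "1 \<le> i" "i < m" using i by auto
      then show ?thesis using keep lr[of i] ab'[of i] st
        by (simp add: stage_def mu_ok_def det3_def V')
    qed
    then show "length_ok V' (lft i) (above i)" "length_ok V' (above i) (rgt i)" "mu_ok V' i" by auto
  qed
  then show ?thesis by blast
qed

lemma vectors_exist:
  obtains V where "\<And>i. super_vector (V i)" "\<And>a b. {a, b} \<in> all_arcs \<Longrightarrow> length_ok V a b"
    "first_mu_ok V" "\<And>m. 1 \<le> m \<Longrightarrow> m \<le> n - 1 \<Longrightarrow> mu_ok V m"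
proof -
  have "\<exists>V. stage V m" if "1 \<le> m" "m \<le> n" for m
    using that
  proof (induction m rule: dec_induct)
    case base
    show ?case by (rule stage_base)
  next
    case (step m)
    then obtain V where "stage V m" by auto
    then show ?case using stage_step[of V m] step by auto
  qed
  from this[of n] obtain V where st: "stage V n" using n2 by auto
  then have sv: "super_vector (V i)" for i by (simp add: stage_def)
  interpret super_vectors V by unfold_locales (rule sv)
  have dg: "length_ok V (lft m) (rgt m)" "length_ok V (lft m) (above m)" "length_ok V (above m) (rgt m)" "mu_ok V m"
    if "1 \<le> m" "m \<le> n - 1" for m
    using st that by (auto simp: stage_def)
  have o: "length_ok V 0 1" "length_ok V 0 (n + 1)" using st by (simp_all add: stage_def)
  \<comment> \<open>Each triangle between two diagonals has one boundary side, on the side of \<open>f\<close> on which the ends of the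
    diagonals differ.\<close>
  have bd: "(\<forall>v<lft m. length_ok V v (Suc v)) \<and> (\<forall>v. rgt m \<le> v \<and> v \<le> n \<longrightarrow> length_ok V v (Suc v))"
    if "1 \<le> m" "m \<le> n - 1" for m
    using that
  proof (induction m rule: dec_induct)
    case base
    then show ?case using o diagonal_first by auto
  next
    case (step m)
    then have m: "1 \<le> m" "m \<le> n - 1" and IH: "\<And>v. v < lft m \<Longrightarrow> length_ok V v (Suc v)"
      "\<And>v. rgt m \<le> v \<Longrightarrow> v \<le> n \<Longrightarrow> length_ok V v (Suc v)" by auto
    show ?case
    proof (cases rule: above_cases[OF m])
      case 1 then show ?thesis using step by simp
    next
      case 2
      then have "length_ok V (rgt (Suc m)) (Suc (rgt (Suc m)))" using dg(3)[OF m] by simp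
      then show ?thesis using 2 IH
        by (metis Suc_leI le_neq_implies_less)
    next
      case 3
      then have "length_ok V (lft m) (Suc (lft m))" using dg(2)[OF m] by simp
      then show ?thesis using 3 IH by (auto simp: less_Suc_eq)
    qed
  qed
  have n1: "1 \<le> n - 1" using n2 by simp
  have "length_ok V (k - 1) k" "length_ok V k (Suc k)" using dg(2,3)[OF n1 order_refl] diagonal_last by (simp_all add: above_def)
  then have side: "length_ok V v (Suc v)" if "v \<le> n" for v
    using bd[OF n1 order_refl] that diagonal_last k_bounds
    by (metis One_nat_def Suc_eq_plus1 Suc_leI Suc_pred' less_or_eq_imp_le linorder_neqE_nat not_less_eq_eq order_le_less_trans zero_less_one le_neq_implies_less)
  have sym: "length_ok V b a" if "length_ok V a b" "a \<noteq> b" for a b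
    using that lam_sym[of a b] by (simp add: length_ok_def insert_commute)
  have "length_ok V a b" if ab: "{a, b} \<in> all_arcs" for a b
  proof -
    have "\<exists>c d. {a, b} = {c, d} \<and> length_ok V c d"
      using ab
    proof
      assume "{a, b} \<in> T" then show ?thesis using T_cases dg(1) by metis
    next
      assume "{a, b} \<in> boundary_sides" then show ?thesis
        by (rule boundary_cases) (use side o in blast)+
    qed
    then show ?thesis using sym arc_vertices(3)[OF ab] by (metis doubleton_eq_iff)
  qed
  then show thesis using that[of V] sv st dg(4) by (auto simp: stage_def)
qed

end

section \<open>Products in the positive order\<close>

lemma sorted_wrt_unique:
  assumes "sorted_wrt R xs" "sorted_wrt R ys" "distinct xs" "distinct ys" "set xs = set ys"
    and "\<And>a b. a \<in> set xs \<Longrightarrow> b \<in> set xs \<Longrightarrow> R a b \<Longrightarrow> \<not> R b a"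
  shows "xs = ys"
  using assms
proof (induction xs arbitrary: ys)
  case (Cons a xs)
  have "ys \<noteq> []" using Cons.prems(5) by auto
  then obtain b ys' where ys: "ys = b # ys'" by (cases ys) simp_all
  have eq: "a = b"
  proof (rule ccontr)
    assume "a \<noteq> b"
    then have ab: "a \<in> set ys'" "b \<in> set xs" using Cons.prems(5) ys by auto
    then have "R b a" "R a b" using Cons.prems(1,2) ys by simp_all
    then show False using Cons.prems(6)[of a b] ab by simp
  qed
  have "set xs = set ys'"
    using Cons.prems(3-5) ys eq by (simp add: insert_ident)
  then have "xs = ys'"
    using Cons.prems(1-4,6) ys by (intro Cons.IH) simp_all
  then show ?case using ys eq by simp
qed simp

lemma parity_prod_list:
  assumes "\<And>m. godd (\<theta> m)"
  shows "if even (length ms) then geven (prod_list (map \<theta> ms)) else godd (prod_list (map \<theta> ms))"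
  using assms by (induction ms) (auto split: if_splits)

text \<open>
  The sign \<open>\<eta>\<close> is attached to every other factor, beginning with the first one if \<open>b\<close> holds.
\<close>

fun signed_product :: "(nat \<Rightarrow> real) \<Rightarrow> (nat \<Rightarrow> grassmann) \<Rightarrow> bool \<Rightarrow> nat list \<Rightarrow> grassmann" where
  "signed_product \<eta> \<theta> b [] = 1"
| "signed_product \<eta> \<theta> b (r # rs) = ((if b then \<eta> r else 1) *\<^sub>R \<theta> r) * signed_product \<eta> \<theta> (\<not> b) rs"

lemma signed_product_snoc:
  "signed_product \<eta> \<theta> b (rs @ [m])
     = signed_product \<eta> \<theta> b rs * ((if b \<longleftrightarrow> even (length rs) then \<eta> m else 1) *\<^sub>R \<theta> m)"
  by (induction rs arbitrary: b) (auto simp: mult.assoc)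

lemma signed_product_swap_signs:
  "(\<And>m. \<eta> m * \<eta> m = 1) \<Longrightarrow>
     signed_product \<eta> (\<lambda>m. \<eta> m *\<^sub>R \<theta> m) b rs = signed_product \<eta> \<theta> (\<not> b) rs"
  by (induction rs arbitrary: b) auto

context crossed_triangulation
begin

lemma eta_square: "eta m * eta m = 1"
  by (simp add: eta_def)

text \<open>
  For an increasing list, the same elements in the positive order.
\<close>

fun positive_list :: "nat list \<Rightarrow> nat list" where
  "positive_list [] = []"
| "positive_list (r # rs) = (if center r < k then r # positive_list rs else positive_list rs @ [r])"

lemma set_positive_list: "set (positive_list rs) = set rs"
  by (induction rs) auto

lemma length_positive_list: "length (positive_list rs) = length rs"
  by (induction rs) auto

lemma distinct_positive_list: "distinct rs \<Longrightarrow> distinct (positive_list rs)"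
  by (induction rs) (auto simp: set_positive_list)

lemma pos_greater_iff:
  assumes "1 \<le> r" "r < s" "s \<le> n"
  shows "pos_greater n k j x r s \<longleftrightarrow> center r < k" "pos_greater n k j x s r \<longleftrightarrow> \<not> center r < k"
  using assms lies_on_right_iff[of r] by (auto simp: pos_greater_def)

lemma sorted_positive_list:
  "sorted_wrt (<) rs \<Longrightarrow> set rs \<subseteq> {1..n} \<Longrightarrow> sorted_wrt (pos_greater n k j x) (positive_list rs)"
proof (induction rs)
  case (Cons r rs)
  then have "s \<in> set rs \<Longrightarrow> r < s \<and> s \<le> n" "1 \<le> r" for s by auto
  then have "s \<in> set rs \<Longrightarrow> (pos_greater n k j x r s \<longleftrightarrow> center r < k) \<and> (pos_greater n k j x s r \<longleftrightarrow> \<not> center r < k)" for s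
    using pos_greater_iff by blast
  with Cons show ?case by (auto simp: set_positive_list sorted_wrt_append)
qed simp

lemma pos_product_list:
  assumes "S \<subseteq> {1..n}"
  shows "pos_product n k j x \<theta> S = prod_list (map \<theta> (positive_list (sorted_list_of_set S)))"
proof -
  define ms where "ms = positive_list (sorted_list_of_set S)"
  have fin: "finite S" using assms finite_subset by blast
  have ms: "set ms = S" "distinct ms" "sorted_wrt (pos_greater n k j x) ms"
    using assms fin unfolding ms_def
    by (auto simp: set_positive_list intro!: distinct_positive_list sorted_positive_list)
  have asym: "\<not> pos_greater n k j x b a" if "a \<in> S" "b \<in> S" "pos_greater n k j x a b" for a b
    using that assms pos_greater_iff[of a b] pos_greater_iff[of b a]
    by (cases a b rule: linorder_cases) (auto simp: pos_greater_def)
  have "(THE ms. set ms = S \<and> distinct ms \<and> sorted_wrt (pos_greater n k j x) ms) = ms"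
  proof (rule the_equality)
    show "set ms = S \<and> distinct ms \<and> sorted_wrt (pos_greater n k j x) ms" using ms by blast
    fix ms' assume m': "set ms' = S \<and> distinct ms' \<and> sorted_wrt (pos_greater n k j x) ms'"
    show "ms' = ms"
      by (rule sorted_wrt_unique[of "pos_greater n k j x"]) (use m' ms asym in blast)+
  qed
  then show ?thesis by (simp add: pos_product_def ms_def)
qed

text \<open>
  A variable with a right fan center is moved from the far right to the front, past all later
  variables.  This costs a sign if their number is odd.
\<close>

lemma prod_positive_list:
  assumes "\<And>m. godd (\<theta> m)"
  shows "prod_list (map \<theta> (positive_list rs)) = signed_product eta \<theta> (even (length rs)) rs"
proof (induction rs)
  case (Cons r rs)
  define P where "P = prod_list (map \<theta> (positive_list rs))"
  show ?case
  proof (cases "center r < k")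
    case True
    then show ?thesis using Cons by (simp add: eta_def)
  next
    case False
    then have eta: "eta r = - 1" by (simp add: eta_def)
    have "prod_list (map \<theta> (positive_list (r # rs))) = P * \<theta> r" using False by (simp add: P_def)
    also have "\<dots> = (if even (length rs) then \<theta> r * P else - (\<theta> r * P))"
      using parity_prod_list[of \<theta> "positive_list rs"] assms geven_commute[of P "\<theta> r"] godd_anticommute[of "\<theta> r" P]
      by (auto simp: P_def[symmetric] length_positive_list geven_commute[of P])
    also have "\<dots> = signed_product eta \<theta> (even (length (r # rs))) (r # rs)"
      using Cons eta by (simp add: P_def)
    finally show ?thesis .
  qed
qed simp

text \<open>
  In the product of the weights of disjoint cycles, the variables with the sign \<open>\<eta>\<close> are those that open
  a cycle.
\<close>

definition index_product :: "nat set \<Rightarrow> grassmann" where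
  "index_product S = signed_product eta odd_var True (sorted_list_of_set S)"

lemma index_product_empty [simp]: "index_product {} = 1"
  by (simp add: index_product_def)

lemma index_product_insert:
  assumes "finite S" "\<And>s. s \<in> S \<Longrightarrow> s < m"
  shows "index_product (insert m S) = index_product S * ((if even (card S) then eta m else 1) *\<^sub>R odd_var m)"
proof -
  have fin: "finite (insert m S)" using assms(1) by simp
  have "sorted (sorted_list_of_set S @ [m])"
    using assms by (auto simp: sorted_append intro: less_imp_le)
  moreover have "distinct (sorted_list_of_set S @ [m])" using assms by auto
  moreover have "set (sorted_list_of_set S @ [m]) = set (sorted_list_of_set (insert m S))"
    using assms(1) set_sorted_list_of_set[OF fin] by simp
  ultimately have "sorted_list_of_set (insert m S) = sorted_list_of_set S @ [m]"
    using sorted_distinct_set_unique sorted_list_of_set(2) distinct_sorted_list_of_set by metis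
  then show ?thesis unfolding index_product_def by (simp add: signed_product_snoc)
qed

lemma pos_product_cong:
  assumes "S \<subseteq> {1..n}" "\<And>m. m \<in> S \<Longrightarrow> \<theta> m = \<theta>' m"
  shows "pos_product n k j x \<theta> S = pos_product n k j x \<theta>' S"
proof -
  have "finite S" using assms finite_subset by blast
  then have "map \<theta> (positive_list (sorted_list_of_set S)) = map \<theta>' (positive_list (sorted_list_of_set S))"
    using assms(2) by (simp add: set_positive_list)
  then show ?thesis unfolding pos_product_list[OF assms(1)] by (rule arg_cong)
qed

lemma pos_product_even:
  assumes "S \<subseteq> {1..n}" "even (card S)"
  shows "pos_product n k j x odd_var S = index_product S"
proof -
  have "finite S" using assms finite_subset by blast
  then show ?thesis
    using assms unfolding pos_product_list[OF assms(1)] index_product_def by (subst prod_positive_list) simp_all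
qed

lemma pos_product_odd:
  assumes "S \<subseteq> {1..n}" "odd (card S)"
  shows "pos_product n k j x (\<lambda>m. eta m *\<^sub>R odd_var m) S = index_product S"
proof -
  have "finite S" using assms finite_subset by blast
  then show ?thesis
    using assms unfolding pos_product_list[OF assms(1)] index_product_def
    by (subst prod_positive_list) (simp_all add: signed_product_swap_signs eta_square)
qed

end

section \<open>The super lambda-length of f and the mu-invariant after the flip\<close>

locale realized_triangulation = crossed_triangulation + super_vectors V for V +
  assumes V_ok: "\<And>a b. {a, b} \<in> all_arcs \<Longrightarrow> length_ok V a b"
    and V_det0: "first_mu_ok V"
    and V_det: "\<And>m. 1 \<le> m \<Longrightarrow> m \<le> n - 1 \<Longrightarrow> mu_ok V m"
begin

lemma arc_pos: "{a, b} \<in> all_arcs \<Longrightarrow> w {a, b} > 0"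
  using w_pos by blast

lemma lam_arc: "{a, b} \<in> all_arcs \<Longrightarrow> lam V a b = of_real (w {a, b})"
  using V_ok by (simp add: length_ok_def)

lemma root_arc: "{a, b} \<in> all_arcs \<Longrightarrow> gsqrt (lam V a b) = of_real (sqrt (w {a, b}))"
  using lam_arc arc_pos gsqrt_of_real by simp

definition eps :: "nat set \<Rightarrow> real" where
  "eps t = (if t = tri n k x 1 then - eta 1 else 1)"

lemma eps_tri: "1 \<le> m \<Longrightarrow> m \<le> n \<Longrightarrow> eps (tri n k x m) = (if m = 1 then - eta 1 else 1)"
  using inj_onD[OF tri_inj, of m 1] by (auto simp: eps_def)

lemma mu_tri: "1 \<le> m \<Longrightarrow> m \<le> n \<Longrightarrow> mu D (tri n k x m) = odd_var m"
  using D_default unfolding default_decorated_def by simp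

lemma cw_above: "1 \<le> m \<Longrightarrow> m \<le> n - 1 \<Longrightarrow> cw (lft m) (above m) (rgt m)"
  using above_between unfolding cw_def by simp

lemma cw_below: "1 \<le> m \<Longrightarrow> m \<le> n - 1 \<Longrightarrow> cw (lft m) (rgt m) (below m)"
  using below_outside[of m] diagonal(3,4)[of m] unfolding cw_def by auto

lemma triangle_ok_base:
  assumes "cw a b c" "{a, b} \<in> all_arcs" "{b, c} \<in> all_arcs" "{a, c} \<in> all_arcs"
    and mu: "mu D {a, b, c} = odd_var m"
    and det: "det a b c = (eps {a, b, c} * sqrt (w {a, b} * w {b, c} * w {a, c})) *\<^sub>R odd_var m"
  shows "triangle_ok D eps a b c"
proof -
  have "eps {a, b, c} * eps {a, b, c} = 1" by (simp add: eps_def eta_square)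
  then have "eps {a, b, c} *\<^sub>R det a b c = sqrt (w {a, b} * w {b, c} * w {a, c}) *\<^sub>R odd_var m"
    unfolding det by (simp flip: mult.assoc)
  moreover have "mu D {a, b, c} * (rt a b * (rt b c * rt a c)) = sqrt (w {a, b} * w {b, c} * w {a, c}) *\<^sub>R odd_var m"
    unfolding mu root_arc[OF assms(2)] root_arc[OF assms(3)] root_arc[OF assms(4)]
    by (simp add: real_sqrt_mult of_real_def mult_ac)
  ultimately show ?thesis unfolding triangle_ok_def by simp
qed

text \<open>
  All triangles but the first have the sign \<open>1\<close>.  Across \<open>x m\<close> this means that the orientation depends
  on whether the vertex below \<open>x m\<close> has a larger or a smaller label than the one above, that is, on the
  side of \<open>f\<close> on which the previous diagonal ends at a different vertex.
\<close>

lemma D_compatible: "compatible eps D"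
  unfolding compatible_def arcs_D
proof (intro conjI allI impI)
  show "eps t * eps t = 1" for t by (simp add: eps_def eta_square)
  show "noncrossing (all_arcs)" by (rule noncrossing_arcs)
  show "len D {p, q} = lam V p q" "body (lam V p q) > 0" if "{p, q} \<in> all_arcs \<and> p \<noteq> q" for p q
    using that lam_arc arc_pos D_default unfolding default_decorated_def by auto
next
  fix a b c
  assume "cw a b c \<and> {a, b} \<in> all_arcs \<and> {b, c} \<in> all_arcs \<and> {a, c} \<in> all_arcs"
  then have c: "cw a b c" and arcs: "{a, b} \<in> all_arcs" "{b, c} \<in> all_arcs"
    "{a, c} \<in> all_arcs" by auto
  obtain m where "m \<in> {1..n}" and m3: "{a, b, c} = tri n k x m"
    using triangle_is_tri[OF c arcs] by blast
  then have m: "1 \<le> m" "m \<le> n" "{a, b, c} = tri n k x m" by simp_all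
  have "\<exists>p q r. cw p q r \<and> {p, q, r} = tri n k x m \<and> {p, q} \<in> all_arcs
     \<and> {q, r} \<in> all_arcs \<and> {p, r} \<in> all_arcs \<and> triangle_ok D eps p q r"
  proof (cases "m = 1")
    case True
    have n1: "1 \<le> n - 1" using n2 by simp
    have c0: "cw 0 1 (n + 1)" using n2 by (simp add: cw_def)
    have a0: "{0, 1} \<in> all_arcs" "{1, n + 1} \<in> all_arcs" "{0, n + 1} \<in> all_arcs"
      using boundary_in(1)[of 0] boundary_in(2) T_in[OF order_refl n1] diagonal_first by auto
    have "triangle_ok D eps 0 1 (n + 1)"
      by (rule triangle_ok_base[OF c0 a0, of 1])
        (use V_det0 mu_tri[of 1] tri_first n2 in \<open>simp_all add: first_mu_ok_def eps_def\<close>)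
    then show ?thesis using c0 a0 tri_first True by metis
  next
    case False
    then obtain i where i: "m = Suc i" "1 \<le> i" "i \<le> n - 1" using m by (cases m) auto
    note s = cw_above[OF i(2,3)] side_arcs(1,2)[OF i(2,3)]
    have s3: "{lft i, rgt i} \<in> all_arcs" using T_in[OF i(2,3)] by simp
    have t: "{lft i, above i, rgt i} = tri n k x m" using tri_above[OF i(2,3)] i(1) by simp
    have "eps (tri n k x m) = 1" using eps_tri[OF m(1,2)] False by simp
    then have "triangle_ok D eps (lft i) (above i) (rgt i)"
      by (intro triangle_ok_base[OF s s3, of m])
        (use V_det[OF i(2,3)] mu_tri[OF m(1,2)] t i(1) in \<open>simp_all add: mu_ok_def\<close>)
    then show ?thesis using s s3 t by metis
  qed
  then obtain p q r where pqr: "cw p q r" "{p, q, r} = tri n k x m" "{p, q} \<in> all_arcs"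
     "{q, r} \<in> all_arcs" "{p, r} \<in> all_arcs" "triangle_ok D eps p q r" by blast
  have d: "p \<noteq> q" "p \<noteq> r" "q \<noteq> r" "q \<noteq> p" "r \<noteq> p" "r \<noteq> q" using cw_distinct[OF pqr(1)] by auto
  have pos: "body (lam V p q) > 0" "body (lam V q r) > 0" "body (lam V p r) > 0"
    using lam_arc arc_pos pqr(3-5) by simp_all
  then have pos': "body (lam V q p) > 0" "body (lam V r q) > 0" "body (lam V r p) > 0"
    using lam_sym[OF d(1)] lam_sym[OF d(2)] lam_sym[OF d(3)] by simp_all
  have r1: "triangle_ok D eps q r p" by (rule triangle_ok_rotate[OF pqr(6) d(1,2) pos])
  have r2: "triangle_ok D eps r p q" by (rule triangle_ok_rotate[OF r1 d(3,4) pos(2) pos'(3) pos'(1)])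
  have "{a, b, c} = {p, q, r}" using m(3) pqr(2) by simp
  from cw_same_triple[OF c pqr(1) this] show "triangle_ok D eps a b c" using pqr(6) r1 r2 by blast
next
  fix u v t z
  assume "cw u v t \<and> cw u t z \<and> {{u, t}, {u, v}, {v, t}, {t, z}, {z, u}} \<subseteq> all_arcs"
  then have c: "cw u v t" "cw u t z" and a: "{u, t} \<in> all_arcs" "{u, v} \<in> all_arcs"
    "{v, t} \<in> all_arcs" "{t, z} \<in> all_arcs" "{z, u} \<in> all_arcs" by auto
  have c': "cw t z u" "cw t u v" using c cw_rotate by blast+
  have a': "{t, u} \<in> all_arcs" "{v, u} \<in> all_arcs" "{t, v} \<in> all_arcs"
     "{z, t} \<in> all_arcs" "{u, z} \<in> all_arcs" using a by (simp_all add: insert_commute)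
  have "{u, t} \<notin> boundary_sides"
    using boundary_one_sided[of u t v z] c c' arc_vertices a by blast
  then have "{u, t} \<in> T" using a by simp
  then obtain m where m: "1 \<le> m" "m \<le> n - 1" "{u, t} = {lft m, rgt m}" using T_cases by blast
  note s = side_arcs[OF m(1,2)]
  have cwa: "cw (lft m) (above m) (rgt m)" "cw (rgt m) (below m) (lft m)"
    using cw_above[OF m(1,2)] cw_below[OF m(1,2)] cw_rotate by blast+
  have ta: "eps {lft m, above m, rgt m} = 1" and
    tb: "eps {lft m, rgt m, below m} = (if m = 1 then - eta 1 else 1)"
    using eps_tri[of "Suc m"] eps_tri[of m] tri_above[OF m(1,2)] tri_below[OF m(1,2)] m n2 by simp_all
  have key: "center m < k \<longleftrightarrow> eps {lft m, rgt m, below m} = sg (above m) (below m)"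
  proof (cases rule: below_cases[OF m(1,2)])
    case 1
    then show ?thesis unfolding tb by (simp add: eta_def sg_def)
  next
    case (2 i)
    then have "center m < k" using center_interior[of m] m diagonal(3)[OF m(1,2)] by simp
    then show ?thesis unfolding tb using 2 above_between[OF m(1,2)] by (simp add: sg_def)
  next
    case (3 i)
    then have "\<not> center m < k" using center_interior[of m] m diagonal(4)[OF m(1,2)] by simp
    then show ?thesis unfolding tb using 3 above_between[OF m(1,2)] by (simp add: sg_def)
  qed
  have dir: "dir D u t = default_dir n j x u t"
    using D_default \<open>{u, t} \<in> T\<close> unfolding default_decorated_def by blast
  consider "u = lft m" "t = rgt m" | "u = rgt m" "t = lft m" using m(3) by (auto simp: doubleton_eq_iff)
  then show "dir D u t \<longleftrightarrow> eps {u, v, t} * eps {u, t, z} = sg v z"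
  proof cases
    case 1
    have "v = above m" using noncrossing_apex_unique[OF noncrossing_arcs c(1)[unfolded 1] cwa(1)] a s 1 by simp
    moreover have "z = below m"
      using noncrossing_apex_unique[OF noncrossing_arcs c'(1)[unfolded 1] cwa(2)] a s 1 by (simp add: insert_commute)
    ultimately show ?thesis using dir default_dir_diagonal[OF m(1,2)] key ta 1 by simp
  next
    case 2
    have v: "v = below m" using noncrossing_apex_unique[OF noncrossing_arcs c(1)[unfolded 2] cwa(2)] a s 2 by (simp add: insert_commute)
    moreover have z: "z = above m"
      using noncrossing_apex_unique[OF noncrossing_arcs c'(1)[unfolded 2] cwa(1)] a s 2 by (simp add: insert_commute)
    have "below m \<noteq> above m" using above_between[OF m(1,2)] below_outside[OF m(1,2)] by auto
    then have "sg (below m) (above m) = - sg (above m) (below m)" by (intro sg_flip) simp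
    moreover have "eps {rgt m, below m, lft m} = eps {lft m, rgt m, below m}"
      "eps {rgt m, lft m, above m} = eps {lft m, above m, rgt m}" by (simp_all add: insert_commute)
    moreover have "eps {lft m, rgt m, below m} = 1 \<or> eps {lft m, rgt m, below m} = - 1"
      by (auto simp: eps_def eta_def)
    ultimately show ?thesis using dir default_dir_diagonal[OF m(1,2)] key ta v z 2
      by (auto simp: sg_def split: if_splits)
  qed
qed

text \<open>
  Flipping the crossed diagonals from the bottom produces the fan of \<open>0\<close>.
\<close>

lemma reachable_fan:
  assumes "1 \<le> m" "m \<le> n - 1"
  shows "\<exists>E. move\<^sup>*\<^sup>* D E \<and> (\<forall>i. m \<le> i \<and> i \<le> n - 1 \<longrightarrow> {lft i, rgt i} \<in> arcs E) \<and> boundary_sides \<subseteq> arcs E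
     \<and> {0, lft m} \<in> arcs E \<and> {0, rgt m} \<in> arcs E"
  using assms
proof (induction m rule: dec_induct)
  case base
  show ?case
    using T_in boundary_in(1)[of 0] boundary_in(2) diagonal_first by (intro exI[of _ D]) (auto simp: arcs_D)
next
  case (step m)
  then have m: "1 \<le> m" "m \<le> n - 1" "m < n - 1" by auto
  then obtain E where E: "move\<^sup>*\<^sup>* D E" "\<And>i. m \<le> i \<Longrightarrow> i \<le> n - 1 \<Longrightarrow> {lft i, rgt i} \<in> arcs E"
    "boundary_sides \<subseteq> arcs E" "{0, lft m} \<in> arcs E" "{0, rgt m} \<in> arcs E" using step by auto
  obtain \<epsilon> where comp: "compatible \<epsilon> E" using compatible_moves[OF E(1) D_compatible] by blast
  note dm = diagonal[OF m(1,2)]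
  have c: "cw (lft m) (above m) (rgt m)" "cw (lft m) (rgt m) 0"
    using cw_above[OF m(1,2)] dm by (auto simp: cw_def)
  have side: "{lft m, above m} \<in> arcs E" "{above m, rgt m} \<in> arcs E"
  proof -
    have "{lft m, above m} \<in> arcs E \<and> {above m, rgt m} \<in> arcs E"
    proof (cases rule: above_cases[OF m(1,2)])
      case 1 then show ?thesis using m by simp
    next
      case 2
      then have "{above m, rgt m} \<in> boundary_sides" using boundary_in(1)[of "above m"] dm by simp
      then show ?thesis using E(2)[of "Suc m"] E(3) 2 by auto
    next
      case 3
      then have "{lft m, above m} \<in> boundary_sides" using boundary_in(1)[of "lft m"] dm k_bounds by simp
      then show ?thesis using E(2)[of "Suc m"] E(3) 3 by auto
    qed
    then show "{lft m, above m} \<in> arcs E" "{above m, rgt m} \<in> arcs E" by auto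
  qed
  obtain E' where E': "move E E'" "arcs E' = insert {0, above m} (arcs E - {{lft m, rgt m}})"
    using flip_possible[OF comp c E(2)[OF order_refl m(2)] side] E(4,5) by (auto simp: insert_commute)
  have "{lft i, rgt i} \<noteq> {lft m, rgt m}" if "Suc m \<le> i" "i \<le> n - 1" for i
    using diagonal_strict[of m i] that m dm diagonal[of i] by (auto simp: doubleton_eq_iff)
  then have 1: "{lft i, rgt i} \<in> arcs E'" if "Suc m \<le> i" "i \<le> n - 1" for i
    using E(2)[of i] that E'(2) by auto
  have "{lft m, rgt m} \<notin> boundary_sides"
    using T_in[OF m(1,2)] triangulation unfolding triangulation_def diagonals_def by auto
  then have 2: "boundary_sides \<subseteq> arcs E'" using E(3) E'(2) by auto
  have "{0, lft m} \<in> arcs E'" "{0, rgt m} \<in> arcs E'" "{0, above m} \<in> arcs E'"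
    using E(4,5) E'(2) dm by (auto simp: doubleton_eq_iff)
  then have 3: "{0, lft (Suc m)} \<in> arcs E'" "{0, rgt (Suc m)} \<in> arcs E'"
    by (cases rule: above_cases[OF m(1,2)]; use m in simp)+
  show ?case using E(1) E'(1) 1 2 3 by (intro exI[of _ E']) (auto intro: rtranclp.rtrancl_into_rtrancl)
qed

text \<open>
  Every decoration that can be reached assigns the same length to an arc, namely its bracket.
\<close>

lemma super_length_eq:
  assumes "move\<^sup>*\<^sup>* D E" "{0, b} \<in> arcs E" "0 < b"
  shows "super_length D {0, b} = lam V 0 b"
  unfolding super_length_def
proof (rule the_equality)
  have len: "len E' {0, b} = lam V 0 b" if "move\<^sup>*\<^sup>* D E'" "{0, b} \<in> arcs E'" for E'
    using compatible_moves[OF that(1) D_compatible] compatibleD(3) that(2) assms(3) by blast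
  then show "\<exists>E. move\<^sup>*\<^sup>* D E \<and> {0, b} \<in> arcs E \<and> lam V 0 b = len E {0, b}" using assms by metis
  show "y = lam V 0 b" if "\<exists>E. move\<^sup>*\<^sup>* D E \<and> {0, b} \<in> arcs E \<and> y = len E {0, b}" for y
    using that len by blast
qed

lemma last_quad_cw: "cw j k l" "cw j l 0"
  using diagonal_last k_bounds by (auto simp: cw_def)

lemma last_quad_reachable:
  obtains E where "move\<^sup>*\<^sup>* D E" "{j, l} \<in> arcs E" "{j, k} \<in> arcs E" "{k, l} \<in> arcs E" "{l, 0} \<in> arcs E"
    "{0, j} \<in> arcs E"
proof -
  have n1: "1 \<le> n - 1" using n2 by simp
  obtain E where E: "move\<^sup>*\<^sup>* D E" "{lft (n - 1), rgt (n - 1)} \<in> arcs E" "boundary_sides \<subseteq> arcs E"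
     "{0, lft (n - 1)} \<in> arcs E" "{0, rgt (n - 1)} \<in> arcs E"
    using reachable_fan[OF n1 order_refl] by blast
  have "{j, k} \<in> boundary_sides" "{k, l} \<in> boundary_sides"
    using boundary_in(1)[of "k - 1"] boundary_in(1)[of k] k_bounds diagonal_last by auto
  with E show thesis using diagonal_last that[of E] by (auto simp: insert_commute)
qed

lemma lam_pos_0j: "body (lam V 0 j) > 0" "body (lam V 0 l) > 0" "body (lam V 0 k) > 0"
  and super_length_0j: "super_length D {0, j} = lam V 0 j"
  and super_length_0k: "super_length D {0, k} = lam V 0 k"
proof -
  obtain E where E: "move\<^sup>*\<^sup>* D E" "{j, l} \<in> arcs E" "{j, k} \<in> arcs E" "{k, l} \<in> arcs E" "{l, 0} \<in> arcs E"
    "{0, j} \<in> arcs E" by (rule last_quad_reachable)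
  obtain \<epsilon> where comp: "compatible \<epsilon> E" using compatible_moves[OF E(1) D_compatible] by blast
  have j: "0 < j" "0 < l" using diagonal_last k_bounds by simp_all
  show "super_length D {0, j} = lam V 0 j" by (rule super_length_eq[OF E(1,6) j(1)])
  have E': "{j, 0} \<in> arcs E" "{0, l} \<in> arcs E" using E by (simp_all add: insert_commute)
  obtain E'' where E'': "move E E''" "arcs E'' = insert {0, k} (arcs E - {{j, l}})"
    using flip_possible[OF comp last_quad_cw E(2,3,4,5) E'(1)] by blast
  have r: "move\<^sup>*\<^sup>* D E''" using E(1) E''(1) by simp
  then show "super_length D {0, k} = lam V 0 k" using super_length_eq E''(2) k_bounds by simp
  show "body (lam V 0 j) > 0" "body (lam V 0 l) > 0"
    using compatibleD(4)[OF comp E(6)] compatibleD(4)[OF comp E'(2)] j by simp_all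
  obtain \<epsilon>' where "compatible \<epsilon>' E''" using compatible_moves[OF r D_compatible] by blast
  then show "body (lam V 0 k) > 0" using compatibleD(4)[of \<epsilon>' E'' 0 k] E''(2) k_bounds by simp
qed

lemma det_last: "det j k l = sqrt (w {j, k} * w {k, l} * w {j, l}) *\<^sub>R odd_var n"
proof -
  have "1 \<le> n - 1" "Suc (n - 1) = n" using n2 by simp_all
  then show ?thesis using V_det[of "n - 1"] diagonal_last by (simp add: mu_ok_def above_def)
qed

lemma last_arcs: "{j, k} \<in> all_arcs" "{k, l} \<in> all_arcs" "{j, l} \<in> all_arcs"
  using boundary_in(1)[of "k - 1"] boundary_in(1)[of k] k_bounds diagonal_last T_in[of "n - 1"] n2 by auto

text \<open>
  Requiring that the mu-invariant of the last triangle is \<open>+ \<theta>\<^sub>n\<close> and that the flipped diagonal points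
  from \<open>j\<close> to \<open>l\<close> fixes the signs of both triangles next to it, hence the result.  Reversing these two
  triangles, if necessary, shows that such a decoration can be reached.
\<close>

lemma flipped_mu_eq:
  "flipped_mu n j k l D * (rt j k * (rt k 0 * rt j 0)) = - det j k 0"
proof -
  note pos = arc_pos[OF last_arcs(1)] arc_pos[OF last_arcs(2)] arc_pos[OF last_arcs(3)]
  have d: "j \<noteq> k" "j \<noteq> l" "k \<noteq> l" "j \<noteq> 0" "l \<noteq> 0" "k \<noteq> 0" using diagonal_last k_bounds by auto
  define R where "R = rt j k * (rt k 0 * rt j 0)"
  have "body (lam V k 0) > 0" "body (lam V j 0) > 0" "body (lam V j k) > 0"
    using lam_pos_0j lam_sym[of 0 k] lam_sym[of 0 j] d lam_arc[OF last_arcs(1)] pos by simp_all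
  then have R: "geven R" "body R > 0" unfolding R_def by (auto simp: gsqrt_props)
  have uniq: "y = y'" if "y * R = y' * R" for y y'
    using that mult_left_cancel_grassmann[OF R(1), of y y'] R geven_commute[OF R(1)] by simp
  have sq: "sqrt (w {j, k} * w {k, l} * w {j, l}) \<noteq> 0" using pos by simp
  have roots: "rt j k * (rt k l * rt j l) = of_real (sqrt (w {j, k} * w {k, l} * w {j, l}))"
    unfolding root_arc[OF last_arcs(1)] root_arc[OF last_arcs(2)] root_arc[OF last_arcs(3)]
    by (simp add: real_sqrt_mult mult.assoc)
  \<comment> \<open>The length of the three sides and \<open>\<theta>\<^sub>n\<close> are fixed, so the mu-invariant shows the sign of the triangle.\<close>
  have sign: "mu E {j, k, l} = odd_var n \<longleftrightarrow> \<epsilon> {j, k, l} = 1"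
    if "compatible \<epsilon> E" "{j, k} \<in> arcs E" "{k, l} \<in> arcs E" "{j, l} \<in> arcs E" for \<epsilon> E
  proof -
    have "mu E {j, k, l} * (rt j k * (rt k l * rt j l)) = \<epsilon> {j, k, l} *\<^sub>R det j k l"
      using compatibleD(5)[OF that(1) last_quad_cw(1) that(2,3,4)] unfolding triangle_ok_def .
    then have "sqrt (w {j, k} * w {k, l} * w {j, l}) *\<^sub>R mu E {j, k, l}
       = sqrt (w {j, k} * w {k, l} * w {j, l}) *\<^sub>R (\<epsilon> {j, k, l} *\<^sub>R odd_var n)"
      unfolding roots det_last by (simp add: of_real_def mult.commute)
    from scaleR_left_imp_eq[OF sq this] have mu: "mu E {j, k, l} = \<epsilon> {j, k, l} *\<^sub>R odd_var n" .
    show ?thesis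
    proof
      assume "mu E {j, k, l} = odd_var n"
      then have "coeff (odd_var n) {n} = coeff (\<epsilon> {j, k, l} *\<^sub>R odd_var n) {n}" using mu by simp
      then show "\<epsilon> {j, k, l} = 1" by (simp add: coeff_odd_var)
    qed (simp add: mu)
  qed
  have determined: "y * R = - det j k 0"
    if "move\<^sup>*\<^sup>* D E" "mu E {j, k, l} = odd_var n" "flip j k l 0 E E'" "y = mu E' {0, j, k}" for y E E'
  proof -
    note hyp = that
    obtain \<epsilon> where comp: "compatible \<epsilon> E" using compatible_moves[OF hyp(1) D_compatible] by blast
    have arcs: "{j, l} \<in> arcs E" "{j, k} \<in> arcs E" "{k, l} \<in> arcs E" "{l, 0} \<in> arcs E" "{0, j} \<in> arcs E"
      using hyp(3) unfolding flip_def by simp_all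
    then have e: "\<epsilon> {j, k, l} = 1" using sign[OF comp] hyp(2) by simp
    obtain \<epsilon>' where c': "compatible \<epsilon>' E'" "\<epsilon>' {j, k, 0} = \<epsilon> {j, k, l} * sg l 0"
      using compatible_flip[OF comp hyp(3)] by blast
    have "\<exists>dr ln m. E' = \<lparr>arcs = insert {0, k} (arcs E - {{j, l}}), dir = dr, len = ln, mu = m\<rparr>"
      using hyp(3) unfolding flip_def Let_def by blast
    then obtain dr ln m where "E' = \<lparr>arcs = insert {0, k} (arcs E - {{j, l}}), dir = dr, len = ln, mu = m\<rparr>"
      by blast
    then have "arcs E' = insert {0, k} (arcs E - {{j, l}})" by (simp only: decorated.simps)
    then have a': "{j, k} \<in> arcs E'" "{k, 0} \<in> arcs E'" "{j, 0} \<in> arcs E'"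
      using arcs d by (auto simp: doubleton_eq_iff insert_commute)
    have "cw j k 0" using cw_four[OF last_quad_cw] by blast
    then have "mu E' {j, k, 0} * R = \<epsilon>' {j, k, 0} *\<^sub>R det j k 0"
      using compatibleD(5)[OF c'(1) _ a'] unfolding triangle_ok_def R_def by blast
    moreover have "{0, j, k} = {j, k, 0}" by auto
    ultimately show ?thesis using hyp(4) c'(2) e by (simp add: sg_def)
  qed
  have exist: "\<exists>y E E'. move\<^sup>*\<^sup>* D E \<and> mu E {j, k, l} = odd_var n \<and> flip j k l 0 E E' \<and> y = mu E' {0, j, k}"
  proof -
    obtain E where E: "move\<^sup>*\<^sup>* D E" "{j, l} \<in> arcs E" "{j, k} \<in> arcs E" "{k, l} \<in> arcs E" "{l, 0} \<in> arcs E"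
      "{0, j} \<in> arcs E" by (rule last_quad_reachable)
    obtain \<epsilon> where comp: "compatible \<epsilon> E" using compatible_moves[OF E(1) D_compatible] by blast
    have adjust: "\<exists>\<epsilon>' E'. move\<^sup>*\<^sup>* D E' \<and> arcs E' = arcs E \<and> compatible \<epsilon>' E' \<and> \<epsilon>' t = c
        \<and> (\<forall>t'. t' \<noteq> t \<longrightarrow> \<epsilon>' t' = \<epsilon>0 t')"
      if "is_triangle E0 t" "move\<^sup>*\<^sup>* D E0" "arcs E0 = arcs E" "compatible \<epsilon>0 E0" "c = 1 \<or> c = - 1" for t c E0 \<epsilon>0
    proof (cases "\<epsilon>0 t = c")
      case True then show ?thesis using that by blast
    next
      case False
      have "\<epsilon>0 t = 1 \<or> \<epsilon>0 t = - 1" using compatibleD(1)[OF that(4), of t] by (simp add: square_eq_1_iff)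
      then have "- \<epsilon>0 t = c" using False that(5) by auto
      moreover have "move E0 (reverse_triangles {t} E0)" using that(1) unfolding move_def by blast
      then have "move\<^sup>*\<^sup>* D (reverse_triangles {t} E0)" using that(2) by simp
      moreover have "arcs (reverse_triangles {t} E0) = arcs E" using that(3) by (simp add: reverse_triangles_def)
      ultimately show ?thesis using compatible_reverse[OF that(4,1)]
        by (intro exI[of _ "\<epsilon>0(t := - \<epsilon>0 t)"] exI[of _ "reverse_triangles {t} E0"]) simp
    qed
    have t1: "is_triangle E1 {j, k, l}" and t2: "is_triangle E1 {j, l, 0}" if "arcs E1 = arcs E" for E1
      using E d that unfolding is_triangle_def by (auto simp: insert_commute)
    \<comment> \<open>With these two signs the rule for orientations makes \<open>{j, l}\<close> point from \<open>j\<close> to \<open>l\<close>.\<close>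
    obtain \<epsilon>1 E1 where 1: "move\<^sup>*\<^sup>* D E1" "arcs E1 = arcs E" "compatible \<epsilon>1 E1" "\<epsilon>1 {j, k, l} = 1"
      using adjust[OF t1 E(1) _ comp, of 1] by blast
    obtain \<epsilon>2 E2 where 2: "move\<^sup>*\<^sup>* D E2" "arcs E2 = arcs E" "compatible \<epsilon>2 E2" "\<epsilon>2 {j, l, 0} = - 1"
      and keep: "\<And>t'. t' \<noteq> {j, l, 0} \<Longrightarrow> \<epsilon>2 t' = \<epsilon>1 t'"
      using adjust[OF t2 1(1,2,3), of "- 1"] 1(2) by blast
    have "{j, k, l} \<noteq> {j, l, 0}" using d by auto
    then have e1: "\<epsilon>2 {j, k, l} = 1" using keep 1(4) by simp
    then have "mu E2 {j, k, l} = odd_var n" using sign[OF 2(3)] E 2(2) by simp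
    moreover have arcs: "{j, l} \<in> arcs E2" "{j, k} \<in> arcs E2" "{k, l} \<in> arcs E2" "{l, 0} \<in> arcs E2" "{j, 0} \<in> arcs E2"
      using E 2(2) by (simp_all add: insert_commute)
    have "dir E2 j l" using compatibleD(6)[OF 2(3) last_quad_cw arcs] e1 2(4) by (simp add: sg_def)
    moreover have "{{j, l}, {j, k}, {k, l}, {l, 0}, {0, j}} \<subseteq> arcs E2" using E 2(2) by simp
    ultimately show ?thesis using 2(1) flip_exists[OF last_quad_cw] by metis
  qed
  obtain y where y: "\<exists>E E'. move\<^sup>*\<^sup>* D E \<and> mu E {j, k, l} = odd_var n \<and> flip j k l 0 E E' \<and> y = mu E' {0, j, k}"
    using exist by blast
  then have yR: "y * R = - det j k 0" using determined by blast
  have "flipped_mu n j k l D = y"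
    unfolding flipped_mu_def
  proof (rule the_equality)
    show "\<exists>E E'. move\<^sup>*\<^sup>* D E \<and> mu E {j, k, l} = odd_var n \<and> flip j k l 0 E E' \<and> y = mu E' {0, j, k}" by (rule y)
    fix y' assume "\<exists>E E'. move\<^sup>*\<^sup>* D E \<and> mu E {j, k, l} = odd_var n \<and> flip j k l 0 E E' \<and> y' = mu E' {0, j, k}"
    then have "y' * R = - det j k 0" using determined by blast
    then have "y' * R = y * R" using yR by (rule trans[OF _ sym])
    then show "y' = y" by (rule uniq)
  qed
  with yR have "flipped_mu n j k l D * R = - det j k 0" by simp
  then show ?thesis by (simp add: R_def)
qed

end

section \<open>Double dimer covers of a graph grown by a tile\<close>

definition covers :: "'v set set \<Rightarrow> 'v set multiset set" where
  "covers E = {M. set_mset M \<subseteq> E \<and> (\<forall>v\<in>\<Union>E. size {#g \<in># M. v \<in> g#} = 2)}"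

lemma size_filter_count:
  assumes "finite E" "set_mset M \<subseteq> E"
  shows "size (filter_mset P M) = (\<Sum>g\<in>{g \<in> E. P g}. count M g)"
proof -
  have "size (filter_mset P M) = (\<Sum>g\<in>set_mset (filter_mset P M). count (filter_mset P M) g)"
    by (simp add: size_multiset_overloaded_eq)
  also have "\<dots> = (\<Sum>g\<in>{g \<in> E. P g}. count (filter_mset P M) g)"
    by (rule sum.mono_neutral_left) (use assms in \<open>auto simp: count_eq_zero_iff\<close>)
  also have "\<dots> = (\<Sum>g\<in>{g \<in> E. P g}. count M g)" by (rule sum.cong) auto
  finally show ?thesis .
qed

lemma covers_count_le:
  assumes "M \<in> covers E" "g \<in> E" "g \<noteq> {}"
  shows "count M g \<le> 2"
proof -
  obtain v where "v \<in> g" using assms(3) by blast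
  then have "count M g \<le> size {#g \<in># M. v \<in> g#}"
    using count_le_size[of "{#g \<in># M. v \<in> g#}" g] by simp
  then show ?thesis using assms \<open>v \<in> g\<close> unfolding covers_def by fastforce
qed

text \<open>
  A tile is attached along the edge \<open>{u1, u2}\<close>; its other two vertices \<open>f1\<close>, \<open>f2\<close> are new.
\<close>

locale tile_attachment =
  fixes E :: "'v set set" and u1 u2 f1 f2 :: 'v
  assumes fin: "finite E" and g_in: "{u1, u2} \<in> E" and u: "u1 \<noteq> u2"
    and f: "f1 \<notin> \<Union>E" "f2 \<notin> \<Union>E" "f1 \<noteq> f2"
begin

abbreviation "g \<equiv> {u1, u2}"
abbreviation "s1 \<equiv> {u1, f1}"
abbreviation "s2 \<equiv> {u2, f2}"
abbreviation "far \<equiv> {f1, f2}"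

definition E' where "E' = E \<union> {s1, s2, far}"

text \<open>
  Moving \<open>h\<close> copies of the common edge to the two adjacent sides of the tile keeps the degrees at its
  ends; the far edge completes the degrees of the new vertices.
\<close>

definition attach :: "'v set multiset \<Rightarrow> nat \<Rightarrow> 'v set multiset" where
  "attach M h = (M - replicate_mset h g) + replicate_mset h s1 + replicate_mset h s2 + replicate_mset (2 - h) far"

lemma ends: "u1 \<in> \<Union>E" "u2 \<in> \<Union>E" "u1 \<noteq> f1" "u1 \<noteq> f2" "u2 \<noteq> f1" "u2 \<noteq> f2"
  using g_in f by auto

lemma edges_distinct: "s1 \<noteq> s2" "s1 \<noteq> far" "s2 \<noteq> far" "s1 \<noteq> g" "s2 \<noteq> g" "far \<noteq> g"
  using f ends u by (auto simp: doubleton_eq_iff)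

lemma edges_fresh: "s1 \<notin> E" "s2 \<notin> E" "far \<notin> E"
  using f by auto

lemmas new_edges = edges_fresh edges_distinct

lemma finite_E': "finite E'"
  using fin by (simp add: E'_def)

lemma edges_at: "{e \<in> E'. f1 \<in> e} = {s1, far}" "{e \<in> E'. f2 \<in> e} = {s2, far}"
  using f ends unfolding E'_def by auto

lemma count_attach:
  assumes "set_mset M \<subseteq> E"
  shows "count (attach M h) s1 = h" "count (attach M h) s2 = h" "count (attach M h) far = 2 - h"
    and "count (attach M h) g = count M g - h"
    and "e \<in> E \<Longrightarrow> e \<noteq> g \<Longrightarrow> count (attach M h) e = count M e"
proof -
  have "count M s1 = 0" "count M s2 = 0" "count M far = 0"
    using assms new_edges by (meson not_in_iff subsetD)+
  then show "count (attach M h) s1 = h" "count (attach M h) s2 = h" "count (attach M h) far = 2 - h"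
    "count (attach M h) g = count M g - h"
    using edges_distinct edges_distinct[THEN not_sym] by (simp_all add: attach_def)
  assume "e \<in> E" "e \<noteq> g"
  then have "e \<noteq> s1" "e \<noteq> s2" "e \<noteq> far" "e \<noteq> g" using edges_fresh by metis+
  then show "count (attach M h) e = count M e" by (simp add: attach_def)
qed

lemma degree_attach:
  assumes "set_mset M \<subseteq> E" "h \<le> count M g" "h \<le> 2"
  shows "v \<in> \<Union>E \<Longrightarrow> size {#e \<in># attach M h. v \<in> e#} = size {#e \<in># M. v \<in> e#}"
    and "size {#e \<in># attach M h. f1 \<in> e#} = 2" "size {#e \<in># attach M h. f2 \<in> e#} = 2"
proof -
  have sub: "replicate_mset h g \<subseteq># M" using assms by (simp add: count_le_replicate_mset_subset_eq)
  have deg: "size {#e \<in># attach M h. v \<in> e#}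
     = size {#e \<in># M. v \<in> e#} - (if v \<in> g then h else 0) + (if v \<in> s1 then h else 0)
       + (if v \<in> s2 then h else 0) + (if v \<in> far then 2 - h else 0)" for v
  proof -
    have "size {#e \<in># M - replicate_mset h g. v \<in> e#}
        = size {#e \<in># M. v \<in> e#} - size {#e \<in># replicate_mset h g. v \<in> e#}"
      using sub by (simp add: filter_diff_mset size_Diff_submset multiset_filter_mono)
    moreover have "size {#e \<in># replicate_mset h X. v \<in> e#} = (if v \<in> X then h else 0)" for h X
      by (induction h) auto
    ultimately show ?thesis unfolding attach_def by simp
  qed
  show "size {#e \<in># attach M h. v \<in> e#} = size {#e \<in># M. v \<in> e#}" if v: "v \<in> \<Union>E" for v
  proof -
    have "v \<noteq> f1" "v \<noteq> f2" using v f by auto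
    moreover have "v \<in> g \<Longrightarrow> h \<le> size {#e \<in># M. v \<in> e#}"
      using count_le_size[of "{#e \<in># M. v \<in> e#}" g] assms(2) by simp
    ultimately show ?thesis unfolding deg using u ends by auto
  qed
  have "size {#e \<in># M. f1 \<in> e#} = 0" "size {#e \<in># M. f2 \<in> e#} = 0"
  proof -
    have "f1 \<notin> e" "f2 \<notin> e" if "e \<in># M" for e using that assms(1) f(1,2) by blast+
    then have "{#e \<in># M. f1 \<in> e#} = {#e \<in># M. False#}" "{#e \<in># M. f2 \<in> e#} = {#e \<in># M. False#}"
      by (blast intro: filter_mset_cong[OF refl])+
    then show "size {#e \<in># M. f1 \<in> e#} = 0" "size {#e \<in># M. f2 \<in> e#} = 0" by simp_all
  qed
  then show "size {#e \<in># attach M h. f1 \<in> e#} = 2" "size {#e \<in># attach M h. f2 \<in> e#} = 2"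
    unfolding deg using u ends f(3) assms(3) by auto
qed

lemma attach_in_covers:
  assumes "M \<in> covers E" "h \<le> count M g"
  shows "attach M h \<in> covers E'"
proof -
  have M: "set_mset M \<subseteq> E" using assms(1) by (simp add: covers_def)
  have h: "h \<le> 2" using covers_count_le[OF assms(1) g_in] assms(2) by simp
  have "set_mset (attach M h) \<subseteq> E'"
  proof
    fix e assume "e \<in># attach M h"
    then have "e \<in># M \<or> e \<in> {s1, s2, far}"
      unfolding attach_def by (auto dest: in_diffD split: if_splits)
    then show "e \<in> E'" using M unfolding E'_def by auto
  qed
  moreover have "size {#e \<in># attach M h. v \<in> e#} = 2" if "v \<in> \<Union>E'" for v
  proof (cases "v \<in> \<Union>E")
    case True
    moreover have "size {#e \<in># M. v \<in> e#} = 2" using assms(1) True unfolding covers_def by blast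
    ultimately show ?thesis using degree_attach(1)[OF M assms(2) h] by simp
  next
    case False
    then have "v = f1 \<or> v = f2" using that ends unfolding E'_def by auto
    then show ?thesis using degree_attach(2,3)[OF M assms(2) h] by auto
  qed
  ultimately show ?thesis unfolding covers_def by blast
qed

text \<open>
  The degrees of the two new vertices show that both sides of the tile occur equally often.
\<close>

lemma covers_E'_detach:
  assumes "M' \<in> covers E'"
  obtains M h where "M \<in> covers E" "h \<le> count M g" "M' = attach M h"
proof -
  have sub: "set_mset M' \<subseteq> E'" and deg: "\<And>v. v \<in> \<Union>E' \<Longrightarrow> size {#e \<in># M'. v \<in> e#} = 2"
    using assms by (auto simp: covers_def)
  define h where "h = count M' s1"
  have "f1 \<in> \<Union>E'" "f2 \<in> \<Union>E'" unfolding E'_def by auto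
  then have "count M' s1 + count M' far = 2" "count M' s2 + count M' far = 2"
    using deg[of f1] deg[of f2] new_edges size_filter_count[OF finite_E' sub] edges_at by simp_all
  then have c: "count M' far = 2 - h" "count M' s2 = h" "h \<le> 2" by (auto simp: h_def)
  \<comment> \<open>The \<open>h\<close> copies of the two sides came from the common edge, and are put back there.\<close>
  define M where "M = filter_mset (\<lambda>e. e \<in> E) M' + replicate_mset h g"
  have M: "set_mset M \<subseteq> E" using g_in by (auto simp: M_def split: if_splits)
  have hM: "h \<le> count M g" by (simp add: M_def)
  have eq: "M' = attach M h"
  proof (rule multiset_eqI)
    fix e
    consider "e \<notin> E'" | "e = g" | "e \<in> E" "e \<noteq> g" | "e = s1" | "e = s2" | "e = far"
      unfolding E'_def by blast
    then show "count M' e = count (attach M h) e"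
    proof cases
      case 1
      then have "e \<noteq> g" "e \<noteq> s1" "e \<noteq> s2" "e \<noteq> far" "e \<notin># M" "e \<notin># M'"
        using sub M g_in unfolding E'_def by auto
      then show ?thesis by (simp add: attach_def not_in_iff)
    next
      case 2
      have "count M g - h = count M' g" using g_in by (simp add: M_def)
      then show ?thesis unfolding 2 count_attach(4)[OF M] by simp
    next
      case 3
      have "count M e = count M' e" using 3 by (simp add: M_def)
      then show ?thesis using count_attach(5)[OF M 3] by simp
    next
      case 4 then show ?thesis using count_attach(1)[OF M] by (simp add: h_def)
    next
      case 5 then show ?thesis using count_attach(2)[OF M] c by simp
    next
      case 6 then show ?thesis using count_attach(3)[OF M] c by simp
    qed
  qed
  have "size {#e \<in># M. v \<in> e#} = 2" if "v \<in> \<Union>E" for v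
    using degree_attach(1)[OF M hM c(3) that] deg[of v] that unfolding eq E'_def by auto
  then have "M \<in> covers E" using M unfolding covers_def by blast
  then show thesis using hM eq by (rule that)
qed

lemma attach_inj:
  assumes "set_mset M \<subseteq> E" "set_mset M' \<subseteq> E" "h \<le> count M g" "h' \<le> count M' g" "attach M h = attach M' h'"
  shows "M = M' \<and> h = h'"
proof -
  have h: "h = h'" using count_attach(1)[OF assms(1), of h] count_attach(1)[OF assms(2), of h'] assms(5) by simp
  have "count M e = count M' e" for e
  proof -
    consider "e \<notin> E" | "e = g" | "e \<in> E" "e \<noteq> g" by blast
    then show ?thesis
    proof cases
      case 1 then show ?thesis using assms(1,2) by (metis count_eq_zero_iff subsetD)
    next
      case 2
      have "count M g - h = count M' g - h"
        using count_attach(4)[OF assms(1), of h] count_attach(4)[OF assms(2), of h'] assms(5) h by simp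
      then show ?thesis using 2 assms(3,4) h by simp
    next
      case 3
      then show ?thesis
        using count_attach(5)[OF assms(1), of e h] count_attach(5)[OF assms(2), of e h'] assms(5) by simp
    qed
  qed
  then show ?thesis using h by (simp add: multiset_eq_iff)
qed

lemma bij_attach: "bij_betw (\<lambda>(M, h). attach M h) (SIGMA M:covers E. {..count M g}) (covers E')"
  unfolding bij_betw_def
proof
  show "inj_on (\<lambda>(M, h). attach M h) (SIGMA M:covers E. {..count M g})"
    using attach_inj by (auto simp: inj_on_def covers_def)
  show "(\<lambda>(M, h). attach M h) ` (SIGMA M:covers E. {..count M g}) = covers E'"
  proof (intro subset_antisym subsetI)
    fix M' assume "M' \<in> (\<lambda>(M, h). attach M h) ` (SIGMA M:covers E. {..count M g})"
    then obtain M h where "M \<in> covers E" "h \<le> count M g" "M' = attach M h" by (elim imageE) auto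
    then show "M' \<in> covers E'" using attach_in_covers by simp
  next
    fix M' assume "M' \<in> covers E'"
    then obtain M h where "M \<in> covers E" "h \<le> count M g" "M' = attach M h" by (rule covers_E'_detach)
    then show "M' \<in> (\<lambda>(M, h). attach M h) ` (SIGMA M:covers E. {..count M g})"
      by (intro image_eqI[of _ _ "(M, h)"]) simp_all
  qed
qed

lemma finite_covers_E': "finite (covers E) \<Longrightarrow> finite (covers E')"
  using bij_betw_finite[OF bij_attach] by auto

lemma sum_covers_E':
  fixes F :: "'v set multiset \<Rightarrow> 'b::comm_monoid_add"
  assumes "finite (covers E)"
  shows "sum F (covers E') = (\<Sum>M\<in>covers E. \<Sum>h\<le>count M g. F (attach M h))"
proof -
  have "sum F (covers E') = (\<Sum>p\<in>(SIGMA M:covers E. {..count M g}). F (case p of (M, h) \<Rightarrow> attach M h))"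
    using sum.reindex_bij_betw[OF bij_attach, of F] by simp
  also have "\<dots> = (\<Sum>M\<in>covers E. \<Sum>h\<le>count M g. F (attach M h))"
    using assms by (simp add: sum.Sigma case_prod_unfold)
  finally show ?thesis .
qed

lemma prod_attach:
  fixes W :: "'v set \<Rightarrow> real"
  assumes "h \<le> count M g" "W g \<noteq> 0"
  shows "(\<Prod>e\<in>#attach M h. W e) = (\<Prod>e\<in>#M. W e) / W g ^ h * (W s1 * W s2) ^ h * W far ^ (2 - h)"
proof -
  have "M = (M - replicate_mset h g) + replicate_mset h g"
    using assms(1) by (simp add: count_le_replicate_mset_subset_eq)
  then have "(\<Prod>e\<in>#M. W e) = (\<Prod>e\<in>#(M - replicate_mset h g) + replicate_mset h g. W e)" by (rule arg_cong)
  also have "\<dots> = (\<Prod>e\<in>#M - replicate_mset h g. W e) * W g ^ h" by simp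
  finally show ?thesis using assms(2) by (simp add: attach_def power_mult_distrib field_simps)
qed

end

section \<open>Double dimer covers of a snake graph\<close>

context
  fixes n k :: nat and x :: "nat \<Rightarrow> nat set"
begin

abbreviation "edge \<equiv> tile_edge n k x"

definition horizontal :: "nat \<Rightarrow> bool" where
  "horizontal N \<longleftrightarrow> N = 0 \<or> third_side n k x N = tile_label n k x N Right"

text \<open>
  The edge along which tile \<open>N + 1\<close> is attached.  For \<open>N = 0\<close> it is the left edge of the first tile, as if
  the graph had grown from this single edge.
\<close>

definition glue :: "nat \<Rightarrow> (nat \<times> nat) set" where
  "glue N = edge (Suc N) (if horizontal N then Left else Bottom)"

text \<open>
  The edge of the new tile opposite to the glued one, and the two adjacent ones; the next tile can
  only be attached to the far edge or to the side edge.
\<close>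

definition far_edge :: "nat \<Rightarrow> (nat \<times> nat) set" where
  "far_edge N = edge (Suc N) (if horizontal N then Right else Top)"

definition side_edge :: "nat \<Rightarrow> (nat \<times> nat) set" where
  "side_edge N = edge (Suc N) (if horizontal N then Top else Right)"

definition back_edge :: "nat \<Rightarrow> (nat \<times> nat) set" where
  "back_edge N = edge (Suc N) (if horizontal N then Bottom else Left)"

definition snake :: "nat \<Rightarrow> (nat \<times> nat) set set" where
  "snake N = insert (glue 0) (\<Union>m\<in>{1..N}. range (edge m))"

lemma range_edge: "range (edge m) = {edge m Left, edge m Bottom, edge m Top, edge m Right}"
proof -
  have U: "(UNIV :: side set) = {Left, Bottom, Top, Right}" using side.exhaust by blast
  show ?thesis unfolding U image_insert image_empty ..
qed

lemma range_edge_Suc: "range (edge (Suc N)) = {glue N, far_edge N, side_edge N, back_edge N}"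
  unfolding range_edge glue_def far_edge_def side_edge_def back_edge_def by auto

lemma tile_pos_Suc:
  "N \<ge> 1 \<Longrightarrow> tile_pos n k x (Suc N) = (if horizontal N
     then (Suc (fst (tile_pos n k x N)), snd (tile_pos n k x N))
     else (fst (tile_pos n k x N), Suc (snd (tile_pos n k x N))))"
  by (simp add: horizontal_def split: prod.split)

lemma glue_Suc: "glue (Suc N) = edge (Suc N) (if horizontal (Suc N) then Right else Top)"
  using tile_pos_Suc[of "Suc N"]
  by (auto simp: glue_def tile_edge_def split: prod.split simp del: tile_pos.simps)

lemma glue_Suc_cases: "glue (Suc N) = far_edge N \<or> glue (Suc N) = side_edge N"
  unfolding glue_Suc far_edge_def side_edge_def by auto

lemma tile_pos_mono:
  assumes "1 \<le> m" "m \<le> N"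
  shows "fst (tile_pos n k x m) \<le> fst (tile_pos n k x N) \<and> snd (tile_pos n k x m) \<le> snd (tile_pos n k x N)"
  using assms(2,1)
proof (induction N rule: dec_induct)
  case (step N)
  then show ?case using tile_pos_Suc[of N] by (auto simp del: tile_pos.simps)
qed simp

lemma vertex_bound:
  assumes "g \<in> range (edge m)" "v \<in> g" "1 \<le> m" "m \<le> N"
  shows "fst v \<le> Suc (fst (tile_pos n k x N)) \<and> snd v \<le> Suc (snd (tile_pos n k x N))"
proof -
  obtain a b where ab: "tile_pos n k x m = (a, b)" by (metis surj_pair)
  then have "a \<le> fst (tile_pos n k x N)" "b \<le> snd (tile_pos n k x N)" using tile_pos_mono[OF assms(3,4)] by auto
  then show ?thesis using assms(1,2) ab unfolding range_edge by (auto simp: tile_edge_def)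
qed

definition near_corner1 where "near_corner1 N = (case tile_pos n k x (Suc N) of (a, b) \<Rightarrow> if horizontal N then (a, Suc b) else (Suc a, b))"
definition near_corner2 where "near_corner2 N = tile_pos n k x (Suc N)"
definition far_corner1 where "far_corner1 N = (case tile_pos n k x (Suc N) of (a, b) \<Rightarrow> (Suc a, Suc b))"
definition far_corner2 where "far_corner2 N = (case tile_pos n k x (Suc N) of (a, b) \<Rightarrow> if horizontal N then (Suc a, b) else (a, Suc b))"

lemma tile_edges:
  "glue N = {near_corner1 N, near_corner2 N}" "side_edge N = {near_corner1 N, far_corner1 N}"
  "back_edge N = {near_corner2 N, far_corner2 N}" "far_edge N = {far_corner1 N, far_corner2 N}"
  by (auto simp: glue_def side_edge_def back_edge_def far_edge_def near_corner1_def near_corner2_def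
      far_corner1_def far_corner2_def tile_edge_def split: prod.split simp del: tile_pos.simps)

lemma corners_distinct: "near_corner1 N \<noteq> near_corner2 N" "far_corner1 N \<noteq> far_corner2 N"
  by (auto simp: near_corner1_def near_corner2_def far_corner1_def far_corner2_def split: prod.split simp del: tile_pos.simps)

lemma snake_Suc: "snake (Suc N) = snake N \<union> {side_edge N, back_edge N, far_edge N}" "glue N \<in> snake N"
proof -
  show gl: "glue N \<in> snake N"
  proof (cases N)
    case (Suc i)
    then have "glue N \<in> range (edge N)" using glue_Suc[of i] by simp
    moreover have "N \<in> {1..N}" using Suc by simp
    ultimately show ?thesis unfolding snake_def by blast
  qed (simp add: snake_def)
  have ins: "{1..Suc N} = insert (Suc N) {1..N}" by auto
  have "snake (Suc N) = snake N \<union> range (edge (Suc N))"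
    unfolding snake_def ins UN_insert by (simp only: Un_insert_left Un_insert_right Un_commute)
  also have "\<dots> = snake N \<union> {side_edge N, back_edge N, far_edge N}"
  proof -
    have "A \<union> {a, b, c, d} = A \<union> {c, d, b}" if "a \<in> A" for a b c d :: "'z" and A using that by blast
    from this[OF gl] show ?thesis unfolding range_edge_Suc .
  qed
  finally show "snake (Suc N) = snake N \<union> {side_edge N, back_edge N, far_edge N}" .
qed

lemma snake_eq:
  assumes "N \<ge> 1"
  shows "snake N = (\<Union>m\<in>{1..N}. range (edge m))"
proof -
  have "glue 0 \<in> range (edge 1)" by (simp add: glue_def)
  moreover have "1 \<in> {1..N}" using assms by simp
  ultimately show ?thesis unfolding snake_def by blast
qed

text \<open>
  The tiles move to the right or upwards, so the new corners exceed all earlier ones in one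
  coordinate.
\<close>

lemma far_corners_fresh: "far_corner1 N \<notin> \<Union>(snake N)" "far_corner2 N \<notin> \<Union>(snake N)"
proof -
  have "far_corner1 N \<notin> \<Union>(snake N) \<and> far_corner2 N \<notin> \<Union>(snake N)"
  proof (cases N)
    case 0
    then show ?thesis
      by (auto simp: snake_def glue_def horizontal_def tile_edge_def far_corner1_def far_corner2_def)
  next
    case (Suc i)
    obtain a b where ab: "tile_pos n k x N = (a, b)" by (metis surj_pair)
    have bound: "fst v \<le> Suc a \<and> snd v \<le> Suc b" if v: "v \<in> \<Union>(snake N)" for v
    proof -
      have "1 \<le> N" using Suc by simp
      then obtain m g where "m \<in> {1..N}" "g \<in> range (edge m)" "v \<in> g"
        using v unfolding snake_eq[OF \<open>1 \<le> N\<close>] by blast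
      then show ?thesis using vertex_bound[of g m v N] ab by simp
    qed
    have "tile_pos n k x (Suc N) = (if horizontal N then (Suc a, b) else (a, Suc b))"
      using tile_pos_Suc[of N] ab Suc by simp
    then have "\<not> (fst (far_corner1 N) \<le> Suc a \<and> snd (far_corner1 N) \<le> Suc b)"
      "\<not> (fst (far_corner2 N) \<le> Suc a \<and> snd (far_corner2 N) \<le> Suc b)"
      unfolding far_corner1_def far_corner2_def by (auto simp del: tile_pos.simps)
    then show ?thesis using bound by blast
  qed
  then show "far_corner1 N \<notin> \<Union>(snake N)" "far_corner2 N \<notin> \<Union>(snake N)" by auto
qed

lemma finite_snake: "finite (snake N)"
  unfolding snake_def range_edge by simp

interpretation att: tile_attachment "snake N" "near_corner1 N" "near_corner2 N" "far_corner1 N" "far_corner2 N" for N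
  by unfold_locales (use finite_snake snake_Suc(2) tile_edges(1) corners_distinct far_corners_fresh in simp_all)

abbreviation "attach_tile N \<equiv> tile_attachment.attach (near_corner1 N) (near_corner2 N) (far_corner1 N) (far_corner2 N)"

lemma snake_Suc': "att.E' N = snake (Suc N)"
  unfolding att.E'_def snake_Suc tile_edges by auto

lemma new_tile_edges:
  "side_edge N \<notin> snake N" "back_edge N \<notin> snake N" "far_edge N \<notin> snake N" "side_edge N \<noteq> far_edge N"
  "side_edge N \<noteq> glue N" "back_edge N \<noteq> glue N" "far_edge N \<noteq> glue N" "side_edge N \<noteq> back_edge N" "back_edge N \<noteq> far_edge N"
  using att.new_edges[of N] unfolding tile_edges by simp_all

lemma range_edge_in_snake:
  assumes "1 \<le> m" "m \<le> N"
  shows "range (edge m) \<subseteq> snake N"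
proof -
  have "m \<in> {1..N}" using assms by simp
  then show ?thesis unfolding snake_def by blast
qed

lemma glue_not_before: "1 \<le> m \<Longrightarrow> m < N \<Longrightarrow> glue N \<notin> range (edge m)"
proof -
  assume m: "1 \<le> m" "m < N"
  then obtain i where i: "N = Suc i" "m \<le> i" by (cases N) auto
  then have "glue N \<notin> snake i" using glue_Suc_cases[of i] new_tile_edges(1,3)[of i] by metis
  then show ?thesis using range_edge_in_snake[OF m(1) i(2)] by blast
qed

lemma glue_on_last: "N \<ge> 1 \<Longrightarrow> glue N \<in> range (edge N)"
  using glue_Suc[of "N - 1"] by (cases N) simp_all

abbreviation "cycle \<equiv> cycle_around n k x"

lemma card_split:
  assumes "s \<le> Suc N"
  shows "card {m \<in> {s..Suc N}. g \<in> range (edge m)}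
     = card {m \<in> {s..N}. g \<in> range (edge m)} + (if g \<in> range (edge (Suc N)) then 1 else 0)"
proof -
  have ins: "{s..Suc N} = insert (Suc N) {s..N}" using assms by auto
  have fin: "finite {m \<in> {s..N}. g \<in> range (edge m)}" by simp
  show ?thesis
  proof (cases "g \<in> range (edge (Suc N))")
    case True
    then have "{m \<in> {s..Suc N}. g \<in> range (edge m)} = insert (Suc N) {m \<in> {s..N}. g \<in> range (edge m)}"
      unfolding ins by blast
    then show ?thesis using True fin by simp
  next
    case False
    then have "{m \<in> {s..Suc N}. g \<in> range (edge m)} = {m \<in> {s..N}. g \<in> range (edge m)}"
      unfolding ins by blast
    then show ?thesis using False by simp
  qed
qed

lemma cycle_in_snake: "1 \<le> s \<Longrightarrow> t \<le> N \<Longrightarrow> cycle s t \<subseteq> snake N"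
proof
  fix g assume s: "1 \<le> s" "t \<le> N" and "g \<in> cycle s t"
  then have "card {m \<in> {s..t}. g \<in> range (edge m)} \<noteq> 0" unfolding cycle_around_def by simp
  then have "{m \<in> {s..t}. g \<in> range (edge m)} \<noteq> {}" by (metis card.empty)
  then obtain m where "m \<in> {s..t}" "g \<in> range (edge m)" by blast
  then show "g \<in> snake N" using range_edge_in_snake[of m N] s(1,2) by (meson atLeastAtMost_iff le_trans subsetD)
qed

lemma glue_notin_cycle: "1 \<le> s \<Longrightarrow> t < N \<Longrightarrow> glue N \<notin> cycle s t"
proof
  assume s: "1 \<le> s" "t < N" and "glue N \<in> cycle s t"
  then have "card {m \<in> {s..t}. glue N \<in> range (edge m)} \<noteq> 0" unfolding cycle_around_def by simp
  then have "{m \<in> {s..t}. glue N \<in> range (edge m)} \<noteq> {}" by (metis card.empty)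
  then obtain m where "m \<in> {s..t}" "glue N \<in> range (edge m)" by blast
  then show False using glue_not_before[of m N] s(1,2) by simp
qed

lemma cycle_single: "cycle (Suc N) (Suc N) = {glue N, far_edge N, side_edge N, back_edge N}"
proof -
  have "{m \<in> {Suc N..Suc N}. g \<in> range (edge m)} = (if g \<in> range (edge (Suc N)) then {Suc N} else {})" for g
    by (cases "g \<in> range (edge (Suc N))") (simp_all add: set_eq_iff conj_commute cong: conj_cong)
  then have "g \<in> cycle (Suc N) (Suc N) \<longleftrightarrow> g \<in> range (edge (Suc N))" for g
    unfolding cycle_around_def by simp
  then show ?thesis unfolding range_edge_Suc by blast
qed

text \<open>
  Prolonging a cycle around one more tile replaces the glued edge by the rest of the boundary of that
  tile.
\<close>

lemma cycle_Suc:
  assumes "1 \<le> s" "s \<le> N"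
  shows "cycle s (Suc N) = (cycle s N - {glue N}) \<union> {far_edge N, side_edge N, back_edge N}" "glue N \<in> cycle s N"
proof -
  define c where "c g = card {m \<in> {s..N}. g \<in> range (edge m)}" for g
  have cyc: "g \<in> cycle s N \<longleftrightarrow> c g = 1" for g by (simp add: cycle_around_def c_def)
  have new: "c g = 0" if "g \<in> {far_edge N, side_edge N, back_edge N}" for g
  proof -
    from that have "g = far_edge N \<or> g = side_edge N \<or> g = back_edge N" by simp
    then have "g \<notin> snake N" using new_tile_edges(1-3)[of N] by (elim disjE) simp_all
    then have "g \<notin> range (edge m)" if "m \<in> {s..N}" for m
      using range_edge_in_snake[of m N] that assms by (meson atLeastAtMost_iff le_trans subsetD)
    then have "{m \<in> {s..N}. g \<in> range (edge m)} = {}" by blast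
    then show ?thesis unfolding c_def by simp
  qed
  have "{m \<in> {s..N}. glue N \<in> range (edge m)} = {N}"
  proof (intro set_eqI iffI)
    fix m assume "m \<in> {m \<in> {s..N}. glue N \<in> range (edge m)}"
    then have "s \<le> m" "m \<le> N" "glue N \<in> range (edge m)" by simp_all
    then show "m \<in> {N}" using glue_not_before[of m N] assms by (cases "m = N") simp_all
  next
    fix m assume "m \<in> {N}"
    then show "m \<in> {m \<in> {s..N}. glue N \<in> range (edge m)}" using glue_on_last[of N] assms by simp
  qed
  then have gl: "c (glue N) = 1" by (simp add: c_def)
  then show "glue N \<in> cycle s N" by (simp add: cyc)
  have step: "g \<in> cycle s (Suc N) \<longleftrightarrow> c g + (if g \<in> {glue N, far_edge N, side_edge N, back_edge N} then 1 else 0) = 1" for g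
    using card_split[of s N g] assms unfolding cycle_around_def c_def range_edge_Suc by simp
  show "cycle s (Suc N) = (cycle s N - {glue N}) \<union> {far_edge N, side_edge N, back_edge N}"
  proof (rule set_eqI)
    fix g
    consider "g \<in> {far_edge N, side_edge N, back_edge N}" | "g = glue N" | "g \<notin> {glue N, far_edge N, side_edge N, back_edge N}"
      by blast
    then show "g \<in> cycle s (Suc N) \<longleftrightarrow> g \<in> (cycle s N - {glue N}) \<union> {far_edge N, side_edge N, back_edge N}"
    proof cases
      case 1
      then have "g \<in> cycle s (Suc N)" unfolding step using new[OF 1] by auto
      with 1 show ?thesis by blast
    next
      case 2
      then have "g \<notin> cycle s (Suc N)" unfolding step using gl by simp
      moreover have "g \<notin> {far_edge N, side_edge N, back_edge N}" using 2 new_tile_edges(5-7)[of N, THEN not_sym] by simp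
      ultimately show ?thesis using 2 by blast
    next
      case 3
      then have "g \<in> cycle s (Suc N) \<longleftrightarrow> g \<in> cycle s N" unfolding step cyc by simp
      with 3 show ?thesis by blast
    qed
  qed
qed

definition surrounds :: "(nat \<times> nat) set multiset \<Rightarrow> nat \<Rightarrow> nat \<Rightarrow> bool" where
  "surrounds M s t \<longleftrightarrow> (\<forall>g\<in>cycle s t. count M g = 1)"

definition odd_upto :: "nat \<Rightarrow> (nat \<times> nat) set multiset \<Rightarrow> nat set" where
  "odd_upto N M = \<Union>{{s, Suc t} | s t. 1 \<le> s \<and> s \<le> t \<and> t \<le> N \<and> surrounds M s t}"

lemma in_odd_upto:
  "i \<in> odd_upto N M \<longleftrightarrow> (\<exists>s t. (i = s \<or> i = Suc t) \<and> 1 \<le> s \<and> s \<le> t \<and> t \<le> N \<and> surrounds M s t)"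
  unfolding odd_upto_def by blast

lemma odd_upto_bound: "odd_upto N M \<subseteq> {1..Suc N}"
  by (auto simp: in_odd_upto)

lemma finite_odd_upto [simp]: "finite (odd_upto N M)"
  using odd_upto_bound finite_subset by blast

context
  fixes N M h
  assumes M: "M \<in> covers (snake N)" and h: "h \<le> count M (glue N)"
begin

abbreviation "M' \<equiv> attach_tile N M h"

lemma M_sub: "set_mset M \<subseteq> snake N"
  using M by (simp add: covers_def)

lemma h_le: "h \<le> 2" "count M (glue N) \<le> 2"
  using covers_count_le[OF M snake_Suc(2)] h unfolding tile_edges by auto

lemma attach_counts:
  "count M' (side_edge N) = h" "count M' (back_edge N) = h" "count M' (far_edge N) = 2 - h"
  "count M' (glue N) = count M (glue N) - h"
  "e \<in> snake N \<Longrightarrow> e \<noteq> glue N \<Longrightarrow> count M' e = count M e"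
  using att.count_attach[OF M_sub] unfolding tile_edges by simp_all

lemma count_glue_Suc: "count M' (glue (Suc N)) = 1 \<longleftrightarrow> h = 1"
  using glue_Suc_cases[of N] attach_counts h_le by auto

lemma surrounds_before:
  assumes "1 \<le> s" "t < N"
  shows "surrounds M' s t \<longleftrightarrow> surrounds M s t"
proof -
  have "count M' g = count M g" if "g \<in> cycle s t" for g
  proof (rule attach_counts(5))
    show "g \<in> snake N" using cycle_in_snake[of s t N] assms that by auto
    show "g \<noteq> glue N" using glue_notin_cycle[OF assms] that by blast
  qed
  then show ?thesis by (simp add: surrounds_def)
qed

text \<open>
  The upper and the right edge of a tile have total multiplicity two as long as no further tile is
  attached, so a cycle that uses one of them once also uses the other once.
\<close>

lemma surrounds_without_glue:
  assumes "1 \<le> s" "s \<le> N" "\<forall>g\<in>cycle s N - {glue N}. count M g = 1"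
  shows "count M (glue N) = 1"
proof -
  obtain i where i: "N = Suc i" using assms by (cases N) auto
  define other where "other = (if glue N = far_edge i then side_edge i else far_edge i)"
  have d: "far_edge i \<noteq> side_edge i" using new_tile_edges(4)[of i] by simp
  then have go: "glue N = far_edge i \<and> other = side_edge i \<or> glue N = side_edge i \<and> other = far_edge i"
    using glue_Suc_cases[of i] i by (auto simp: other_def)
  have "other \<in> cycle s N"
  proof (cases "s = N")
    case True then show ?thesis using cycle_single[of i] i go by auto
  next
    case False
    then show ?thesis using cycle_Suc(1)[of s i] assms i go by auto
  qed
  moreover have "other \<noteq> glue N" using go d by auto
  ultimately have o: "count M other = 1" using assms(3) by blast
  have "M \<in> covers (att.E' i)" using M i snake_Suc'[of i] by simp
  then obtain L m where L: "L \<in> covers (snake i)" "M = attach_tile i L m" by (rule att.covers_E'_detach)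
  then have Ls: "set_mset L \<subseteq> snake i" by (simp add: covers_def)
  have "count M (side_edge i) = m" "count M (far_edge i) = 2 - m"
    using att.count_attach[OF Ls] L(2) unfolding tile_edges by simp_all
  then show ?thesis using go o by auto
qed

lemma surrounds_last:
  assumes "1 \<le> s" "s \<le> N"
  shows "surrounds M' s N \<longleftrightarrow> surrounds M s N \<and> h = 0"
    and "surrounds M' s (Suc N) \<longleftrightarrow> surrounds M s N \<and> h = 1"
proof -
  have other: "count M' g = count M g" if "g \<in> cycle s N - {glue N}" for g
    using attach_counts(5) that cycle_in_snake[of s N N] assms(1) by blast
  have gl: "glue N \<in> cycle s N" by (rule cycle_Suc(2)[OF assms])
  define B where "B \<longleftrightarrow> (\<forall>g\<in>cycle s N - {glue N}. count M g = 1)"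
  have B: "B \<Longrightarrow> count M (glue N) = 1" using surrounds_without_glue assms unfolding B_def by blast
  have "surrounds M s N \<longleftrightarrow> B \<and> count M (glue N) = 1" using gl unfolding surrounds_def B_def by blast
  then have s: "surrounds M s N \<longleftrightarrow> B" using B by blast
  have "surrounds M' s N \<longleftrightarrow> (\<forall>g\<in>cycle s N - {glue N}. count M' g = 1) \<and> count M' (glue N) = 1"
    using gl unfolding surrounds_def by blast
  also have "\<dots> \<longleftrightarrow> B \<and> count M (glue N) - h = 1" using other attach_counts(4) unfolding B_def by simp
  also have "\<dots> \<longleftrightarrow> B \<and> h = 0" using B h by auto
  finally show "surrounds M' s N \<longleftrightarrow> surrounds M s N \<and> h = 0" using s by simp
  have "surrounds M' s (Suc N) \<longleftrightarrow> (\<forall>g\<in>cycle s N - {glue N}. count M' g = 1) \<and> h = 1 \<and> 2 - h = 1"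
    unfolding surrounds_def cycle_Suc(1)[OF assms] using attach_counts(1-3) by auto
  then show "surrounds M' s (Suc N) \<longleftrightarrow> surrounds M s N \<and> h = 1" using other s unfolding B_def by auto
qed

lemma surrounds_new: "surrounds M' (Suc N) (Suc N) \<longleftrightarrow> h = 1 \<and> count M (glue N) = 2"
  unfolding surrounds_def cycle_single using attach_counts(1-4) h h_le by auto

lemma surrounds_glue: "1 \<le> s \<Longrightarrow> s \<le> N \<Longrightarrow> surrounds M s N \<Longrightarrow> count M (glue N) = 1"
  using cycle_Suc(2) unfolding surrounds_def by blast

text \<open>
  Choosing \<open>h = 1\<close> either prolongs the cycle that ends at tile \<open>N\<close>, which replaces its closing variable
  \<open>\<theta>\<^bsub>N+1\<^esub>\<close> by \<open>\<theta>\<^bsub>N+2\<^esub>\<close>, or opens a cycle around the new tile alone, which adds both.  Toggling describes the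
  two cases at once.
\<close>

lemma odd_upto_attach:
  assumes IH: "Suc N \<in> odd_upto N M \<longleftrightarrow> count M (glue N) = 1"
  shows "odd_upto (Suc N) M' = (if h = 1 then insert (Suc (Suc N)) (toggle (Suc N) (odd_upto N M)) else odd_upto N M)"
proof -
  have old: "i \<in> odd_upto (Suc N) M' \<longleftrightarrow>
     (\<exists>s t. (i = s \<or> i = Suc t) \<and> 1 \<le> s \<and> s \<le> t \<and> t < N \<and> surrounds M s t)
     \<or> (\<exists>s. (i = s \<or> i = Suc N) \<and> 1 \<le> s \<and> s \<le> N \<and> surrounds M s N \<and> h = 0)
     \<or> (\<exists>s. (i = s \<or> i = Suc (Suc N)) \<and> 1 \<le> s \<and> s \<le> N \<and> surrounds M s N \<and> h = 1)
     \<or> (i = Suc N \<or> i = Suc (Suc N)) \<and> h = 1 \<and> count M (glue N) = 2" for i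
  proof -
    have "i \<in> odd_upto (Suc N) M' \<longleftrightarrow>
     (\<exists>s t. (i = s \<or> i = Suc t) \<and> 1 \<le> s \<and> s \<le> t \<and> t < N \<and> surrounds M' s t)
     \<or> (\<exists>s. (i = s \<or> i = Suc N) \<and> 1 \<le> s \<and> s \<le> N \<and> surrounds M' s N)
     \<or> (\<exists>s. (i = s \<or> i = Suc (Suc N)) \<and> 1 \<le> s \<and> s \<le> N \<and> surrounds M' s (Suc N))
     \<or> (i = Suc N \<or> i = Suc (Suc N)) \<and> surrounds M' (Suc N) (Suc N)"
      (is "?L \<longleftrightarrow> ?A \<or> ?B \<or> ?C \<or> ?D")
    proof
      assume ?L
      then obtain s t where st: "i = s \<or> i = Suc t" "1 \<le> s" "s \<le> t" "t \<le> Suc N" "surrounds M' s t"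
        unfolding in_odd_upto by blast
      then consider "t < N" | "t = N" "s \<le> N" | "t = Suc N" "s \<le> N" | "t = Suc N" "s = Suc N" by linarith
      then show "?A \<or> ?B \<or> ?C \<or> ?D" by cases (use st in blast)+
    next
      have "1 \<le> Suc N" "Suc N \<le> Suc N" "N \<le> Suc N" by simp_all
      moreover have "t < N \<Longrightarrow> t \<le> Suc N" "t \<le> N \<Longrightarrow> t \<le> Suc N" for t by simp_all
      moreover assume "?A \<or> ?B \<or> ?C \<or> ?D"
      ultimately show ?L unfolding in_odd_upto by (elim disjE exE conjE) blast+
    qed
    then show ?thesis by (simp add: surrounds_before surrounds_last surrounds_new cong: conj_cong)
  qed
  have all: "i \<in> odd_upto N M \<longleftrightarrow>
     (\<exists>s t. (i = s \<or> i = Suc t) \<and> 1 \<le> s \<and> s \<le> t \<and> t < N \<and> surrounds M s t)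
     \<or> (\<exists>s. (i = s \<or> i = Suc N) \<and> 1 \<le> s \<and> s \<le> N \<and> surrounds M s N)" for i
    unfolding in_odd_upto by (auto simp: less_le)
  consider "h = 0" | "h = 1" "count M (glue N) = 1" | "h = 1" "count M (glue N) = 2" | "h = 2"
    using h h_le by fastforce
  then show ?thesis
  proof cases
    case 1
    have "i \<in> odd_upto (Suc N) M' \<longleftrightarrow> i \<in> odd_upto N M" for i unfolding old all using 1 by simp
    then show ?thesis using 1 by auto
  next
    case 2
    then have T: "Suc N \<in> odd_upto N M" using IH by simp
    then obtain s where s: "1 \<le> s" "s \<le> N" "surrounds M s N" unfolding all by auto
    have "i \<in> odd_upto (Suc N) M' \<longleftrightarrow> i = Suc (Suc N) \<or> i \<in> odd_upto N M \<and> i \<noteq> Suc N" for i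
      unfolding old all using 2 s by auto
    then show ?thesis using 2 T by (auto simp: toggle_def)
  next
    case 3
    then have T: "Suc N \<notin> odd_upto N M" using IH by simp
    have no: "\<not> surrounds M s N" if "1 \<le> s" "s \<le> N" for s using surrounds_glue[OF that] 3 by auto
    have "i \<in> odd_upto (Suc N) M' \<longleftrightarrow> i = Suc (Suc N) \<or> i \<in> odd_upto N M \<or> i = Suc N" for i
      unfolding old all using 3 no by auto
    then show ?thesis using 3 T by (auto simp: toggle_def)
  next
    case 4
    then have "count M (glue N) = 2" using h h_le by simp
    then have no: "\<not> surrounds M s N" if "1 \<le> s" "s \<le> N" for s using surrounds_glue[OF that] by auto
    have "i \<in> odd_upto (Suc N) M' \<longleftrightarrow> i \<in> odd_upto N M" for i unfolding old all using 4 no by auto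
    then show ?thesis using 4 by auto
  qed
qed

end

lemma snake_0: "snake 0 = {glue 0}"
  by (simp add: snake_def)

lemma covers_snake_0: "covers (snake 0) = {{#glue 0, glue 0#}}"
proof (intro set_eqI iffI)
  fix M assume M: "M \<in> covers (snake 0)"
  then have sub: "set_mset M \<subseteq> {glue 0}" by (simp add: covers_def snake_0)
  have v: "near_corner1 0 \<in> glue 0" unfolding tile_edges by simp
  then have "size {#g \<in># M. near_corner1 0 \<in> g#} = 2" using M unfolding covers_def snake_0 by blast
  moreover have "{g \<in> {glue 0}. near_corner1 0 \<in> g} = {glue 0}" using v by blast
  ultimately have "count M (glue 0) = 2" using size_filter_count[of "{glue 0}" M "\<lambda>g. near_corner1 0 \<in> g"] sub by simp
  moreover have "M = replicate_mset (count M (glue 0)) (glue 0)"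
    using sub by (metis set_mset_subset_singletonD count_replicate_mset)
  ultimately show "M \<in> {{#glue 0, glue 0#}}" by (simp add: numeral_2_eq_2)
next
  fix M assume "M \<in> {{#glue 0, glue 0#}}"
  then show "M \<in> covers (snake 0)" by (auto simp: covers_def snake_0)
qed

lemma finite_covers_snake: "finite (covers (snake N))"
proof (induction N)
  case 0 then show ?case by (simp add: covers_snake_0)
next
  case (Suc N) then show ?case using att.finite_covers_E'[of N] by (simp add: snake_Suc')
qed

lemma covers_snake_Suc_cases:
  assumes "M \<in> covers (snake (Suc N))"
  obtains L h where "L \<in> covers (snake N)" "h \<le> count L (glue N)" "M = attach_tile N L h"
proof -
  have "M \<in> covers (att.E' N)" using assms by (simp add: snake_Suc')
  then show thesis using that unfolding tile_edges by (rule att.covers_E'_detach)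
qed

text \<open>
  The variable \<open>\<theta>\<^bsub>N+1\<^esub>\<close> closes a cycle exactly if this cycle uses the edge to which the next tile will be
  attached.
\<close>

lemma last_odd_iff:
  "M \<in> covers (snake N) \<Longrightarrow> Suc N \<in> odd_upto N M \<longleftrightarrow> count M (glue N) = 1"
proof (induction N arbitrary: M)
  case 0
  then show ?case by (auto simp: covers_snake_0 in_odd_upto)
next
  case (Suc N)
  then obtain L h where L: "L \<in> covers (snake N)" "h \<le> count L (glue N)" "M = attach_tile N L h"
    using covers_snake_Suc_cases by metis
  have "Suc (Suc N) \<in> odd_upto (Suc N) M \<longleftrightarrow> h = 1"
    using odd_upto_attach[OF L(1,2) Suc.IH[OF L(1)]] odd_upto_bound[of N L] L(3) by auto
  then show ?case using count_glue_Suc[OF L(1,2)] L(3) by simp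
qed

lemma even_odd_upto: "M \<in> covers (snake N) \<Longrightarrow> even (card (odd_upto N M))"
proof (induction N arbitrary: M)
  case 0
  have "odd_upto 0 M = {}" by (auto simp: in_odd_upto)
  then show ?case by simp
next
  case (Suc N)
  then obtain L h where L: "L \<in> covers (snake N)" "h \<le> count L (glue N)" "M = attach_tile N L h"
    using covers_snake_Suc_cases by metis
  note o = odd_upto_attach[OF L(1,2) last_odd_iff[OF L(1)], folded L(3)]
  have "Suc (Suc N) \<notin> toggle (Suc N) (odd_upto N L)"
    using odd_upto_bound[of N L] by (auto simp: toggle_def split: if_splits)
  moreover have "odd (card (toggle (Suc N) (odd_upto N L)))"
    using Suc.IH[OF L(1)] card_Diff_singleton[of "Suc N" "odd_upto N L"] card_gt_0_iff[of "odd_upto N L"]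
    by (auto simp: toggle_def)
  moreover have "finite (toggle (Suc N) (odd_upto N L))" by (simp add: toggle_def)
  ultimately show ?case using o Suc.IH[OF L(1)] by simp
qed

lemma sum_covers_snake_Suc:
  fixes F :: "(nat \<times> nat) set multiset \<Rightarrow> 'b::comm_monoid_add"
  shows "sum F (covers (snake (Suc N))) = (\<Sum>M\<in>covers (snake N). \<Sum>h\<le>count M (glue N). F (attach_tile N M h))"
  using att.sum_covers_E'[OF finite_covers_snake, of F N] by (simp add: snake_Suc' tile_edges)

lemma prod_attach_snake:
  fixes W :: "(nat \<times> nat) set \<Rightarrow> real"
  assumes "h \<le> count M (glue N)" "W (glue N) \<noteq> 0"
  shows "(\<Prod>e\<in>#attach_tile N M h. W e) = (\<Prod>e\<in>#M. W e) / W (glue N) ^ h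
      * (W (side_edge N) * W (back_edge N)) ^ h * W (far_edge N) ^ (2 - h)"
  using att.prod_attach[of h M N W] assms by (simp add: tile_edges)

end

section \<open>Labels of the snake graph and sums over its covers\<close>

context crossed_triangulation
begin

abbreviation "edge' \<equiv> tile_edge n k x"
abbreviation "horiz \<equiv> horizontal n k x"

lemma tile_label_eq:
  assumes m: "1 \<le> m" "m \<le> n - 1"
  shows "tile_label n k x m sd =
    (if odd m
     then (case sd of Left \<Rightarrow> {below m, lft m} | Bottom \<Rightarrow> {below m, rgt m} | Top \<Rightarrow> {lft m, above m} | Right \<Rightarrow> {rgt m, above m})
     else (case sd of Left \<Rightarrow> {below m, rgt m} | Bottom \<Rightarrow> {below m, lft m} | Top \<Rightarrow> {rgt m, above m} | Right \<Rightarrow> {lft m, above m}))"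
proof -
  have "tri n k x m - x m = {below m}"
    unfolding tri_below[OF m] diagonal(1)[OF m] using diagonal(3,4)[OF m] below_outside[OF m] by auto
  then have u: "the_elem (tri n k x m - x m) = below m" by (simp only: the_elem_eq)
  have "tri n k x (Suc m) - x m = {above m}"
    unfolding tri_above[OF m] diagonal(1)[OF m] using above_between[OF m] by auto
  then have v: "the_elem (tri n k x (Suc m) - x m) = above m" by (simp only: the_elem_eq)
  show ?thesis unfolding tile_label_def Let_def lft_def[symmetric] rgt_def[symmetric] u v by (rule refl)
qed

lemma third_side_eq:
  assumes m: "1 \<le> m" "m < n - 1"
  shows "third_side n k x m = (if lft (Suc m) = lft m then {above m, rgt m} else {lft m, above m})"
proof -
  have m': "1 \<le> m" "m \<le> n - 1" "1 \<le> Suc m" "Suc m \<le> n - 1" using m by auto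
  note ab = above_between[OF m'(1,2)]
  define d where "d = (if lft (Suc m) = lft m then {above m, rgt m} else {lft m, above m})"
  define d' where "d' = (if lft (Suc m) = lft m then {lft m, above m} else {above m, rgt m})"
  have xs: "x m = {lft m, rgt m}" "x (Suc m) = d'"
    using diagonal(1)[OF m'(1,2)] diagonal(1)[OF m'(3,4)] m ab
    by (auto simp: d'_def intro: above_cases[OF m'(1,2)])
  have sub: "c = {lft m, above m} \<or> c = {above m, rgt m} \<or> c = {lft m, rgt m}"
    if "c \<subseteq> {lft m, above m, rgt m}" "card c = 2" for c
  proof -
    obtain a b where "c = {a, b}" "a \<noteq> b" using \<open>card c = 2\<close> by (auto simp: card_2_iff)
    then show ?thesis using that(1) by auto
  qed
  have "third_side n k x m = d"
    unfolding third_side_def tri_above[OF m'(1,2)] xs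
  proof (rule the_equality)
    show "d \<subseteq> {lft m, above m, rgt m} \<and> card d = 2 \<and> d \<noteq> {lft m, rgt m} \<and> d \<noteq> d'"
      using ab by (auto simp: d_def d'_def doubleton_eq_iff)
    show "c = d" if "c \<subseteq> {lft m, above m, rgt m} \<and> card c = 2 \<and> c \<noteq> {lft m, rgt m} \<and> c \<noteq> d'" for c
      using sub[of c] that by (auto simp: d_def d'_def split: if_splits)
  qed
  then show ?thesis by (simp add: d_def)
qed

text \<open>
  The diagonals \<open>x (m - 1)\<close> and \<open>x m\<close> share one end.  For \<open>m = 1\<close> the previous diagonal is replaced by the
  side from \<open>0\<close> to the right end of \<open>x 1\<close>.
\<close>

definition kept_left :: "nat \<Rightarrow> bool" where
  "kept_left m \<longleftrightarrow> m \<noteq> 1 \<and> lft (m - 1) = lft m"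

definition kept :: "nat \<Rightarrow> nat" where
  "kept m = (if kept_left m then lft m else rgt m)"

definition gone :: "nat \<Rightarrow> nat" where
  "gone m = (if kept_left m then rgt m else lft m)"

text \<open>
  The labels of odd and even tiles are mirror images of each other, so a change of fan is needed to
  continue in the same direction.
\<close>

lemma horizontal_iff:
  assumes "Suc N \<le> n - 1"
  shows "horiz N \<longleftrightarrow> (odd (Suc N) \<longleftrightarrow> \<not> kept_left (Suc N))"
proof (cases "N = 0")
  case True
  then show ?thesis by (simp add: horizontal_def kept_left_def)
next
  case False
  then have N: "1 \<le> N" "N < n - 1" "N \<le> n - 1" using assms by auto
  note ab = above_between[OF N(1,3)]
  have "horiz N \<longleftrightarrow> third_side n k x N = tile_label n k x N Right" using False by (simp add: horizontal_def)
  also have "\<dots> \<longleftrightarrow> (if lft (Suc N) = lft N then odd N else even N)"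
    unfolding third_side_eq[OF N(1,2)] tile_label_eq[OF N(1,3)] using ab by (auto simp: doubleton_eq_iff)
  also have "\<dots> \<longleftrightarrow> (odd (Suc N) \<longleftrightarrow> \<not> kept_left (Suc N))" using False by (simp add: kept_left_def)
  finally show ?thesis .
qed

lemma edge_inj:
  assumes "edge' m sd = edge' m sd'"
  shows "sd = sd'"
proof -
  obtain a b where "tile_pos n k x m = (a, b)" by (metis surj_pair)
  then show ?thesis using assms
    by (cases sd; cases sd') (auto simp: tile_edge_def doubleton_eq_iff)
qed

lemma glue_labels:
  assumes "1 \<le> m" "Suc m \<le> n - 1"
  shows "tile_label n k x m (if horiz m then Right else Top)
     = tile_label n k x (Suc m) (if horiz m then Left else Bottom)"
proof -
  have m: "m \<le> n - 1" "m < n - 1" using assms by auto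
  have hz: "horiz m \<longleftrightarrow> (odd (Suc m) \<longleftrightarrow> \<not> kept_left (Suc m))" using horizontal_iff assms by simp
  show ?thesis
  proof (cases rule: above_cases[OF assms(1) m(1)])
    case 1 then show ?thesis using m by simp
  next
    case 2
    then have b: "below (Suc m) = rgt m" "kept_left (Suc m)" using assms by (auto simp: below_def kept_left_def)
    then show ?thesis unfolding hz tile_label_eq[OF assms(1) m(1)] tile_label_eq[of "Suc m", OF _ assms(2), simplified]
      using 2 by (simp add: insert_commute)
  next
    case 3
    then have b: "below (Suc m) = lft m" "\<not> kept_left (Suc m)" using assms by (auto simp: below_def kept_left_def)
    then show ?thesis unfolding hz tile_label_eq[OF assms(1) m(1)] tile_label_eq[of "Suc m", OF _ assms(2), simplified]
      using 3 by (simp add: insert_commute)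
  qed
qed

text \<open>
  An edge belongs to two tiles only if they are consecutive, and then both of them label it by the
  third side of the triangle between their diagonals.
\<close>

lemma edge_label_unique:
  assumes "1 \<le> m" "m \<le> m'" "m' \<le> n - 1" "edge' m sd = edge' m' sd'"
  shows "tile_label n k x m sd = tile_label n k x m' sd'"
proof (cases "m = m'")
  case True
  then show ?thesis using edge_inj assms(4) by metis
next
  case False
  then obtain i where i: "m' = Suc i" "m \<le> i" using assms(2) by (cases m') auto
  have g: "edge' m sd \<in> snake n k x i" using range_edge_in_snake[OF assms(1) i(2)] by blast
  have "edge' m' sd' \<in> {glue n k x i, far_edge n k x i, side_edge n k x i, back_edge n k x i}"
    using range_edge_Suc[of n k x i] i by blast
  then have gl: "edge' m' sd' = glue n k x i"
    using g assms(4) new_tile_edges(1-3)[of n k x i] by (elim insertE) auto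
  have "m = i"
  proof (rule ccontr)
    assume "m \<noteq> i"
    then have "glue n k x i \<notin> range (edge' m)" using glue_not_before[of m i] assms(1) i by simp
    then show False using gl assms(4) by (metis rangeI)
  qed
  moreover obtain i' where "i = Suc i'" using assms(1) i by (cases i) auto
  ultimately have "sd = (if horiz m then Right else Top)" "sd' = (if horiz m then Left else Bottom)"
    using gl assms(4) glue_Suc[of n k x i'] edge_inj i by (metis, metis glue_def)
  then show ?thesis using glue_labels[of m] assms i \<open>m = i\<close> by simp
qed

lemma edge_label_eq:
  assumes "1 \<le> m" "m \<le> n - 1"
  shows "edge_label n k x (edge' m sd) = tile_label n k x m sd"
  unfolding edge_label_def
proof (rule the_equality)
  show "\<exists>m'\<in>{1..n - 1}. \<exists>sd'. edge' m sd = edge' m' sd' \<and> tile_label n k x m sd = tile_label n k x m' sd'"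
    using assms by (intro bexI[of _ m] exI[of _ sd]) auto
  fix d assume "\<exists>m'\<in>{1..n - 1}. \<exists>sd'. edge' m sd = edge' m' sd' \<and> d = tile_label n k x m' sd'"
  then obtain m' sd' where m': "1 \<le> m'" "m' \<le> n - 1" "edge' m sd = edge' m' sd'" "d = tile_label n k x m' sd'" by auto
  then show "d = tile_label n k x m sd"
    using edge_label_unique[of m m' sd sd'] edge_label_unique[of m' m sd' sd] assms
    by (cases "m \<le> m'") auto
qed

definition root_weight :: "(nat \<times> nat) set \<Rightarrow> real" where
  "root_weight e = sqrt (w (edge_label n k x e))"

lemma tile_weights:
  assumes "Suc N \<le> n - 1"
  shows "root_weight (glue n k x N) = sqrt (w {below (Suc N), gone (Suc N)})"
    "root_weight (back_edge n k x N) = sqrt (w {below (Suc N), kept (Suc N)})"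
    "root_weight (far_edge n k x N) = sqrt (w {kept (Suc N), above (Suc N)})"
    "root_weight (side_edge n k x N) = sqrt (w {gone (Suc N), above (Suc N)})"
  unfolding root_weight_def glue_def back_edge_def far_edge_def side_edge_def
    edge_label_eq[OF _ assms, simplified] tile_label_eq[OF _ assms, simplified] horizontal_iff[OF assms] kept_def gone_def
  by auto

end

context realized_triangulation
begin

lemma tile_arcs:
  assumes "1 \<le> m" "m \<le> n - 1"
  shows "{below m, gone m} \<in> all_arcs" "{below m, kept m} \<in> all_arcs"
    "{kept m, above m} \<in> all_arcs" "{gone m, above m} \<in> all_arcs"
    "{lft m, rgt m} \<in> all_arcs"
  using side_arcs[OF assms] T_in[OF assms] by (auto simp: kept_def gone_def insert_commute)

definition even_part :: "(nat \<times> nat) set multiset \<Rightarrow> real" where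
  "even_part M = (\<Prod>e\<in>#M. root_weight e)"

text \<open>
  The sums of all weights, of those without an open cycle at the next glued edge, and of those with
  such a cycle, whose last variable is then left out because the cycle may still be prolonged.
\<close>

definition total :: "nat \<Rightarrow> grassmann" where
  "total N = (\<Sum>M\<in>covers (snake n k x N). even_part M *\<^sub>R index_product (odd_upto n k x N M))"

definition closed_at_glue :: "nat \<Rightarrow> grassmann" where
  "closed_at_glue N = (\<Sum>M\<in>covers (snake n k x N).
     if count M (glue n k x N) = 2 then even_part M *\<^sub>R index_product (odd_upto n k x N M) else 0)"

definition open_at_glue :: "nat \<Rightarrow> grassmann" where
  "open_at_glue N = (\<Sum>M\<in>covers (snake n k x N).
     if count M (glue n k x N) = 1 then even_part M *\<^sub>R index_product (odd_upto n k x N M - {Suc N}) else 0)"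

text \<open>
  The same sums, sorted by the multiplicity \<open>h\<close> of the sides of the last tile.
\<close>

definition with_sides :: "nat \<Rightarrow> nat \<Rightarrow> grassmann" where
  "with_sides N h = (\<Sum>M\<in>covers (snake n k x (Suc N)).
     if count M (side_edge n k x N) = h then even_part M *\<^sub>R index_product (odd_upto n k x (Suc N) M) else 0)"

definition open_sides :: "nat \<Rightarrow> grassmann" where
  "open_sides N = (\<Sum>M\<in>covers (snake n k x (Suc N)).
     if count M (side_edge n k x N) = 1 then even_part M *\<^sub>R index_product (odd_upto n k x (Suc N) M - {Suc (Suc N)}) else 0)"

context
  fixes N assumes N: "Suc N \<le> n - 1"
begin

abbreviation "att \<equiv> attach_tile n k x N"
abbreviation "\<omega>g \<equiv> w {below (Suc N), gone (Suc N)}"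
abbreviation "\<omega>b \<equiv> w {below (Suc N), kept (Suc N)}"
abbreviation "\<omega>f \<equiv> w {kept (Suc N), above (Suc N)}"
abbreviation "\<omega>s \<equiv> w {gone (Suc N), above (Suc N)}"

lemma weights_pos: "\<omega>g > 0" "\<omega>b > 0" "\<omega>f > 0" "\<omega>s > 0"
  using tile_arcs[of "Suc N"] N arc_pos by simp_all

lemma even_part_attach:
  assumes "h \<le> count M (glue n k x N)"
  shows "even_part (att M h) = even_part M * (sqrt \<omega>s * sqrt \<omega>b / sqrt \<omega>g) ^ h * sqrt \<omega>f ^ (2 - h)"
  using prod_attach_snake[OF assms, of root_weight] weights_pos
  unfolding even_part_def tile_weights[OF N] by (simp add: power_divide)

lemma sum_attach:
  fixes F :: "(nat \<times> nat) set multiset \<Rightarrow> grassmann"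
  shows "(\<Sum>M\<in>covers (snake n k x (Suc N)). if count M (side_edge n k x N) = h then F M else 0)
     = (\<Sum>M\<in>covers (snake n k x N). if h \<le> count M (glue n k x N) then F (att M h) else 0)"
  unfolding sum_covers_snake_Suc
proof (rule sum.cong[OF refl])
  fix M assume M: "M \<in> covers (snake n k x N)"
  have "(\<Sum>h'\<le>count M (glue n k x N). if count (att M h') (side_edge n k x N) = h then F (att M h') else 0)
     = (\<Sum>h'\<le>count M (glue n k x N). if h' = h then F (att M h) else 0)"
  proof (rule sum.cong[OF refl])
    fix h' assume "h' \<in> {..count M (glue n k x N)}"
    then have "count (att M h') (side_edge n k x N) = h'" using attach_counts(1)[OF M] by simp
    then show "(if count (att M h') (side_edge n k x N) = h then F (att M h') else 0) = (if h' = h then F (att M h) else 0)"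
      by simp
  qed
  then show "(\<Sum>h'\<le>count M (glue n k x N). if count (att M h') (side_edge n k x N) = h then F (att M h') else 0)
     = (if h \<le> count M (glue n k x N) then F (att M h) else 0)" by simp
qed

lemma odd_att:
  assumes "M \<in> covers (snake n k x N)" "h \<le> count M (glue n k x N)"
  shows "odd_upto n k x (Suc N) (att M h)
     = (if h = 1 then insert (Suc (Suc N)) (toggle (Suc N) (odd_upto n k x N M)) else odd_upto n k x N M)"
  using odd_upto_attach[OF assms last_odd_iff[OF assms(1)]] .

lemma with_sides_0: "with_sides N 0 = \<omega>f *\<^sub>R total N"
  unfolding with_sides_def sum_attach total_def scaleR_sum_right
proof (rule sum.cong[OF refl])
  fix M assume M: "M \<in> covers (snake n k x N)"
  show "(if 0 \<le> count M (glue n k x N) then even_part (att M 0) *\<^sub>R index_product (odd_upto n k x (Suc N) (att M 0)) else 0)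
     = \<omega>f *\<^sub>R even_part M *\<^sub>R index_product (odd_upto n k x N M)"
    using odd_att[OF M, of 0] even_part_attach[of 0 M] weights_pos by (simp add: mult.commute)
qed

lemma with_sides_2: "with_sides N 2 = (\<omega>s * \<omega>b / \<omega>g) *\<^sub>R closed_at_glue N"
  unfolding with_sides_def sum_attach closed_at_glue_def scaleR_sum_right
proof (rule sum.cong[OF refl])
  fix M assume M: "M \<in> covers (snake n k x N)"
  show "(if 2 \<le> count M (glue n k x N) then even_part (att M 2) *\<^sub>R index_product (odd_upto n k x (Suc N) (att M 2)) else 0)
     = (\<omega>s * \<omega>b / \<omega>g) *\<^sub>R (if count M (glue n k x N) = 2 then even_part M *\<^sub>R index_product (odd_upto n k x N M) else 0)"
    using odd_att[OF M, of 2] even_part_attach[of 2 M] weights_pos h_le(2)[OF M le0]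
    by (auto simp: power_divide power_mult_distrib mult.commute)
qed

text \<open>
  For \<open>h = 1\<close> either a new cycle is opened, with the sign \<open>\<eta>\<close> of its first variable, or the open cycle is
  prolonged.
\<close>

lemma open_sides_eq:
  "open_sides N = (sqrt \<omega>s * sqrt \<omega>b * sqrt \<omega>f / sqrt \<omega>g) *\<^sub>R
     (closed_at_glue N * (eta (Suc N) *\<^sub>R odd_var (Suc N)) + open_at_glue N)"
proof -
  have "open_sides N = (\<Sum>M\<in>covers (snake n k x N). (sqrt \<omega>s * sqrt \<omega>b * sqrt \<omega>f / sqrt \<omega>g) *\<^sub>R
     ((if count M (glue n k x N) = 2 then even_part M *\<^sub>R index_product (odd_upto n k x N M) else 0) * (eta (Suc N) *\<^sub>R odd_var (Suc N))
     + (if count M (glue n k x N) = 1 then even_part M *\<^sub>R index_product (odd_upto n k x N M - {Suc N}) else 0)))"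
    unfolding open_sides_def sum_attach
  proof (rule sum.cong[OF refl])
    fix M assume M: "M \<in> covers (snake n k x N)"
    define S where "S = odd_upto n k x N M"
    have S: "S \<subseteq> {1..Suc N}" "finite S" "even (card S)" "Suc N \<in> S \<longleftrightarrow> count M (glue n k x N) = 1"
      using odd_upto_bound even_odd_upto[OF M] last_odd_iff[OF M] by (simp_all add: S_def)
    have le: "count M (glue n k x N) \<le> 2" using h_le(2)[OF M le0] .
    have o: "odd_upto n k x (Suc N) (att M 1) - {Suc (Suc N)} = toggle (Suc N) S" if "1 \<le> count M (glue n k x N)"
      using odd_att[OF M that] S(1) by (auto simp: S_def[symmetric] toggle_def)
    have t: "index_product (toggle (Suc N) S) = index_product S * (eta (Suc N) *\<^sub>R odd_var (Suc N))" if "count M (glue n k x N) = 2"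
    proof -
      have notin: "Suc N \<notin> S" using S(4) that by simp
      have "s < Suc N" if "s \<in> S" for s
        using S(1) that notin by (metis atLeastAtMost_iff le_neq_implies_less subsetD)
      then show ?thesis using index_product_insert[OF S(2), of "Suc N"] S(3) notin by (simp add: toggle_def)
    qed
    have e: "even_part (att M 1) = even_part M * (sqrt \<omega>s * sqrt \<omega>b * sqrt \<omega>f / sqrt \<omega>g)" if "1 \<le> count M (glue n k x N)"
      using even_part_attach[OF that] by simp
    consider "count M (glue n k x N) = 0" | "count M (glue n k x N) = 1" | "count M (glue n k x N) = 2" using le by linarith
    then show "(if 1 \<le> count M (glue n k x N) then even_part (att M 1) *\<^sub>R index_product (odd_upto n k x (Suc N) (att M 1) - {Suc (Suc N)}) else 0)
      = (sqrt \<omega>s * sqrt \<omega>b * sqrt \<omega>f / sqrt \<omega>g) *\<^sub>R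
     ((if count M (glue n k x N) = 2 then even_part M *\<^sub>R index_product (odd_upto n k x N M) else 0) * (eta (Suc N) *\<^sub>R odd_var (Suc N))
     + (if count M (glue n k x N) = 1 then even_part M *\<^sub>R index_product (odd_upto n k x N M - {Suc N}) else 0))"
    proof cases
      case 1 then show ?thesis by simp
    next
      case 2
      then have "toggle (Suc N) S = S - {Suc N}" using S(4) by (simp add: toggle_def)
      then show ?thesis using 2 o e by (simp add: S_def mult.commute)
    next
      case 3
      then show ?thesis using o e t by (simp add: S_def mult_ac)
    qed
  qed
  also have "\<dots> = (sqrt \<omega>s * sqrt \<omega>b * sqrt \<omega>f / sqrt \<omega>g) *\<^sub>R
     (closed_at_glue N * (eta (Suc N) *\<^sub>R odd_var (Suc N)) + open_at_glue N)"
    unfolding closed_at_glue_def open_at_glue_def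
    by (simp add: scaleR_sum_right[symmetric] sum.distrib sum_distrib_right)
  finally show ?thesis .
qed

lemma open_at_glue_Suc: "open_at_glue (Suc N) = open_sides N"
  unfolding open_at_glue_def open_sides_def
proof (rule sum.cong[OF refl])
  fix M assume M: "M \<in> covers (snake n k x (Suc N))"
  obtain L h where L: "L \<in> covers (snake n k x N)" "h \<le> count L (glue n k x N)" "M = att L h"
    using M covers_snake_Suc_cases by metis
  then show "(if count M (glue n k x (Suc N)) = 1 then even_part M *\<^sub>R index_product (odd_upto n k x (Suc N) M - {Suc (Suc N)}) else 0)
     = (if count M (side_edge n k x N) = 1 then even_part M *\<^sub>R index_product (odd_upto n k x (Suc N) M - {Suc (Suc N)}) else 0)"
    using count_glue_Suc[OF L(1,2)] attach_counts(1)[OF L(1,2)] by simp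
qed

lemma closed_at_glue_Suc:
  "closed_at_glue (Suc N) = with_sides N (if glue n k x (Suc N) = far_edge n k x N then 0 else 2)"
  unfolding closed_at_glue_def with_sides_def
proof (rule sum.cong[OF refl])
  fix M assume M: "M \<in> covers (snake n k x (Suc N))"
  obtain L h where L: "L \<in> covers (snake n k x N)" "h \<le> count L (glue n k x N)" "M = att L h"
    using M covers_snake_Suc_cases by metis
  have "count M (glue n k x (Suc N)) = 2 \<longleftrightarrow>
      count M (side_edge n k x N) = (if glue n k x (Suc N) = far_edge n k x N then 0 else 2)"
    using glue_Suc_cases[of n k x N] attach_counts[OF L(1,2)] h_le[OF L(1,2)] L(3) by auto
  then show "(if count M (glue n k x (Suc N)) = 2 then even_part M *\<^sub>R index_product (odd_upto n k x (Suc N) M) else 0)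
     = (if count M (side_edge n k x N) = (if glue n k x (Suc N) = far_edge n k x N then 0 else 2)
        then even_part M *\<^sub>R index_product (odd_upto n k x (Suc N) M) else 0)" by simp
qed

lemma total_Suc: "total (Suc N) = with_sides N 0 + with_sides N 2 + open_sides N * odd_var (Suc (Suc N))"
proof -
  have "with_sides N 0 + with_sides N 2 + open_sides N * odd_var (Suc (Suc N)) =
    (\<Sum>M\<in>covers (snake n k x (Suc N)).
      (if count M (side_edge n k x N) = 0 then even_part M *\<^sub>R index_product (odd_upto n k x (Suc N) M) else 0)
      + (if count M (side_edge n k x N) = 2 then even_part M *\<^sub>R index_product (odd_upto n k x (Suc N) M) else 0)
      + (if count M (side_edge n k x N) = 1 then even_part M *\<^sub>R index_product (odd_upto n k x (Suc N) M - {Suc (Suc N)}) else 0)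
        * odd_var (Suc (Suc N)))"
    unfolding with_sides_def open_sides_def by (simp only: sum.distrib sum_distrib_right)
  also have "\<dots> = total (Suc N)"
    unfolding total_def
  proof (rule sum.cong[OF refl])
    fix M assume M: "M \<in> covers (snake n k x (Suc N))"
    obtain L h where L: "L \<in> covers (snake n k x N)" "h \<le> count L (glue n k x N)" "M = att L h"
      using M covers_snake_Suc_cases by metis
    define S where "S = odd_upto n k x (Suc N) M"
    have c: "count M (side_edge n k x N) = h" "h \<le> 2" using attach_counts(1)[OF L(1,2)] h_le[OF L(1,2)] L(3) by simp_all
    have S: "S \<subseteq> {1..Suc (Suc N)}" "finite S" "even (card S)" "Suc (Suc N) \<in> S \<longleftrightarrow> h = 1"
      using odd_upto_bound even_odd_upto[OF M] last_odd_iff[OF M] count_glue_Suc[OF L(1,2)] L(3) by (simp_all add: S_def)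
    have key: "index_product S = index_product (S - {Suc (Suc N)}) * odd_var (Suc (Suc N))" if "h = 1"
    proof -
      have mem: "Suc (Suc N) \<in> S" using S(4) that by simp
      then have "card S = Suc (card (S - {Suc (Suc N)}))" using S(2) by (metis card_Suc_Diff1)
      then have "odd (card (S - {Suc (Suc N)}))" using S(3) by simp
      moreover have "s < Suc (Suc N)" if "s \<in> S - {Suc (Suc N)}" for s using that S(1) by force
      ultimately show ?thesis
        using index_product_insert[of "S - {Suc (Suc N)}" "Suc (Suc N)"] S(2) mem by (simp add: insert_absorb)
    qed
    consider "h = 0" | "h = 1" | "h = 2" using c(2) by linarith
    then show "(if count M (side_edge n k x N) = 0 then even_part M *\<^sub>R index_product (odd_upto n k x (Suc N) M) else 0)
      + (if count M (side_edge n k x N) = 2 then even_part M *\<^sub>R index_product (odd_upto n k x (Suc N) M) else 0)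
      + (if count M (side_edge n k x N) = 1 then even_part M *\<^sub>R index_product (odd_upto n k x (Suc N) M - {Suc (Suc N)}) else 0)
        * odd_var (Suc (Suc N)) = even_part M *\<^sub>R index_product (odd_upto n k x (Suc N) M)"
      unfolding c(1) S_def[symmetric] by cases (simp_all add: key)
  qed
  finally show ?thesis by simp
qed

end

end

section \<open>The two dimer formulas\<close>

lemma sqrt_identity_1:
  fixes a b e :: real
  assumes "a > 0" "b > 0" "e > 0"
  shows "sqrt (b / (e * a)) * (sqrt (a * b * e) / e) = b / e"
proof -
  have "sqrt (b / (e * a)) * sqrt (a * b * e) = sqrt (b * b)"
    unfolding real_sqrt_mult[symmetric] using assms by (simp add: field_simps)
  then show ?thesis using assms by simp
qed

lemma sqrt_identity_2:
  fixes a b e :: real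
  assumes "a > 0" "b > 0" "e > 0"
  shows "sqrt (b / (e * a)) * (a / e) = sqrt (a * b / e) / e"
proof -
  have "sqrt (b / (e * a)) * a = sqrt (b / (e * a)) * sqrt (a * a)" using assms by simp
  also have "\<dots> = sqrt (a * b / e)"
    unfolding real_sqrt_mult[symmetric] using assms by (simp add: field_simps)
  finally show ?thesis by simp
qed

context realized_triangulation
begin

definition cross_upto :: "nat \<Rightarrow> real" where
  "cross_upto N = (\<Prod>m\<in>{1..N}. w {lft m, rgt m})"

lemma cross_upto_Suc: "cross_upto (Suc N) = cross_upto N * w {lft (Suc N), rgt (Suc N)}"
  by (simp add: cross_upto_def)

lemma det_above:
  assumes "1 \<le> m" "m \<le> n - 1"
  shows "det (lft m) (above m) (rgt m) = sqrt (w {lft m, above m} * w {above m, rgt m} * w {lft m, rgt m}) *\<^sub>R odd_var (Suc m)"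
  using V_det[OF assms] by (simp add: mu_ok_def)

lemma sg_0: "0 < p \<Longrightarrow> sg p 0 = - 1" "p < q \<Longrightarrow> sg p q = 1"
  by (auto simp: sg_def)

text \<open>
  The Ptolemy and exchange relations in the quadrilateral of \<open>0\<close>, the diagonal \<open>x m\<close> and the vertex
  above it.
\<close>

lemma fan_relations:
  assumes m: "1 \<le> m" "m \<le> n - 1"
  defines "\<omega>l \<equiv> w {lft m, above m}" and "\<omega>r \<equiv> w {above m, rgt m}" and "\<omega> \<equiv> w {lft m, rgt m}"
  shows "\<omega> *\<^sub>R lam V 0 (above m) = \<omega>l *\<^sub>R lam V 0 (rgt m) + \<omega>r *\<^sub>R lam V 0 (lft m)
           - (sqrt (\<omega>l * \<omega>r * \<omega>) / \<omega>) *\<^sub>R (det 0 (lft m) (rgt m) * odd_var (Suc m))"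
    and "\<omega> *\<^sub>R det 0 (lft m) (above m) = \<omega>l *\<^sub>R det 0 (lft m) (rgt m)
           - sqrt (\<omega>l * \<omega>r * \<omega>) *\<^sub>R (lam V 0 (lft m) * odd_var (Suc m))"
    and "\<omega> *\<^sub>R det 0 (above m) (rgt m) = \<omega>r *\<^sub>R det 0 (lft m) (rgt m)
           + sqrt (\<omega>l * \<omega>r * \<omega>) *\<^sub>R (lam V 0 (rgt m) * odd_var (Suc m))"
proof -
  note d = diagonal[OF m] and ab = above_between[OF m] and s = side_arcs(1,2)[OF m]
  have pos: "\<omega> > 0" using arc_pos T_in[OF m] unfolding \<omega>_def by simp
  have c: "cw (lft m) (above m) (rgt m)" "cw (lft m) (rgt m) 0"
    using cw_above[OF m] d by (auto simp: cw_def)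
  have L: "lam V (lft m) (rgt m) = of_real \<omega>" "lam V (lft m) (above m) = of_real \<omega>l"
    "lam V (above m) (rgt m) = of_real \<omega>r"
    using lam_arc s T_in[OF m] by (simp_all add: \<omega>_def \<omega>l_def \<omega>r_def)
  have L0: "lam V (above m) 0 = lam V 0 (above m)" "lam V (rgt m) 0 = lam V 0 (rgt m)"
    "lam V (lft m) 0 = lam V 0 (lft m)"
    using lam_sym d ab by simp_all
  have rot: "det (lft m) (rgt m) 0 = det 0 (lft m) (rgt m)" "det (lft m) (above m) 0 = det 0 (lft m) (above m)"
     "det (above m) (rgt m) 0 = det 0 (above m) (rgt m)"
    by (rule det3_rotate)+
  have sg: "sg (above m) 0 = - 1" "sg (lft m) (rgt m) = 1" "sg (lft m) 0 = - 1" "sg (rgt m) 0 = - 1"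
    using sg_0 d ab by simp_all
  have R: "of_real r * y = r *\<^sub>R y" for r and y :: grassmann by (simp add: of_real_def)
  have "\<omega> *\<^sub>R (\<omega> *\<^sub>R lam V 0 (above m) - \<omega>l *\<^sub>R lam V 0 (rgt m) - \<omega>r *\<^sub>R lam V 0 (lft m))
      = - (det 0 (lft m) (rgt m) * (sqrt (\<omega>l * \<omega>r * \<omega>) *\<^sub>R odd_var (Suc m)))"
    using lam_ptolemy[OF c] unfolding L L0 rot sg det_above[OF m] R by (simp add: \<omega>_def \<omega>l_def \<omega>r_def)
  then have "(1 / \<omega>) *\<^sub>R (\<omega> *\<^sub>R (\<omega> *\<^sub>R lam V 0 (above m) - \<omega>l *\<^sub>R lam V 0 (rgt m) - \<omega>r *\<^sub>R lam V 0 (lft m)))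
      = (1 / \<omega>) *\<^sub>R (- (sqrt (\<omega>l * \<omega>r * \<omega>) *\<^sub>R (det 0 (lft m) (rgt m) * odd_var (Suc m))))" by simp
  then have "\<omega> *\<^sub>R lam V 0 (above m) - \<omega>l *\<^sub>R lam V 0 (rgt m) - \<omega>r *\<^sub>R lam V 0 (lft m)
     = - ((sqrt (\<omega>l * \<omega>r * \<omega>) / \<omega>) *\<^sub>R (det 0 (lft m) (rgt m) * odd_var (Suc m)))"
    using pos by simp
  then show "\<omega> *\<^sub>R lam V 0 (above m) = \<omega>l *\<^sub>R lam V 0 (rgt m) + \<omega>r *\<^sub>R lam V 0 (lft m)
           - (sqrt (\<omega>l * \<omega>r * \<omega>) / \<omega>) *\<^sub>R (det 0 (lft m) (rgt m) * odd_var (Suc m))"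
    by (simp add: algebra_simps)
  have "- (\<omega> *\<^sub>R det 0 (lft m) (above m)) = - (\<omega>l *\<^sub>R det 0 (lft m) (rgt m))
      + lam V 0 (lft m) * (sqrt (\<omega>l * \<omega>r * \<omega>) *\<^sub>R odd_var (Suc m))"
    using det3_exchange(1)[OF c] unfolding L L0 rot sg det_above[OF m] R by (simp add: \<omega>_def \<omega>l_def \<omega>r_def)
  then show "\<omega> *\<^sub>R det 0 (lft m) (above m) = \<omega>l *\<^sub>R det 0 (lft m) (rgt m)
           - sqrt (\<omega>l * \<omega>r * \<omega>) *\<^sub>R (lam V 0 (lft m) * odd_var (Suc m))"
    by (simp add: algebra_simps)
  have "- (\<omega> *\<^sub>R det 0 (above m) (rgt m)) = - (\<omega>r *\<^sub>R det 0 (lft m) (rgt m))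
      - lam V 0 (rgt m) * (sqrt (\<omega>l * \<omega>r * \<omega>) *\<^sub>R odd_var (Suc m))"
    using det3_exchange(2)[OF c] unfolding L L0 rot sg det_above[OF m] R by (simp add: \<omega>_def \<omega>l_def \<omega>r_def)
  then show "\<omega> *\<^sub>R det 0 (above m) (rgt m) = \<omega>r *\<^sub>R det 0 (lft m) (rgt m)
           + sqrt (\<omega>l * \<omega>r * \<omega>) *\<^sub>R (lam V 0 (rgt m) * odd_var (Suc m))"
    by (simp add: algebra_simps)
qed

text \<open>
  The state of the recursion before tile \<open>N + 1\<close> is attached, expressed by the vectors; the third
  equation already contains the cycle that may be opened at this tile.
\<close>

definition before_tile :: "nat \<Rightarrow> bool" where
  "before_tile N \<longleftrightarrow> (let m = Suc N; g = w {below m, gone m}; b = w {below m, kept m}; e = w {lft m, rgt m} in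
     total N = cross_upto N *\<^sub>R lam V 0 (gone m) \<and>
     closed_at_glue N = (cross_upto N * g / b) *\<^sub>R lam V 0 (kept m) \<and>
     closed_at_glue N * (eta m *\<^sub>R odd_var m) + open_at_glue N
       = - ((cross_upto N * sqrt (g / (b * e))) *\<^sub>R det 0 (lft m) (rgt m)))"

text \<open>
  The sums over \<open>h = 0\<close>, \<open>1\<close>, \<open>2\<close> are the three terms of the Ptolemy relation for the bracket of \<open>0\<close> with
  the new vertex.
\<close>

lemma after_tile:
  assumes m: "m = Suc N" "m \<le> n - 1" and st: "before_tile N"
  defines "e \<equiv> w {lft m, rgt m}"
  shows "with_sides N 0 = (cross_upto m * w {kept m, above m} / e) *\<^sub>R lam V 0 (gone m)"
    and "with_sides N 2 = (cross_upto m * w {gone m, above m} / e) *\<^sub>R lam V 0 (kept m)"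
    and "open_sides N = - ((cross_upto m * (sqrt (w {lft m, above m} * w {above m, rgt m} / e) / e)) *\<^sub>R det 0 (lft m) (rgt m))"
    and "total m = cross_upto m *\<^sub>R lam V 0 (above m)"
proof -
  have N: "Suc N \<le> n - 1" and m1: "1 \<le> m" using m by auto
  define g where "g = w {below m, gone m}"
  define b where "b = w {below m, kept m}"
  define f where "f = w {kept m, above m}"
  define s where "s = w {gone m, above m}"
  have pos: "g > 0" "b > 0" "f > 0" "s > 0" "e > 0"
    using tile_arcs[OF m1 m(2)] arc_pos unfolding g_def b_def f_def s_def e_def by simp_all
  have H: "total N = cross_upto N *\<^sub>R lam V 0 (gone m)"
     "closed_at_glue N = (cross_upto N * g / b) *\<^sub>R lam V 0 (kept m)"
     "closed_at_glue N * (eta m *\<^sub>R odd_var m) + open_at_glue N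
       = - ((cross_upto N * sqrt (g / (b * e))) *\<^sub>R det 0 (lft m) (rgt m))"
    using st unfolding before_tile_def Let_def m(1)[symmetric] g_def b_def e_def by blast+
  have cr: "cross_upto m = cross_upto N * e" unfolding m(1) cross_upto_Suc e_def ..
  show w0: "with_sides N 0 = (cross_upto m * w {kept m, above m} / e) *\<^sub>R lam V 0 (gone m)"
    using with_sides_0[OF N, folded m(1)] pos by (simp add: H cr mult.commute f_def[symmetric])
  show w2: "with_sides N 2 = (cross_upto m * w {gone m, above m} / e) *\<^sub>R lam V 0 (kept m)"
    using with_sides_2[OF N, folded m(1)] pos by (simp add: H cr field_simps s_def[symmetric] b_def[symmetric] g_def[symmetric])
  have "{f, s} = {w {lft m, above m}, w {above m, rgt m}} \<and> f * s = w {lft m, above m} * w {above m, rgt m}"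
    unfolding f_def s_def kept_def gone_def by (auto simp: insert_commute mult.commute)
  then have fs: "f * s = w {lft m, above m} * w {above m, rgt m}" by blast
  have "sqrt s * sqrt b * sqrt f / sqrt g * sqrt (g / (b * e)) = sqrt (s * b * f / g * (g / (b * e)))"
    by (simp add: real_sqrt_mult real_sqrt_divide)
  also have "s * b * f / g * (g / (b * e)) = f * s / e" using pos by (simp add: field_simps)
  finally have sq: "sqrt s * sqrt b * sqrt f / sqrt g * sqrt (g / (b * e)) = sqrt (f * s / e)" .
  have "open_sides N = - ((sqrt s * sqrt b * sqrt f / sqrt g * (cross_upto N * sqrt (g / (b * e)))) *\<^sub>R det 0 (lft m) (rgt m))"
    using open_sides_eq[OF N, folded m(1)]
    unfolding H(3) b_def[symmetric] g_def[symmetric] f_def[symmetric] s_def[symmetric] by simp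
  also have "sqrt s * sqrt b * sqrt f / sqrt g * (cross_upto N * sqrt (g / (b * e)))
      = cross_upto N * (sqrt s * sqrt b * sqrt f / sqrt g * sqrt (g / (b * e)))" by simp
  also have "\<dots> = cross_upto m * (sqrt (f * s / e) / e)" unfolding sq cr using pos by simp
  finally show o: "open_sides N = - ((cross_upto m * (sqrt (w {lft m, above m} * w {above m, rgt m} / e) / e)) *\<^sub>R det 0 (lft m) (rgt m))"
    unfolding fs .
  define l where "l = w {lft m, above m}"
  define r where "r = w {above m, rgt m}"
  have lr: "l > 0" "r > 0" using side_arcs(1,2)[OF m1 m(2)] arc_pos by (simp_all add: l_def r_def)
  have sum: "with_sides N 0 + with_sides N 2 = (cross_upto m / e) *\<^sub>R (l *\<^sub>R lam V 0 (rgt m) + r *\<^sub>R lam V 0 (lft m))"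
    unfolding w0 w2 by (simp add: kept_def gone_def l_def r_def scaleR_add_right insert_commute)
  have sqd: "sqrt (l * r / e) = sqrt (l * r * e) / e"
  proof -
    have "sqrt (l * r / e) * e = sqrt (l * r / e) * sqrt (e * e)" using pos by simp
    also have "\<dots> = sqrt (l * r * e)" unfolding real_sqrt_mult[symmetric] using pos by simp
    finally show ?thesis using pos by (simp add: field_simps)
  qed
  have "total m = (cross_upto m / e) *\<^sub>R (l *\<^sub>R lam V 0 (rgt m) + r *\<^sub>R lam V 0 (lft m)
      - (sqrt (l * r * e) / e) *\<^sub>R (det 0 (lft m) (rgt m) * odd_var (Suc m)))"
    using total_Suc[OF N, folded m(1)]
    unfolding sum o l_def[symmetric] r_def[symmetric] sqd by (simp add: scaleR_diff_right)
  also have "\<dots> = (cross_upto m / e) *\<^sub>R (e *\<^sub>R lam V 0 (above m))"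
    using fan_relations(1)[OF m1 m(2)] by (simp add: l_def r_def e_def)
  finally show "total m = cross_upto m *\<^sub>R lam V 0 (above m)" using pos by simp
qed

lemma before_first_tile: "before_tile 0"
proof -
  have n1: "Suc 0 \<le> n - 1" using n2 by simp
  have k1: "kept (Suc 0) = n + 1" "gone (Suc 0) = 1" "below (Suc 0) = 0" "lft (Suc 0) = 1" "rgt (Suc 0) = n + 1"
    using diagonal_first by (simp_all add: kept_def gone_def kept_left_def below_def)
  have arcs: "{0, 1} \<in> all_arcs" "{0, n + 1} \<in> all_arcs" "{1, n + 1} \<in> all_arcs"
    using boundary_in(1)[of 0] boundary_in(2) T_in[of 1] diagonal_first n2 by auto
  note pos = arc_pos[OF arcs(1)] arc_pos[OF arcs(2)] arc_pos[OF arcs(3)]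
  have "even_part {#glue n k x 0, glue n k x 0#} = w {0, 1}"
    using tile_weights(1)[OF n1] pos by (simp add: even_part_def k1)
  moreover have "odd_upto n k x 0 M = {}" for M by (auto simp: in_odd_upto)
  ultimately have *: "total 0 = of_real (w {0, 1})" "closed_at_glue 0 = of_real (w {0, 1})" "open_at_glue 0 = 0"
    unfolding total_def closed_at_glue_def open_at_glue_def covers_snake_0 by (simp_all add: of_real_def)
  have "sqrt (w {0, 1} / (w {0, n + 1} * w {1, n + 1})) * sqrt (w {0, 1} * w {1, n + 1} * w {0, n + 1})
     = sqrt (w {0, 1} * w {0, 1})"
    unfolding real_sqrt_mult[symmetric] using pos by (simp add: field_simps)
  then have sq: "sqrt (w {0, 1} / (w {0, n + 1} * w {1, n + 1})) * sqrt (w {0, 1} * w {1, n + 1} * w {0, n + 1}) = w {0, 1}"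
    using pos by simp
  have "det 0 1 (n + 1) = (- eta 1 * sqrt (w {0, 1} * w {1, n + 1} * w {0, n + 1})) *\<^sub>R odd_var 1"
    using V_det0 by (simp add: first_mu_ok_def)
  then have "- (sqrt (w {0, 1} / (w {0, n + 1} * w {1, n + 1})) *\<^sub>R det 0 1 (n + 1))
     = (eta 1 * (sqrt (w {0, 1} / (w {0, n + 1} * w {1, n + 1})) * sqrt (w {0, 1} * w {1, n + 1} * w {0, n + 1}))) *\<^sub>R odd_var 1"
    by (simp add: mult_ac)
  also have "\<dots> = (eta 1 * w {0, 1}) *\<^sub>R odd_var 1" unfolding sq ..
  finally have D: "- (sqrt (w {0, 1} / (w {0, n + 1} * w {1, n + 1})) *\<^sub>R det 0 1 (n + 1)) = (eta 1 * w {0, 1}) *\<^sub>R odd_var 1" .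
  have 1: "total 0 = cross_upto 0 *\<^sub>R lam V 0 1" "closed_at_glue 0 = (cross_upto 0 * w {0, 1} / w {0, n + 1}) *\<^sub>R lam V 0 (n + 1)"
    using * lam_arc arcs pos by (simp_all add: cross_upto_def of_real_def)
  have 2: "closed_at_glue 0 * (eta 1 *\<^sub>R odd_var 1) + open_at_glue 0
       = - ((cross_upto 0 * sqrt (w {0, 1} / (w {0, n + 1} * w {1, n + 1}))) *\<^sub>R det 0 1 (n + 1))"
    unfolding * using D by (simp add: cross_upto_def of_real_def mult.commute)
  show ?thesis unfolding before_tile_def Let_def k1 using 1 2 by simp
qed

text \<open>
  The next tile is attached to the far edge of the previous one exactly if the fan changes, which
  exchanges the roles of \<open>h = 0\<close> and \<open>h = 2\<close>.  The sign \<open>\<eta>\<close> of a variable that opens a cycle is, up to a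
  common sign, the one in the exchange relation for the side along which the next diagonal lies.
\<close>

lemma before_next_tile:
  assumes m: "m = Suc N" "Suc m \<le> n - 1" and st: "before_tile N"
  shows "before_tile m"
proof -
  have m': "m \<le> n - 1" "1 \<le> m" "1 \<le> Suc m" "m \<noteq> n - 1" using m by auto
  have N: "Suc N \<le> n - 1" using m by simp
  define e where "e = w {lft m, rgt m}"
  define l where "l = w {lft m, above m}"
  define r where "r = w {above m, rgt m}"
  define c where "c = cross_upto m"
  have pos: "e > 0" "l > 0" "r > 0"
    using side_arcs(1,2)[OF m'(2,1)] T_in[OF m'(2,1)] arc_pos by (simp_all add: l_def r_def e_def)
  note after = after_tile[OF m(1) m'(1) st]
  note fan = fan_relations[OF m'(2,1), folded e_def l_def r_def]
  have hN: "horiz N \<longleftrightarrow> (odd m \<longleftrightarrow> \<not> kept_left m)" using horizontal_iff[OF N] m(1) by simp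
  have hm: "horiz m \<longleftrightarrow> (even m \<longleftrightarrow> \<not> kept_left (Suc m))" using horizontal_iff[OF m(2)] by simp
  have "glue n k x m = far_edge n k x N \<longleftrightarrow> (horiz m \<longleftrightarrow> horiz N)"
    unfolding m(1) glue_Suc far_edge_def using edge_inj by (auto split: if_splits)
  then have far: "glue n k x m = far_edge n k x N \<longleftrightarrow> (kept_left (Suc m) \<longleftrightarrow> \<not> kept_left m)"
    unfolding hN hm by auto
  have closed: "closed_at_glue m = (if kept_left (Suc m) then (c * r / e) *\<^sub>R lam V 0 (lft m) else (c * l / e) *\<^sub>R lam V 0 (rgt m))"
    using closed_at_glue_Suc[OF N, folded m(1)] far after(1,2)
    by (auto simp: kept_def gone_def c_def l_def r_def e_def insert_commute)
  have opn: "open_at_glue m = - ((c * (sqrt (l * r / e) / e)) *\<^sub>R det 0 (lft m) (rgt m))"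
    using open_at_glue_Suc[OF N, folded m(1)] after(3) by (simp add: c_def l_def r_def e_def)
  have tot: "total m = c *\<^sub>R lam V 0 (above m)" using after(4) by (simp add: c_def)
  show ?thesis
  proof (cases rule: above_cases[OF m'(2,1)])
    case 1 then show ?thesis using m' by simp
  next
    case 2
    then have kl: "kept_left (Suc m)" and b: "below (Suc m) = rgt m" and v: "kept (Suc m) = lft m" "gone (Suc m) = above m"
      using m' by (auto simp: kept_left_def below_def kept_def gone_def)
    have "center (Suc m) < k"
      using center_interior[of "Suc m"] m m' 2 diagonal(3)[OF m'(2,1)] by simp
    then have eta: "eta (Suc m) = 1" by (simp add: eta_def)
    have "det 0 (lft m) (above m) = (1 / e) *\<^sub>R (e *\<^sub>R det 0 (lft m) (above m))" using pos by simp
    also have "\<dots> = (l / e) *\<^sub>R det 0 (lft m) (rgt m) - (sqrt (l * r * e) / e) *\<^sub>R (lam V 0 (lft m) * odd_var (Suc m))"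
      unfolding fan(2) by (simp add: scaleR_diff_right)
    finally have "- ((c * sqrt (r / (e * l))) *\<^sub>R det 0 (lft m) (above m))
       = (c * (sqrt (r / (e * l)) * (sqrt (l * r * e) / e))) *\<^sub>R (lam V 0 (lft m) * odd_var (Suc m))
         - (c * (sqrt (r / (e * l)) * (l / e))) *\<^sub>R det 0 (lft m) (rgt m)"
      by (simp add: scaleR_diff_right mult.assoc)
    also have "\<dots> = (c * (r / e)) *\<^sub>R (lam V 0 (lft m) * odd_var (Suc m)) - (c * (sqrt (l * r / e) / e)) *\<^sub>R det 0 (lft m) (rgt m)"
      unfolding sqrt_identity_1[OF pos(2,3,1)] sqrt_identity_2[OF pos(2,3,1)] ..
    finally have D: "- ((c * sqrt (r / (e * l))) *\<^sub>R det 0 (lft m) (above m))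
       = closed_at_glue m * (eta (Suc m) *\<^sub>R odd_var (Suc m)) + open_at_glue m"
      unfolding closed opn eta using kl by simp
    have "w {rgt m, above m} = r" "w {rgt m, lft m} = e" by (simp_all add: r_def e_def insert_commute)
    then show ?thesis
      unfolding before_tile_def Let_def b v 2(2,3) using tot closed kl D by (simp add: c_def l_def)
  next
    case 3
    then have kl: "\<not> kept_left (Suc m)" and b: "below (Suc m) = lft m" and v: "kept (Suc m) = rgt m" "gone (Suc m) = above m"
      using m' by (auto simp: kept_left_def below_def kept_def gone_def)
    have "\<not> center (Suc m) < k"
      using center_interior[of "Suc m"] m m' 3 diagonal(4)[OF m'(2,1)] by simp
    then have eta: "eta (Suc m) = - 1" by (simp add: eta_def)
    have rle: "r * l * e = l * r * e" "r * l / e = l * r / e" by simp_all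
    have id: "sqrt (l / (e * r)) * (sqrt (l * r * e) / e) = l / e"
      "sqrt (l / (e * r)) * (r / e) = sqrt (l * r / e) / e"
      using sqrt_identity_1[OF pos(3,2,1)] sqrt_identity_2[OF pos(3,2,1)] unfolding rle by -
    have "det 0 (above m) (rgt m) = (1 / e) *\<^sub>R (e *\<^sub>R det 0 (above m) (rgt m))" using pos by simp
    also have "\<dots> = (r / e) *\<^sub>R det 0 (lft m) (rgt m) + (sqrt (l * r * e) / e) *\<^sub>R (lam V 0 (rgt m) * odd_var (Suc m))"
      unfolding fan(3) by (simp add: scaleR_add_right)
    finally have "- ((c * sqrt (l / (e * r))) *\<^sub>R det 0 (above m) (rgt m))
       = - (c * (sqrt (l / (e * r)) * (sqrt (l * r * e) / e))) *\<^sub>R (lam V 0 (rgt m) * odd_var (Suc m))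
         - (c * (sqrt (l / (e * r)) * (r / e))) *\<^sub>R det 0 (lft m) (rgt m)"
      by (simp add: scaleR_add_right mult.assoc)
    also have "\<dots> = - (c * (l / e)) *\<^sub>R (lam V 0 (rgt m) * odd_var (Suc m)) - (c * (sqrt (l * r / e) / e)) *\<^sub>R det 0 (lft m) (rgt m)"
      unfolding id by simp
    finally have D: "- ((c * sqrt (l / (e * r))) *\<^sub>R det 0 (above m) (rgt m))
       = closed_at_glue m * (eta (Suc m) *\<^sub>R odd_var (Suc m)) + open_at_glue m"
      unfolding closed opn eta using kl by simp
    show ?thesis
      unfolding before_tile_def Let_def b v 3(2,3) using tot closed kl D by (simp add: c_def l_def r_def e_def)
  qed
qed

lemma before_tile: "Suc N \<le> n - 1 \<Longrightarrow> before_tile N"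
proof (induction N)
  case 0 show ?case by (rule before_first_tile)
next
  case (Suc N)
  then show ?case using before_next_tile[of "Suc N" N] by simp
qed

definition last_tile :: nat where "last_tile = n - 2"

lemma last_tile: "Suc last_tile = n - 1" "Suc last_tile \<le> n - 1"
  using n2 by (simp_all add: last_tile_def)

lemma double_dimers_eq: "double_dimers n k x = covers (snake n k x (n - 1))"
proof -
  have "1 \<le> n - 1" using n2 by simp
  then have "snake_edges n k x = snake n k x (n - 1)" by (simp add: snake_edges_def snake_eq)
  then show ?thesis by (simp add: double_dimers_def covers_def)
qed

lemma odd_indices_eq: "odd_indices n k x M = odd_upto n k x (n - 1) M"
  unfolding odd_indices_def odd_upto_def surrounds_def ..

lemma even_weight_eq: "even_weight n k x w M = even_part M"
  unfolding even_weight_def even_part_def root_weight_def ..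

lemma odd_indices_subset: "odd_upto n k x (n - 1) M \<subseteq> {1..n}"
  using odd_upto_bound[of n k x "n - 1" M] n2 by auto

lemma cross_eq: "cross n x w = cross_upto (n - 1)"
  unfolding cross_def cross_upto_def by (rule prod.cong) (use diagonal(1) in auto)

lemma cross_pos: "cross n x w > 0"
  unfolding cross_eq cross_upto_def by (rule prod_pos) (use arc_pos T_in in auto)

lemma dimer_formula_length:
  "super_length D {0, k} = (\<Sum>M\<in>double_dimers n k x. wt n k j x w (\<lambda>m. mu D (tri n k x m)) M) /\<^sub>R cross n x w"
proof -
  have "(\<Sum>M\<in>double_dimers n k x. wt n k j x w (\<lambda>m. mu D (tri n k x m)) M) = total (n - 1)"
    unfolding double_dimers_eq total_def
  proof (rule sum.cong[OF refl])
    fix M assume M: "M \<in> covers (snake n k x (n - 1))"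
    have "pos_product n k j x (\<lambda>m. mu D (tri n k x m)) (odd_upto n k x (n - 1) M)
        = pos_product n k j x odd_var (odd_upto n k x (n - 1) M)"
      by (rule pos_product_cong[OF odd_indices_subset]) (use mu_tri odd_indices_subset in force)
    also have "\<dots> = index_product (odd_upto n k x (n - 1) M)"
      by (rule pos_product_even[OF odd_indices_subset even_odd_upto[OF M]])
    finally show "wt n k j x w (\<lambda>m. mu D (tri n k x m)) M = even_part M *\<^sub>R index_product (odd_upto n k x (n - 1) M)"
      by (simp add: wt_def odd_indices_eq even_weight_eq)
  qed
  also have "\<dots> = cross n x w *\<^sub>R lam V 0 k"
    using after_tile(4)[OF refl last_tile(2) before_tile[OF last_tile(2)]]
    by (simp add: last_tile(1) cross_eq above_def)
  finally show ?thesis using super_length_0k cross_pos by simp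
qed

text \<open>
  Reversing the right fans multiplies every variable by its sign \<open>\<eta>\<close>.
\<close>

lemma mu_reversed:
  assumes "1 \<le> m" "m \<le> n"
  shows "mu (reverse_right_fans n k j x D) (tri n k x m) = eta m *\<^sub>R odd_var m"
proof -
  have "center m \<noteq> k"
  proof (cases "m = n")
    case True
    have "center n \<in> {lft (n - 1), rgt (n - 1)}" using center_in_diagonal(2)[of "n - 1"] n2 by simp
    then show ?thesis using True diagonal_last k_bounds by auto
  next
    case False
    then have m: "1 \<le> m" "m \<le> n - 1" using assms by auto
    then show ?thesis using center_in_diagonal(1)[OF m] diagonal(3,4)[OF m] by auto
  qed
  moreover have "tri n k x m \<in> tri n k x ` {m \<in> {1..n}. k < center m} \<longleftrightarrow> k < center m"
    using assms inj_onD[OF tri_inj, of m] by auto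
  ultimately show ?thesis
    unfolding reverse_right_fans_def reverse_triangles_def using mu_tri[OF assms] by (simp add: eta_def)
qed

lemma toggled_weight:
  assumes "M \<in> covers (snake n k x (n - 1))"
  shows "wt_star n k j x w (\<lambda>m. mu (reverse_right_fans n k j x D) (tri n k x m)) M
     = even_part M *\<^sub>R index_product (toggle n (odd_upto n k x (n - 1) M))"
proof -
  define S where "S = odd_upto n k x (n - 1) M"
  have S: "S \<subseteq> {1..n}" "finite S" "even (card S)"
    using odd_indices_subset even_odd_upto[OF assms] by (simp_all add: S_def)
  have t: "toggle n S \<subseteq> {1..n}" using S(1) n2 by (auto simp: toggle_def)
  have "odd (card (toggle n S))"
  proof (cases "n \<in> S")
    case True
    then have "card S = Suc (card (S - {n}))" using S(2) by (metis card_Suc_Diff1)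
    then show ?thesis using True S(3) by (simp add: toggle_def)
  next
    case False
    then show ?thesis using S by (simp add: toggle_def)
  qed
  then have "pos_product n k j x (\<lambda>m. eta m *\<^sub>R odd_var m) (toggle n S) = index_product (toggle n S)"
    by (rule pos_product_odd[OF t])
  moreover have "pos_product n k j x (\<lambda>m. mu (reverse_right_fans n k j x D) (tri n k x m)) (toggle n S)
      = pos_product n k j x (\<lambda>m. eta m *\<^sub>R odd_var m) (toggle n S)"
    by (rule pos_product_cong[OF t]) (use mu_reversed t in force)
  ultimately show ?thesis by (simp add: wt_star_def odd_indices_eq even_weight_eq S_def)
qed

lemma eta_last: "eta n = 1"
  using last_center j_left by (simp add: eta_def)

text \<open>
  If no cycle reaches the last tile, toggling appends \<open>\<theta>\<^sub>n\<close> to a product of even length; such covers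
  that use the edge \<open>{k, l}\<close> add up to a bracket.  If a cycle does, it closes with \<open>\<theta>\<^sub>n\<close>, and toggling
  leaves the product of an open cycle, as in the sum that gives the odd invariant.
\<close>

lemma toggled_sum:
  "(\<Sum>M\<in>double_dimers_using (if odd n then Top else Right) n k x.
      wt_star n k j x w (\<lambda>m. mu (reverse_right_fans n k j x D) (tri n k x m)) M)
   = with_sides last_tile (if kept_left (n - 1) then 2 else 0) * odd_var n + open_sides last_tile"
proof -
  define N where "N = last_tile"
  have N: "Suc N = n - 1" "Suc N \<le> n - 1" "Suc (n - 1) = n" using last_tile n2 by (simp_all add: N_def)
  define b where "b = tile_edge n k x (n - 1) (if odd n then Top else Right)"
  have "odd n \<longleftrightarrow> even (Suc N)" using N n2 by presburger
  then have b: "b = (if kept_left (n - 1) then side_edge n k x N else far_edge n k x N)"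
    unfolding b_def side_edge_def far_edge_def horizontal_iff[OF N(2)] N(1) by auto
  have "(\<Sum>M\<in>double_dimers_using (if odd n then Top else Right) n k x.
      wt_star n k j x w (\<lambda>m. mu (reverse_right_fans n k j x D) (tri n k x m)) M)
    = (\<Sum>M\<in>covers (snake n k x (n - 1)). if b \<in># M then even_part M *\<^sub>R index_product (toggle n (odd_upto n k x (n - 1) M)) else 0)"
  proof -
    have "double_dimers_using (if odd n then Top else Right) n k x = {M \<in> covers (snake n k x (n - 1)). b \<in># M}"
      unfolding double_dimers_using_def double_dimers_eq b_def ..
    then have "(\<Sum>M\<in>double_dimers_using (if odd n then Top else Right) n k x.
        wt_star n k j x w (\<lambda>m. mu (reverse_right_fans n k j x D) (tri n k x m)) M)
      = (\<Sum>M\<in>covers (snake n k x (n - 1)). if b \<in># M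
         then wt_star n k j x w (\<lambda>m. mu (reverse_right_fans n k j x D) (tri n k x m)) M else 0)"
      by (simp only: sum.inter_filter[OF finite_covers_snake])
    also have "\<dots> = (\<Sum>M\<in>covers (snake n k x (n - 1)). if b \<in># M
         then even_part M *\<^sub>R index_product (toggle n (odd_upto n k x (n - 1) M)) else 0)"
      by (rule sum.cong[OF refl]) (simp only: toggled_weight)
    finally show ?thesis .
  qed
  also have "\<dots> = (\<Sum>M\<in>covers (snake n k x (Suc N)).
      (if count M (side_edge n k x N) = (if kept_left (n - 1) then 2 else 0) then even_part M *\<^sub>R index_product (odd_upto n k x (Suc N) M) else 0)
        * odd_var n
      + (if count M (side_edge n k x N) = 1 then even_part M *\<^sub>R index_product (odd_upto n k x (Suc N) M - {Suc (Suc N)}) else 0))"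
    unfolding N(1)[symmetric]
  proof (rule sum.cong[OF refl])
    fix M assume M: "M \<in> covers (snake n k x (Suc N))"
    obtain L h where L: "L \<in> covers (snake n k x N)" "h \<le> count L (glue n k x N)" "M = attach_tile n k x N L h"
      using M covers_snake_Suc_cases by metis
    define S where "S = odd_upto n k x (Suc N) M"
    have c: "count M (side_edge n k x N) = h" "count M (far_edge n k x N) = 2 - h" "h \<le> 2"
      using attach_counts(1,3)[OF L(1,2)] h_le[OF L(1,2)] L(3) by simp_all
    have n': "Suc (Suc N) = n" using N by simp
    have S: "S \<subseteq> {1..n}" "finite S" "even (card S)" "n \<in> S \<longleftrightarrow> h = 1"
      using odd_upto_bound[of n k x "Suc N" M] even_odd_upto[OF M] last_odd_iff[OF M] count_glue_Suc[OF L(1,2)] L(3)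
      by (simp_all add: S_def n')
    \<comment> \<open>The appended factor follows evenly many others, so it carries the sign \<open>\<eta> n\<close>, which is \<open>1\<close> because the
      last fan center is to the left of \<open>f\<close>.\<close>
    have key: "index_product (toggle n S) = index_product S * odd_var n" if "h \<noteq> 1"
    proof -
      have "n \<notin> S" using S(4) that by simp
      moreover have "s < n" if "s \<in> S" for s using S(1) that \<open>n \<notin> S\<close> by (metis atLeastAtMost_iff le_neq_implies_less subsetD)
      ultimately show ?thesis using index_product_insert[OF S(2), of n] S(3) eta_last by (simp add: toggle_def)
    qed
    have key': "toggle n S = S - {n}" if "h = 1" using S(4) that by (simp add: toggle_def)
    have mem: "b \<in># M \<longleftrightarrow> (if kept_left (n - 1) then h \<noteq> 0 else h \<noteq> 2)"
      unfolding b using c by (auto simp: count_greater_zero_iff[symmetric] simp del: count_greater_zero_iff)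
    consider "h = 0" | "h = 1" | "h = 2" using c(3) by linarith
    then show "(if b \<in># M then even_part M *\<^sub>R index_product (toggle n (odd_upto n k x (Suc N) M)) else 0)
      = (if count M (side_edge n k x N) = (if kept_left (Suc N) then 2 else 0) then even_part M *\<^sub>R index_product (odd_upto n k x (Suc N) M) else 0)
        * odd_var n
      + (if count M (side_edge n k x N) = 1 then even_part M *\<^sub>R index_product (odd_upto n k x (Suc N) M - {Suc (Suc N)}) else 0)"
      unfolding c(1) n' N(1) S_def[symmetric, unfolded N(1)] mem
      using N(3) by cases (simp_all add: key key')
  qed
  also have "\<dots> = with_sides N (if kept_left (n - 1) then 2 else 0) * odd_var n + open_sides N"
    unfolding with_sides_def open_sides_def by (simp only: sum.distrib sum_distrib_right)
  finally show ?thesis by (simp add: N_def)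
qed

text \<open>
  The toggled sum is the right-hand side of the exchange relation for the odd invariant of
  \<open>(0, j, k)\<close>, and this is the mu-invariant up to the square roots of the sides.
\<close>

lemma dimer_formula_mu:
  "gsqrt (super_length D {0, j} * super_length D {0, k}) * flipped_mu n j k l D =
     (sqrt (w {j, l} / w {k, l}) / cross n x w) *\<^sub>R
     (\<Sum>M\<in>double_dimers_using (if odd n then Top else Right) n k x.
        wt_star n k j x w (\<lambda>m. mu (reverse_right_fans n k j x D) (tri n k x m)) M)"
proof -
  define m where "m = n - 1"
  have m: "m = Suc last_tile" "m \<le> n - 1" "1 \<le> m" "Suc m = n" using last_tile n2 by (simp_all add: m_def)
  have v: "lft m = j" "rgt m = l" "above m = k" using diagonal_last by (simp_all add: m_def above_def)
  define a where "a = w {j, k}"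
  define b where "b = w {k, l}"
  define e where "e = w {j, l}"
  define c where "c = cross_upto m"
  have pos: "a > 0" "b > 0" "e > 0" using arc_pos last_arcs by (simp_all add: a_def b_def e_def)
  have c: "c > 0" "cross n x w = c" using cross_pos cross_eq by (simp_all add: c_def m_def)
  note after = after_tile[OF m(1,2) before_tile[OF last_tile(2)], unfolded v, folded a_def b_def e_def c_def]
  have "with_sides last_tile (if kept_left m then 2 else 0) = (c * b / e) *\<^sub>R lam V 0 j"
    using after(1,2) by (auto simp: kept_def gone_def v b_def insert_commute)
  then have sum: "(\<Sum>M\<in>double_dimers_using (if odd n then Top else Right) n k x.
        wt_star n k j x w (\<lambda>m. mu (reverse_right_fans n k j x D) (tri n k x m)) M)
     = c *\<^sub>R ((b / e) *\<^sub>R (lam V 0 j * odd_var n) - (sqrt (a * b / e) / e) *\<^sub>R det 0 j l)"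
    unfolding toggled_sum m_def[symmetric] after(3) by (simp add: scaleR_diff_right)
  have fan: "e *\<^sub>R det 0 j k = a *\<^sub>R det 0 j l - sqrt (a * b * e) *\<^sub>R (lam V 0 j * odd_var n)"
    using fan_relations(2)[OF m(3,2)] unfolding v m(4) by (simp add: a_def b_def e_def)
  have d: "j \<noteq> k" "j \<noteq> 0" "k \<noteq> 0" using diagonal_last k_bounds by auto
  define G where "G = gsqrt (lam V 0 j * lam V 0 k)"
  have G: "G = rt 0 j * rt 0 k" unfolding G_def by (rule gsqrt_mult) (use lam_pos_0j in simp_all)
  have ev: "geven (rt 0 j)" "geven (rt 0 k)" using lam_pos_0j by (simp_all add: gsqrt_props)
  have roots: "rt j k * (rt k 0 * rt j 0) = of_real (sqrt a) * G"
    unfolding G root_arc[OF last_arcs(1)] using lam_sym[of 0 k] lam_sym[of 0 j] d geven_commute[OF ev(1), of "rt 0 k"]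
    by (simp add: a_def)
  have evG: "geven G" using ev by (simp add: G)
  have "sqrt a *\<^sub>R (G * flipped_mu n j k l D) = flipped_mu n j k l D * (rt j k * (rt k 0 * rt j 0))"
    unfolding roots using geven_commute[OF evG, of "flipped_mu n j k l D"] by (simp add: of_real_def)
  also have "\<dots> = - det 0 j k" unfolding flipped_mu_eq det3_rotate[of j k 0] ..
  finally have lhs: "sqrt a *\<^sub>R (G * flipped_mu n j k l D) = - det 0 j k" .
  have s1: "sqrt a * (sqrt (e / b) * (b / e)) = sqrt (a * b * e) / e"
  proof -
    have "sqrt a * (sqrt (e / b) * b) = sqrt a * (sqrt (e / b) * sqrt (b * b))" using pos by simp
    also have "\<dots> = sqrt (a * b * e)" unfolding real_sqrt_mult[symmetric] using pos by (simp add: field_simps)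
    finally show ?thesis by (simp add: mult.assoc)
  qed
  have s2: "sqrt a * (sqrt (e / b) * (sqrt (a * b / e) / e)) = a / e"
  proof -
    have "sqrt a * (sqrt (e / b) * sqrt (a * b / e)) = sqrt (a * a)"
      unfolding real_sqrt_mult[symmetric] using pos by (simp add: field_simps)
    then show ?thesis using pos by (simp add: mult.assoc)
  qed
  have "sqrt a *\<^sub>R (sqrt (e / b) *\<^sub>R ((b / e) *\<^sub>R (lam V 0 j * odd_var n) - (sqrt (a * b / e) / e) *\<^sub>R det 0 j l))
     = (sqrt a * (sqrt (e / b) * (b / e))) *\<^sub>R (lam V 0 j * odd_var n)
       - (sqrt a * (sqrt (e / b) * (sqrt (a * b / e) / e))) *\<^sub>R det 0 j l"
    by (simp add: scaleR_diff_right)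
  also have "\<dots> = - ((1 / e) *\<^sub>R (a *\<^sub>R det 0 j l - sqrt (a * b * e) *\<^sub>R (lam V 0 j * odd_var n)))"
    unfolding s1 s2 by (simp add: scaleR_diff_right)
  also have "\<dots> = - det 0 j k" unfolding fan[symmetric] using pos by simp
  finally have "sqrt a *\<^sub>R (G * flipped_mu n j k l D)
     = sqrt a *\<^sub>R (sqrt (e / b) *\<^sub>R ((b / e) *\<^sub>R (lam V 0 j * odd_var n) - (sqrt (a * b / e) / e) *\<^sub>R det 0 j l))"
    using lhs by simp
  then have "G * flipped_mu n j k l D
     = sqrt (e / b) *\<^sub>R ((b / e) *\<^sub>R (lam V 0 j * odd_var n) - (sqrt (a * b / e) / e) *\<^sub>R det 0 j l)"
    by (rule scaleR_left_imp_eq[rotated]) (use pos in simp)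
  then show ?thesis
    unfolding sum super_length_0j super_length_0k G_def[symmetric] c(2) e_def[symmetric] b_def[symmetric] using c(1) by simp
qed

end

theorem theorem6p2:
  fixes n k j l :: nat
    and T :: "nat set set"
    and x :: "nat \<Rightarrow> nat set"
    and w :: "nat set \<Rightarrow> real"
    and D :: decorated
  assumes "n \<ge> 2"
    and "triangulation (n + 2) T"
    and "k < n + 2" and "\<forall>d\<in>T. crosses {0, k} d"
    and "bij_betw x {1..n - 1} T"
    and "\<forall>m m'. 1 \<le> m \<and> m < m' \<and> m' \<le> n - 1 \<longrightarrow> crossed_before (x m) (x m')"
    and "x (n - 1) = {j, l}" and "fan_center n j x n = j" and "j < k"
    and "\<forall>d \<in> T \<union> boundary (n + 2). w d > 0"
    and "default_decorated n k j x T w D"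
  shows "super_length D {0, k} =
           (\<Sum>M\<in>double_dimers n k x. wt n k j x w (\<lambda>m. mu D (tri n k x m)) M) /\<^sub>R cross n x w \<and>
         gsqrt (super_length D {0, j} * super_length D {0, k}) * flipped_mu n j k l D =
           (sqrt (w {j, l} / w {k, l}) / cross n x w) *\<^sub>R
           (\<Sum>M\<in>double_dimers_using (if odd n then Top else Right) n k x.
              wt_star n k j x w (\<lambda>m. mu (reverse_right_fans n k j x D) (tri n k x m)) M)"
proof -
  interpret crossed_triangulation n k j l T x w D
    by unfold_locales (rule assms)+
  obtain V where V: "\<And>i. super_vector (V i)" "\<And>a b. {a, b} \<in> T \<union> boundary (n + 2) \<Longrightarrow> length_ok V a b"
    "first_mu_ok V" "\<And>m. 1 \<le> m \<Longrightarrow> m \<le> n - 1 \<Longrightarrow> mu_ok V m"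
    using vectors_exist by blast
  interpret realized_triangulation n k j l T x w D V
    by unfold_locales (rule V; assumption)+
  show ?thesis using dimer_formula_length dimer_formula_mu by blast
qed

end
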